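(* Let $n\ge2$ and let $\mathbf t=(t_0,u_0,t,t_n,u_n)$ be such that $a,b,c,d,t>0$, where $(a,b,c,d)=(t_n+u_n,\,t_n-u_n,\,t_0+u_0+\tfrac12,\,t_0-u_0+\tfrac12)$, and such that $\gamma_\lambda\neq\gamma_\mu$ whenever $\lambda\ne\mu$ in $\Lambda=\mathbb Z^n$. Then the nonsymmetric multivariable Wilson polynomials $p_\lambda$, $\lambda\in\Lambda$, form an orthogonal basis of $\mathcal P=\mathbb C[x_1,\dots,x_n]$ with respect to the bilinear form $\langle\cdot,\cdot\rangle_{\mathbf t}$, i.e. $$\langle p_\lambda,p_\mu\rangle_{\mathbf t}=0,\qquad\lambda\ne\mu .$$
   Context: Notation: $[m,n]=\{m,m+1,\dots,n\}$, $\mathcal P=\mathbb C[x_1,\dots,x_n]$, $\Lambda=\mathbb Z^n$. $W$ is the affine Weyl group of type $\widetilde C_n$, the Coxeter group with generators $s_0,\dots,s_n$, realized faithfully on $\mathbb C^n$ by $s_0x=(1-x_1,x_2,\dots,x_n)$, $s_i$ interchanging $x_i$ and $x_{i+1}$ ($i\in[1,n-1]$), $s_nx=(x_1,\dots,x_{n-1},-x_n)$; it acts on functions by $(wp)(x)=p(w^{-1}x)$. Put $a_0(x)=1-2x_1$, $a_i(x)=x_i-x_{i+1}$ ($i\in[1,n-1]$), $a_n(x)=2x_n$. Operators on $\mathcal P$: $X_i$ is multiplication by $x_i$, and $T_ip=\chi_i\,s_ip+d_i\,(s_ip-p)$ ($i\in[0,n]$), where $\chi_0=t_0$, $\chi_n=t_n$,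 $\chi_i=1$ for $i\in[1,n-1]$, $d_0(x)=\frac{t_0^2-u_0^2+(\frac12-x_1)^2}{1-2x_1}$, $d_i(x)=\frac{t}{x_i-x_{i+1}}$ ($i\in[1,n-1]$), $d_n(x)=\frac{t_n^2-u_n^2+x_n^2}{2x_n}$. For $1\le i<j\le n$ put $T_{i,j}=T_iT_{i+1}\cdots T_{j-2}T_{j-1}T_{j-2}\cdots T_{i+1}T_i$. The operators $$Y_i=T_i\cdots T_{n-1}T_nT_{n-1}\cdots T_i+T_{i-1}\cdots T_1T_0T_1\cdots T_{i-1}+t\sum_{j=i+1}^nT_{i,j}\qquad(i\in[1,n])$$ commute pairwise, and $f(Y)$ denotes $f$ evaluated at $(Y_1,\dots,Y_n)$. Put $U_n=T_1\cdots T_{n-1}(-X_n-T_n)T_{n-1}\cdots T_1$. Intertwiners: $S_0=[U_n,a_0(Y)]$, $S_i=[T_i,a_i(Y)]$ ($i\in[1,n]$). They satisfy the braid relations of $W$, so $S_w=S_{i_1}\cdots S_{i_r}$ for a reduced expression $w=s_{i_1}\cdots s_{i_r}$ is well defined ($S_1=1$). The dot action of $W$ on $\mathbb C^n$ is $s_i\cdot x=s_ix$ for $i\in[1,n]$ and $s_0\cdot x=(-x_1-1,x_2,\dots,x_n)$; it preserves $\Lambda$. For $\lambda\in\Lambda$, $u_\lambda$ is the unique shortest element of $W$ (length with respect to $s_0,\dots,s_n$) with $u_\lambda\cdot0=\lambda$. The nonsymmetric multivariable Wilson polynomial is $p_\lambda=S_{u_\lambda}1\in\mathcal P$. Finally $\gamma_0=(\gamma_{0,1},\dots,\gamma_{0,n})$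 with $\gamma_{0,i}=t_0+t_n+(n-i)t$ and $\gamma_\lambda=u_\lambda\cdot\gamma_0$. Bilinear form: with $\Gamma(\alpha\pm\beta)=\Gamma(\alpha+\beta)\Gamma(\alpha-\beta)$, and $\Gamma(\alpha\pm\beta\pm\gamma)$ the product over all four sign choices, $$\Delta_+(x)=\prod_{1\le j<k\le n}\frac{\Gamma(t\pm x_j\pm x_k)}{\Gamma(\pm x_j\pm x_k)}\prod_{j=1}^n\frac{\Gamma(a\pm x_j)\Gamma(b\pm x_j)\Gamma(c\pm x_j)\Gamma(d\pm x_j)}{\Gamma(\pm2x_j)},$$ $$c_+(x)=\prod_{1\le j<k\le n}\frac{(t-x_j+x_k)(t-x_j-x_k)}{(x_k-x_j)(-x_j-x_k)}\prod_{j=1}^n\frac{(a-x_j)(b-x_j)}{-2x_j},\qquad\Delta(x)=c_+(x)\Delta_+(x),$$ $$\langle f,g\rangle_{\mathbf t}=\frac1{(2\pi\mathrm i)^n}\int_{(\mathrm i\mathbb R)^n}f(x)g(x)\Delta(x)\,dx_1\cdots dx_n,$$ with $\mathrm i\mathbb R$ in its standard (upward) orientation. *)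

theory Defs
  imports
    "HOL-Analysis.Analysis"
    "HOL-Library.Function_Algebras"
    "HOL-Library.Complex_Order"
begin

text \<open>
  A point of \<open>\<complex>\<^sup>n\<close> is a function \<^typ>\<open>nat \<Rightarrow> complex\<close> of which only the coordinates
  \<open>1, \<dots>, n\<close> matter.  Since \<open>\<complex>\<close> is infinite, polynomials in \<open>x\<^sub>1, \<dots>, x\<^sub>n\<close> are identified with the
  polynomial functions of these coordinates.
\<close>

type_synonym point = "nat \<Rightarrow> complex"
type_synonym cfun = "point \<Rightarrow> complex"

inductive_set Pol :: "nat \<Rightarrow> cfun set" for n :: nat where
  Pol_const: "(\<lambda>x. c) \<in> Pol n"
| Pol_var: "i \<in> {1..n} \<Longrightarrow> (\<lambda>x. x i) \<in> Pol n"
| Pol_add: "p \<in> Pol n \<Longrightarrow> q \<in> Pol n \<Longrightarrow> (\<lambda>x. p x + q x) \<in> Pol n"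
| Pol_mult: "p \<in> Pol n \<Longrightarrow> q \<in> Pol n \<Longrightarrow> (\<lambda>x. p x * q x) \<in> Pol n"

interpretation cfun: vector_space "\<lambda>(c::complex) (f::cfun) x. c * f x"
  by unfold_locales (auto simp: fun_eq_iff algebra_simps)

definition Lam :: "nat \<Rightarrow> (nat \<Rightarrow> int) set" where
  "Lam n = {\<nu>. \<forall>i. i \<notin> {1..n} \<longrightarrow> \<nu> i = 0}"

record wilson_params =
  par_t0 :: complex
  par_u0 :: complex
  par_t :: complex
  par_tn :: complex
  par_un :: complex

text \<open>For complex \<open>z\<close>, \<^term>\<open>0 < z\<close> (theory \<open>Complex_Order\<close>) says that \<open>z\<close> is real and positive.\<close>

definition par_a :: "wilson_params \<Rightarrow> complex" where
  "par_a \<tau> = par_tn \<tau> + par_un \<tau>"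

definition par_b :: "wilson_params \<Rightarrow> complex" where
  "par_b \<tau> = par_tn \<tau> - par_un \<tau>"

definition par_c :: "wilson_params \<Rightarrow> complex" where
  "par_c \<tau> = par_t0 \<tau> + par_u0 \<tau> + 1/2"

definition par_d :: "wilson_params \<Rightarrow> complex" where
  "par_d \<tau> = par_t0 \<tau> - par_u0 \<tau> + 1/2"


subsection \<open>The affine Weyl group\<close>

definition gen :: "nat \<Rightarrow> nat \<Rightarrow> point \<Rightarrow> point" where
  "gen n i x =
     (if i = 0 then x(1 := 1 - x 1)
      else if i = n then x(n := - x n)
      else x(i := x (i + 1), i + 1 := x i))"

text \<open>
  In this theory \<open>foldr F [i\<^sub>1, \<dots>, i\<^sub>r]\<close> is the composition \<open>F i\<^sub>1 \<circ> \<dots> \<circ> F i\<^sub>r\<close>.  As the realization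
  is faithful, the group is taken to be the group of transformations generated by the \<^term>\<open>gen n i\<close>.
\<close>

definition W :: "nat \<Rightarrow> (point \<Rightarrow> point) set" where
  "W n = {foldr (gen n) is | is. set is \<subseteq> {0..n}}"

definition len :: "nat \<Rightarrow> (point \<Rightarrow> point) \<Rightarrow> nat" where
  "len n w = (LEAST k. \<exists>is. set is \<subseteq> {0..n} \<and> foldr (gen n) is = w \<and> length is = k)"

definition reduced_expr :: "nat \<Rightarrow> (point \<Rightarrow> point) \<Rightarrow> nat list \<Rightarrow> bool" where
  "reduced_expr n w is \<longleftrightarrow> set is \<subseteq> {0..n} \<and> foldr (gen n) is = w \<and> length is = len n w"

definition red :: "nat \<Rightarrow> (point \<Rightarrow> point) \<Rightarrow> nat list" where
  "red n w = (SOME is. reduced_expr n w is)"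

definition act :: "(point \<Rightarrow> point) \<Rightarrow> cfun \<Rightarrow> cfun" where
  "act w p = (\<lambda>x. p (inv w x))"

definition dot_gen :: "nat \<Rightarrow> nat \<Rightarrow> point \<Rightarrow> point" where
  "dot_gen n i x = (if i = 0 then x(1 := - x 1 - 1) else gen n i x)"

text \<open>That the choice of the expression of \<open>w\<close> is irrelevant is lemma \<open>dot_eq\<close> below.\<close>

definition dot :: "nat \<Rightarrow> (point \<Rightarrow> point) \<Rightarrow> point \<Rightarrow> point" where
  "dot n w = foldr (dot_gen n) (red n w)"

definition u :: "nat \<Rightarrow> (nat \<Rightarrow> int) \<Rightarrow> point \<Rightarrow> point" where
  "u n \<nu> = (THE w. is_arg_min (len n) (\<lambda>w. w \<in> W n \<and> dot n w (\<lambda>i. 0) = (\<lambda>i. of_int (\<nu> i))) w)"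

definition gamma0 :: "nat \<Rightarrow> wilson_params \<Rightarrow> point" where
  "gamma0 n \<tau> = (\<lambda>i. if i \<in> {1..n} then par_t0 \<tau> + par_tn \<tau> + of_nat (n - i) * par_t \<tau> else 0)"

definition gamma :: "nat \<Rightarrow> wilson_params \<Rightarrow> (nat \<Rightarrow> int) \<Rightarrow> point" where
  "gamma n \<tau> \<nu> = dot n (u n \<nu>) (gamma0 n \<tau>)"


subsection \<open>The operators\<close>

definition aff :: "nat \<Rightarrow> nat \<Rightarrow> point \<Rightarrow> complex" where
  "aff n i x = (if i = 0 then 1 - 2 * x 1 else if i = n then 2 * x n else x i - x (i + 1))"

definition chi :: "nat \<Rightarrow> wilson_params \<Rightarrow> nat \<Rightarrow> complex" where
  "chi n \<tau> i = (if i = 0 then par_t0 \<tau> else if i = n then par_tn \<tau> else 1)"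

definition dcoef :: "nat \<Rightarrow> wilson_params \<Rightarrow> nat \<Rightarrow> point \<Rightarrow> complex" where
  "dcoef n \<tau> i x =
     (if i = 0 then ((par_t0 \<tau>)\<^sup>2 - (par_u0 \<tau>)\<^sup>2 + (1/2 - x 1)\<^sup>2) / (1 - 2 * x 1)
      else if i = n then ((par_tn \<tau>)\<^sup>2 - (par_un \<tau>)\<^sup>2 + (x n)\<^sup>2) / (2 * x n)
      else par_t \<tau> / (x i - x (i + 1)))"

text \<open>
  The formula for \<open>T\<^sub>i p\<close> makes sense pointwise only off the zero set of the denominator \<^term>\<open>aff n i\<close>;
  \<open>T\<^sub>i p\<close> is the polynomial given by it there.  Existence and uniqueness are lemma \<open>T_ex1\<close> below.
\<close>

definition T :: "nat \<Rightarrow> wilson_params \<Rightarrow> nat \<Rightarrow> cfun \<Rightarrow> cfun" where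
  "T n \<tau> i p = (THE q. q \<in> Pol n \<and>
     (\<forall>x. aff n i x \<noteq> 0 \<longrightarrow>
        q x = chi n \<tau> i * act (gen n i) p x + dcoef n \<tau> i x * (act (gen n i) p x - p x)))"

definition T2 :: "nat \<Rightarrow> wilson_params \<Rightarrow> nat \<Rightarrow> nat \<Rightarrow> cfun \<Rightarrow> cfun" where
  "T2 n \<tau> i j = foldr (T n \<tau>) ([i..<j - 1] @ [j - 1] @ rev [i..<j - 1])"

definition Y :: "nat \<Rightarrow> wilson_params \<Rightarrow> nat \<Rightarrow> cfun \<Rightarrow> cfun" where
  "Y n \<tau> i p = (\<lambda>x.
     foldr (T n \<tau>) ([i..<n] @ [n] @ rev [i..<n]) p x
     + foldr (T n \<tau>) (rev [1..<i] @ [0] @ [1..<i]) p x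
     + par_t \<tau> * (\<Sum>j = i + 1..n. T2 n \<tau> i j p x))"

definition U :: "nat \<Rightarrow> wilson_params \<Rightarrow> cfun \<Rightarrow> cfun" where
  "U n \<tau> p =
     foldr (T n \<tau>) [1..<n]
       ((\<lambda>q x. - x n * q x - T n \<tau> n q x)
         (foldr (T n \<tau>) (rev [1..<n]) p))"

text \<open>\<open>a\<^sub>i(Y)\<close>: the affine function \<^term>\<open>aff n i\<close> with \<open>Y\<^sub>j\<close> substituted for \<open>x\<^sub>j\<close>, and \<open>1\<close> the identity\<close>

definition aff_Y :: "nat \<Rightarrow> wilson_params \<Rightarrow> nat \<Rightarrow> cfun \<Rightarrow> cfun" where
  "aff_Y n \<tau> i p = (\<lambda>x.
     if i = 0 then p x - 2 * Y n \<tau> 1 p x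
     else if i = n then 2 * Y n \<tau> n p x
     else Y n \<tau> i p x - Y n \<tau> (i + 1) p x)"

definition commutator :: "(cfun \<Rightarrow> cfun) \<Rightarrow> (cfun \<Rightarrow> cfun) \<Rightarrow> cfun \<Rightarrow> cfun" where
  "commutator A B p = (\<lambda>x. A (B p) x - B (A p) x)"

definition S_gen :: "nat \<Rightarrow> wilson_params \<Rightarrow> nat \<Rightarrow> cfun \<Rightarrow> cfun" where
  "S_gen n \<tau> i = commutator (if i = 0 then U n \<tau> else T n \<tau> i) (aff_Y n \<tau> i)"

definition S :: "nat \<Rightarrow> wilson_params \<Rightarrow> (point \<Rightarrow> point) \<Rightarrow> cfun \<Rightarrow> cfun" where
  "S n \<tau> w = foldr (S_gen n \<tau>) (red n w)"

definition wilson_poly :: "nat \<Rightarrow> wilson_params \<Rightarrow> (nat \<Rightarrow> int) \<Rightarrow> cfun" where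
  "wilson_poly n \<tau> \<nu> = S n \<tau> (u n \<nu>) (\<lambda>x. 1)"


subsection \<open>The bilinear form\<close>

definition Gamma_pm :: "complex \<Rightarrow> complex \<Rightarrow> complex" where
  "Gamma_pm \<alpha> \<beta> = Gamma (\<alpha> + \<beta>) * Gamma (\<alpha> - \<beta>)"

definition Gamma_pm2 :: "complex \<Rightarrow> complex \<Rightarrow> complex \<Rightarrow> complex" where
  "Gamma_pm2 \<alpha> \<beta> \<delta> =
     Gamma (\<alpha> + \<beta> + \<delta>) * Gamma (\<alpha> + \<beta> - \<delta>) * Gamma (\<alpha> - \<beta> + \<delta>) * Gamma (\<alpha> - \<beta> - \<delta>)"

definition Delta_plus :: "nat \<Rightarrow> wilson_params \<Rightarrow> point \<Rightarrow> complex" where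
  "Delta_plus n \<tau> x =
     (\<Prod>j = 1..n. \<Prod>k = j + 1..n.
        Gamma_pm2 (par_t \<tau>) (x j) (x k) / Gamma_pm2 0 (x j) (x k)) *
     (\<Prod>j = 1..n.
        Gamma_pm (par_a \<tau>) (x j) * Gamma_pm (par_b \<tau>) (x j) *
        Gamma_pm (par_c \<tau>) (x j) * Gamma_pm (par_d \<tau>) (x j) / Gamma_pm 0 (2 * x j))"

definition c_plus :: "nat \<Rightarrow> wilson_params \<Rightarrow> point \<Rightarrow> complex" where
  "c_plus n \<tau> x =
     (\<Prod>j = 1..n. \<Prod>k = j + 1..n.
        (par_t \<tau> - x j + x k) * (par_t \<tau> - x j - x k) / ((x k - x j) * (- x j - x k))) *
     (\<Prod>j = 1..n. (par_a \<tau> - x j) * (par_b \<tau> - x j) / (- 2 * x j))"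

definition Delta :: "nat \<Rightarrow> wilson_params \<Rightarrow> point \<Rightarrow> complex" where
  "Delta n \<tau> x = c_plus n \<tau> x * Delta_plus n \<tau> x"

text \<open>
  The substitution \<open>x\<^sub>j = \<i> y\<^sub>j\<close>, \<open>dx\<^sub>j = \<i> dy\<^sub>j\<close> turns the integral over \<open>(\<i>\<real>)\<^sup>n\<close> into a Lebesgue integral
  over \<open>\<real>\<^sup>n\<close>, here the space of functions on \<open>{1..n}\<close> with the product measure.
\<close>

definition form :: "nat \<Rightarrow> wilson_params \<Rightarrow> cfun \<Rightarrow> cfun \<Rightarrow> complex" where
  "form n \<tau> f g =
     1 / (2 * of_real pi * \<i>) ^ n *
     (\<i> ^ n * (\<integral>y. (let x = (\<lambda>j. \<i> * of_real (y j)) in f x * g x * Delta n \<tau> x)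
                 \<partial>(\<Pi>\<^sub>M j\<in>{1..n}. lborel)))"


subsection \<open>Well-definedness of the dot action and of the operators \<open>T\<^sub>i\<close>\<close>

lemma foldr_dot_gen: "foldr (dot_gen n) is x = (\<lambda>j. - foldr (gen n) is (\<lambda>j. - x j) j)"
proof (induction "is")
  case (Cons i "is")
  have "dot_gen n i (\<lambda>j. - y j) = (\<lambda>j. - gen n i y j)" for y
    by (auto simp: dot_gen_def gen_def fun_eq_iff)
  then show ?case using Cons by simp
qed simp

lemma reduced_expr_red: "w \<in> W n \<Longrightarrow> reduced_expr n w (red n w)"
proof -
  assume "w \<in> W n"
  then have "\<exists>k is. set is \<subseteq> {0..n} \<and> foldr (gen n) is = w \<and> length is = k"
    by (auto simp: W_def)
  then have "\<exists>is. reduced_expr n w is"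
    unfolding reduced_expr_def len_def by (rule LeastI_ex)
  then show ?thesis unfolding red_def by (rule someI_ex)
qed

lemma dot_eq:
  assumes "set is \<subseteq> {0..n}" "foldr (gen n) is = w"
  shows "dot n w = foldr (dot_gen n) is"
proof -
  have "w \<in> W n" using assms by (auto simp: W_def)
  from reduced_expr_red[OF this] have "foldr (gen n) (red n w) = w"
    by (simp add: reduced_expr_def)
  then show ?thesis
    using assms by (auto simp: dot_def fun_eq_iff foldr_dot_gen)
qed

lemma gen_gen: "gen n i (gen n i x) = x"
  by (auto simp: gen_def fun_eq_iff)

lemma act_gen: "act (gen n i) p = (\<lambda>x. p (gen n i x))"
proof -
  have "inv (gen n i) = gen n i"
    by (rule inv_equality) (auto simp: gen_gen)
  then show ?thesis by (simp add: act_def)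
qed

lemma Pol_minus: "p \<in> Pol n \<Longrightarrow> q \<in> Pol n \<Longrightarrow> (\<lambda>x. p x - q x) \<in> Pol n"
  using Pol_add[OF _ Pol_mult[OF Pol_const[of "-1"]], of p n q] by simp

lemma Pol_power: "p \<in> Pol n \<Longrightarrow> (\<lambda>x. p x ^ k) \<in> Pol n"
  by (induction k) (auto intro: Pol.intros)

lemma gen_coord_cases:
  "i = 0 \<and> j = 1 \<or> i = n \<and> j = n \<and> i \<noteq> 0 \<or> i \<noteq> 0 \<and> i \<noteq> n \<and> j = i
    \<or> i \<noteq> 0 \<and> i \<noteq> n \<and> j = i + 1 \<or> (\<forall>x. gen n i x j = x j)"
  by (auto simp: gen_def)

lemma gen_coord_Pol:
  assumes "1 \<le> n" "i \<le> n" "j \<in> {1..n}"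
  shows "(\<lambda>x. gen n i x j) \<in> Pol n"
proof -
  consider "i = 0" "j = 1" | "i = n" "j = n" "i \<noteq> 0" | "i \<noteq> 0" "i \<noteq> n" "j = i"
    | "i \<noteq> 0" "i \<noteq> n" "j = i + 1" | "\<And>x. gen n i x j = x j"
    using gen_coord_cases[of i j n] by metis
  then show ?thesis
  proof cases
    case 1
    then show ?thesis
      using Pol_minus[OF Pol_const[of 1] Pol_var[of 1 n]] assms by (simp add: gen_def)
  next
    case 2
    then show ?thesis
      using Pol_minus[OF Pol_const[of 0] Pol_var[of n n]] assms by (simp add: gen_def)
  next
    case 3
    then show ?thesis using Pol_var[of "i + 1" n] assms by (simp add: gen_def)
  next
    case 4
    then show ?thesis using Pol_var[of i n] assms by (simp add: gen_def)
  next
    case 5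
    then show ?thesis using Pol_var[of j n] assms by simp
  qed
qed

lemma gen_Pol:
  assumes "1 \<le> n" "i \<le> n" "p \<in> Pol n"
  shows "(\<lambda>x. p (gen n i x)) \<in> Pol n"
  using assms(3) by induction (intro Pol.intros gen_coord_Pol[OF assms(1,2)]; assumption)+

lemma gen_coord_diff:
  assumes "1 \<le> n" "i \<le> n"
  shows "\<exists>c. \<forall>x. gen n i x j = x j + aff n i x * c"
proof -
  consider "i = 0" "j = 1" | "i = n" "j = n" "i \<noteq> 0" | "i \<noteq> 0" "i \<noteq> n" "j = i"
    | "i \<noteq> 0" "i \<noteq> n" "j = i + 1" | "\<And>x. gen n i x j = x j"
    using gen_coord_cases[of i j n] by metis
  then show ?thesis
  proof cases
    case 1
    then show ?thesis by (intro exI[of _ 1]) (simp add: gen_def aff_def)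
  next
    case 2
    then show ?thesis by (intro exI[of _ "-1"]) (simp add: gen_def aff_def)
  next
    case 3
    then show ?thesis by (intro exI[of _ "-1"]) (simp add: gen_def aff_def)
  next
    case 4
    then show ?thesis by (intro exI[of _ 1]) (simp add: gen_def aff_def)
  next
    case 5
    then show ?thesis by (intro exI[of _ 0]) simp
  qed
qed

lemma divided_difference:
  assumes "1 \<le> n" "i \<le> n" "p \<in> Pol n"
  shows "\<exists>q \<in> Pol n. \<forall>x. p (gen n i x) = p x + aff n i x * q x"
  using assms(3)
proof induction
  case (Pol_const c)
  then show ?case by (intro bexI[of _ "\<lambda>x. 0"]) (auto intro: Pol.intros)
next
  case (Pol_var j)
  obtain c where "\<And>x. gen n i x j = x j + aff n i x * c"
    using gen_coord_diff[OF assms(1,2)] by blast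
  then show ?case by (intro bexI[of _ "\<lambda>x. c"]) (auto intro: Pol.intros)
next
  case (Pol_add p q)
  then obtain p' q' where p': "p' \<in> Pol n" "\<And>x. p (gen n i x) = p x + aff n i x * p' x"
    and q': "q' \<in> Pol n" "\<And>x. q (gen n i x) = q x + aff n i x * q' x"
    by blast
  then show ?case
    by (intro bexI[of _ "\<lambda>x. p' x + q' x"]) (auto intro: Pol.intros simp: algebra_simps)
next
  case (Pol_mult p q)
  then obtain p' q' where p': "p' \<in> Pol n" "\<And>x. p (gen n i x) = p x + aff n i x * p' x"
    and q': "q' \<in> Pol n" "\<And>x. q (gen n i x) = q x + aff n i x * q' x"
    by blast
  have "(\<lambda>x. p' x * q (gen n i x) + p x * q' x) \<in> Pol n"
    by (intro Pol.Pol_add Pol.Pol_mult gen_Pol p' q' Pol_mult.hyps assms)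
  then show ?case
    by (rule bexI[rotated]) (simp add: p' q' algebra_simps)
qed

lemma Pol_eqI:
  assumes "1 \<le> n" "i \<le> n" "p \<in> Pol n" "q \<in> Pol n"
    and eq: "\<And>x. aff n i x \<noteq> 0 \<Longrightarrow> p x = q x"
  shows "p = q"
proof
  fix x
  show "p x = q x"
  proof (cases "aff n i x = 0")
    case True
    define v where "v = (\<lambda>z. x ((if i = 0 then 1 else i) := x (if i = 0 then 1 else i) + z))"
    have aff: "aff n i (v z) \<noteq> 0" if "z \<noteq> 0" for z
      using True that by (auto simp: aff_def v_def algebra_simps split: if_splits)
    have cont: "isCont (\<lambda>z. r (v z)) 0" if "r \<in> Pol n" for r
      using that
    proof induction
      case (Pol_var j)
      then show ?case by (cases "j = (if i = 0 then 1 else i)") (auto simp: v_def)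
    qed (auto intro!: continuous_intros)
    have "(\<lambda>z. p (v z) - q (v z)) \<midarrow>0\<rightarrow> p (v 0) - q (v 0)"
      using cont[OF assms(3)] cont[OF assms(4)] by (intro tendsto_diff) (auto simp: isCont_def)
    moreover have "(\<lambda>z. p (v z) - q (v z)) \<midarrow>0\<rightarrow> 0"
      by (rule tendsto_eventually) (auto simp: eventually_at_filter eq[OF aff])
    ultimately have "p (v 0) - q (v 0) = 0" by (rule LIM_unique)
    then show ?thesis by (simp add: v_def)
  qed (use eq in auto)
qed

lemma T_ex1:
  assumes "1 \<le> n" "i \<le> n" "p \<in> Pol n"
  shows "\<exists>!q. q \<in> Pol n \<and>
     (\<forall>x. aff n i x \<noteq> 0 \<longrightarrow>
        q x = chi n \<tau> i * act (gen n i) p x + dcoef n \<tau> i x * (act (gen n i) p x - p x))"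
proof -
  obtain r where r: "r \<in> Pol n" "\<And>x. p (gen n i x) = p x + aff n i x * r x"
    using divided_difference[OF assms] by blast
  have "\<exists>N \<in> Pol n. \<forall>x. dcoef n \<tau> i x = N x / aff n i x"
  proof -
    have *: "(\<lambda>x. c + (b - x j)\<^sup>2) \<in> Pol n" if "j \<in> {1..n}" for c b j
      by (intro Pol.intros Pol_power Pol_minus that)
    consider "i = 0" | "i = n" "i \<noteq> 0" | "i \<noteq> n" "i \<noteq> 0" by blast
    then show ?thesis
    proof cases
      case 1
      then show ?thesis using assms
        by (intro bexI[OF _ *[of 1 "(par_t0 \<tau>)\<^sup>2 - (par_u0 \<tau>)\<^sup>2" "1/2"]]) (auto simp: dcoef_def aff_def)
    next
      case 2
      then show ?thesis using assms
        by (intro bexI[OF _ *[of n "(par_tn \<tau>)\<^sup>2 - (par_un \<tau>)\<^sup>2" 0]]) (auto simp: dcoef_def aff_def)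
    next
      case 3
      then show ?thesis
        by (intro bexI[of _ "\<lambda>x. par_t \<tau>"]) (auto simp: dcoef_def aff_def intro: Pol.intros)
    qed
  qed
  then obtain N where N: "N \<in> Pol n" "\<And>x. dcoef n \<tau> i x = N x / aff n i x" by blast
  let ?q = "\<lambda>x. chi n \<tau> i * p (gen n i x) + N x * r x"
  have q_Pol: "?q \<in> Pol n"
    by (intro Pol.intros gen_Pol assms r N)
  show ?thesis
  proof (rule ex1I[of _ ?q])
    show "?q \<in> Pol n \<and> (\<forall>x. aff n i x \<noteq> 0 \<longrightarrow>
        ?q x = chi n \<tau> i * act (gen n i) p x + dcoef n \<tau> i x * (act (gen n i) p x - p x))"
      using q_Pol by (simp add: act_gen r(2) N(2))
  next
    fix q
    assume q: "q \<in> Pol n \<and> (\<forall>x. aff n i x \<noteq> 0 \<longrightarrow>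
        q x = chi n \<tau> i * act (gen n i) p x + dcoef n \<tau> i x * (act (gen n i) p x - p x))"
    show "q = ?q"
      by (rule Pol_eqI[OF assms(1,2) _ q_Pol]) (use q in \<open>simp_all add: act_gen r(2) N(2)\<close>)
  qed
qed

end

theory Submission
  imports Defs "HOL-Complex_Analysis.Cauchy_Integral_Theorem" "HOL-Probability.Sinc_Integral"
begin

text \<open>
  The operators \<open>T\<^sub>i\<close> and \<open>X\<^sub>i\<close> satisfy the relations of a degenerate double affine Hecke algebra.
  These relations alone imply that \<open>S\<^sub>i\<close> maps a joint eigenvector of \<open>Y\<^sub>1, \<dots>, Y\<^sub>n\<close> with eigenvalue
  \<open>g\<close> to one with eigenvalue \<open>s\<^sub>i \<cdot> g\<close> and that \<open>S\<^sub>i\<^sup>2\<close> acts on it by an explicit scalar,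
  without using that the \<open>Y\<^sub>i\<close> commute.  Positivity of the parameters makes this scalar nonzero
  whenever \<open>s\<^sub>i\<close> moves \<open>\<lambda>\<close>, so \<open>p\<^sub>\<lambda>\<close> is a nonzero joint eigenfunction with eigenvalue
  \<open>\<gamma>\<^sub>\<lambda>\<close>, and distinct eigenvalues give linear independence.  Weighting \<open>x\<^sub>i\<close> and \<open>x\<^sub>i\<^sup>2\<close> alike by 1
  makes \<open>T\<^sub>i\<close> and \<open>Y\<^sub>i\<close> preserve the resulting filtration, \<open>S\<^sub>0\<close> raise it by one, and the
  number of monomials of weight at most \<open>d\<close> equal to the number of \<open>\<lambda>\<close> with
  \<open>\<bar>\<lambda>\<^sub>1\<bar> + \<dots> + \<bar>\<lambda>\<^sub>n\<bar> \<le> d\<close>; hence the eigenfunctions span.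
  Each \<open>T\<^sub>i\<close> is symmetric for the bilinear form: for \<open>i > 0\<close> by the substitution \<open>x \<mapsto> s\<^sub>i x\<close>, and for
  \<open>i = 0\<close> by shifting the \<open>x\<^sub>1\<close>-contour to \<open>Re x\<^sub>1 = 1\<close> and substituting \<open>x\<^sub>1 \<mapsto> 1 - x\<^sub>1\<close>.  So every
  \<open>Y\<^sub>i\<close> is symmetric, and eigenfunctions with different eigenvalues are orthogonal.
\<close>

section \<open>Intertwiners in the degenerate double affine Hecke algebra\<close>

text \<open>Three obstacles shape the proof. First, \<open>wilson_poly\<close> comes from a reduced
  word, along which the weight is hard to control. So a second family of eigenfunctions is built
  along words whose letters s_0 only increase |\<lambda>_1| + ... + |\<lambda>_n|; it spans by
  counting, and simplicity of the spectrum identifies both families up to scalars. Second, T_0 and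
  T_n divide a quadratic numerator by a linear wall and so raise the ordinary degree (x_n goes to a
  quadratic polynomial). But x_n^2 is fixed by s_n, and x_1^2 changes under s_0 by 1 - 2 x_1 only;
  giving x_i and x_i^2 the same weight therefore makes both operators harmless. Third, the contour
  shift must not collect residues. As a function of x_1, the continued weight is built from factors
  Gamma(a + z) Gamma(a + 1 - z), the same with b, c, d, shifted ones with t, and reciprocals of
  Gamma; positivity keeps all poles off the closed strip. At its ends the factors with a, b, c, d
  decay faster than the reciprocals grow, while the factors with t grow polynomially only.\<close>

definition commute :: "('v \<Rightarrow> 'v) \<Rightarrow> ('v \<Rightarrow> 'v) \<Rightarrow> bool" where
  "commute A B \<longleftrightarrow> (\<forall>v. A (B v) = B (A v))"

lemma commuteD: "commute A B \<Longrightarrow> A (B v) = B (A v)"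
  by (simp add: commute_def)

text \<open>The relations are listed in the form in which the eigenvalue calculus consumes them:
  \<open>T_braid_n\<close> says that T_n commutes with T_(n-1) T_n T_(n-1) + t T_(n-1),
  \<open>T_braid_0\<close> that T_0 - X_1 commutes with T_1 T_0 T_1, and the last two that X_n + T_n
  and T_0 - X_1 + 1/2 have scalar squares.\<close>

locale degenerate_daha = vector_space scale
  for scale :: "complex \<Rightarrow> 'v::ab_group_add \<Rightarrow> 'v" (infixr "\<cdot>" 75) +
  fixes n :: nat and T X :: "nat \<Rightarrow> 'v \<Rightarrow> 'v" and t0 u0 t tn un :: complex
  assumes n_ge_2: "2 \<le> n"
    and T_add: "T i (v + w) = T i v + T i w" and T_scale: "T i (c \<cdot> v) = c \<cdot> T i v"
    and X_add: "X i (v + w) = X i v + X i w" and X_scale: "X i (c \<cdot> v) = c \<cdot> X i v"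
    and T_T: "0 < i \<Longrightarrow> i < n \<Longrightarrow> T i (T i v) = v"
    and T0_T0: "T 0 (T 0 v) = t0\<^sup>2 \<cdot> v"
    and Tn_Tn: "T n (T n v) = tn\<^sup>2 \<cdot> v"
    and T_far: "j \<le> n \<Longrightarrow> i + 1 < j \<Longrightarrow> T i (T j v) = T j (T i v)"
    and T_braid: "0 < i \<Longrightarrow> i + 1 < n \<Longrightarrow> T i (T (i + 1) (T i v)) = T (i + 1) (T i (T (i + 1) v))"
    and T_braid_n: "T n (T (n - 1) (T n (T (n - 1) v)) + t \<cdot> T (n - 1) v)
          = T (n - 1) (T n (T (n - 1) (T n v))) + t \<cdot> T (n - 1) (T n v)"
    and T_braid_0: "T 0 (T 1 (T 0 (T 1 v))) - X 1 (T 1 (T 0 (T 1 v)))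
          = T 1 (T 0 (T 1 (T 0 v - X 1 v)))"
    and T_X: "0 < i \<Longrightarrow> i < n \<Longrightarrow> T i (X (i + 1) (T i v)) = X i v + t \<cdot> T i v"
    and T_X_far: "1 < i \<Longrightarrow> i \<le> n \<Longrightarrow> T i (X 1 v) = X 1 (T i v)"
    and Xn_Tn: "X n (X n v + T n v) + T n (X n v + T n v) = un\<^sup>2 \<cdot> v"
    and T0_X1: "(let D = (\<lambda>v. T 0 v - X 1 v + (1/2) \<cdot> v) in D (D v) = u0\<^sup>2 \<cdot> v)"
begin

definition P :: "nat \<Rightarrow> 'v \<Rightarrow> 'v" where "P i = foldr T ([i..<n] @ [n] @ rev [i..<n])"
definition Q :: "nat \<Rightarrow> 'v \<Rightarrow> 'v" where "Q i = foldr T (rev [1..<i] @ [0] @ [1..<i])"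
definition R :: "nat \<Rightarrow> nat \<Rightarrow> 'v \<Rightarrow> 'v" where
  "R i j = foldr T ([i..<j - 1] @ [j - 1] @ rev [i..<j - 1])"
text \<open>Y_i without its T_0 part. The sum over \<open>R\<close> is joined to \<open>P\<close>
  because only the combination obeys a one-step recursion, M_i = T_i M_(i+1) T_i + t T_i.\<close>

definition M :: "nat \<Rightarrow> 'v \<Rightarrow> 'v" where "M i v = P i v + t \<cdot> (\<Sum>j = i + 1..n. R i j v)"
definition Y :: "nat \<Rightarrow> 'v \<Rightarrow> 'v" where "Y i v = P i v + Q i v + t \<cdot> (\<Sum>j = i + 1..n. R i j v)"
definition C :: "'v \<Rightarrow> 'v" where "C v = - X n v - T n v"
text \<open>\<open>V 1\<close> is the operator U_n; the partial conjugates serve the downward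
  induction that starts from \<open>V n\<close>.\<close>

definition V :: "nat \<Rightarrow> 'v \<Rightarrow> 'v" where "V i v = foldr T [i..<n] (C (foldr T (rev [i..<n]) v))"

lemma T_0 [simp]: "T i 0 = 0" using T_add[of i 0 0] by simp
lemma X_0 [simp]: "X i 0 = 0" using X_add[of i 0 0] by simp
lemma T_minus: "T i (- v) = - T i v" using T_add[of i v "- v"] by (simp add: eq_neg_iff_add_eq_0 add.commute)
lemma X_minus: "X i (- v) = - X i v" using X_add[of i v "- v"] by (simp add: eq_neg_iff_add_eq_0 add.commute)
lemma T_diff: "T i (v - w) = T i v - T i w" using T_add[of i v "- w"] by (simp add: T_minus)
lemma X_diff: "X i (v - w) = X i v - X i w" using X_add[of i v "- w"] by (simp add: X_minus)
lemma T_sum: "T i (sum f A) = (\<Sum>a\<in>A. T i (f a))"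
  by (induction A rule: infinite_finite_induct) (simp_all add: T_add)

lemmas lin_simps = T_add T_scale X_add X_scale T_minus X_minus T_diff X_diff T_sum
  scale_right_distrib scale_left_distrib scale_right_diff_distrib scale_left_diff_distrib

lemma foldr_T_add: "foldr T is (v + w) = foldr T is v + foldr T is w"
  by (induction "is") (simp_all add: T_add)
lemma foldr_T_scale: "foldr T is (c \<cdot> v) = c \<cdot> foldr T is v"
  by (induction "is") (simp_all add: T_scale)

lemma M_add: "M i (v + w) = M i v + M i w"
  by (simp add: M_def P_def R_def foldr_T_add sum.distrib lin_simps del: foldr_append)
lemma M_scale: "M i (c \<cdot> v) = c \<cdot> M i v"
proof -
  have "(\<Sum>j = i + 1..n. R i j (c \<cdot> v)) = c \<cdot> (\<Sum>j = i + 1..n. R i j v)"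
    unfolding R_def foldr_T_scale scale_sum_right ..
  then show ?thesis
    unfolding M_def P_def foldr_T_scale by (simp only: scale_right_distrib scale_scale mult.commute)
qed
lemma Q_add: "Q i (v + w) = Q i v + Q i w"
  by (simp add: Q_def foldr_T_add del: foldr_append)
lemma Q_scale: "Q i (c \<cdot> v) = c \<cdot> Q i v"
  by (simp add: Q_def foldr_T_scale del: foldr_append)

lemma Y_eq: "Y i v = M i v + Q i v"
  by (simp add: Y_def M_def)

lemma Y_add: "Y i (v + w) = Y i v + Y i w"
  by (simp add: Y_eq M_add Q_add)
lemma Y_scale: "Y i (c \<cdot> v) = c \<cdot> Y i v"
  by (simp add: Y_eq M_scale Q_scale scale_right_distrib)
lemma Y_minus: "Y i (- v) = - Y i v" using Y_scale[of i "-1" v] by simp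
lemma Y_diff: "Y i (v - w) = Y i v - Y i w" using Y_add[of i v "- w"] by (simp add: Y_minus)

lemma M_n: "M n = T n"
  by (simp add: M_def P_def fun_eq_iff)

lemma M_rec: 
  assumes "0 < i" "i < n"
  shows "M i v = T i (M (i + 1) (T i v)) + t \<cdot> T i v"
proof -
  have 1: "[i..<n] = i # [i + 1..<n]" using assms by (simp add: upt_conv_Cons)
  have 2: "R i j w = T i (R (i + 1) j (T i w))" if "i + 1 < j" for j w
  proof -
    have "[i..<j - 1] = i # [i + 1..<j - 1]" using that by (simp add: upt_conv_Cons)
    then show ?thesis by (simp add: R_def)
  qed
  have 3: "{i + 1..n} = insert (i + 1) {i + 2..n}" using assms by auto
  have "(\<Sum>j = i + 1..n. R i j v) = R i (i + 1) v + (\<Sum>j = i + 2..n. R i j v)"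
    by (subst 3) simp
  also have "R i (i + 1) v = T i v" by (simp add: R_def)
  also have "(\<Sum>j = i + 2..n. R i j v) = (\<Sum>j = i + 2..n. T i (R (i + 1) j (T i v)))"
    by (intro sum.cong) (auto simp: 2)
  finally show ?thesis
    by (simp add: M_def P_def 1 lin_simps add_ac)
qed

lemma Q_1: "Q 1 = T 0" by (simp add: Q_def fun_eq_iff)

lemma Q_rec: "0 < i \<Longrightarrow> Q (i + 1) v = T i (Q i (T i v))"
  by (simp add: Q_def)

lemma V_rec: "i < n \<Longrightarrow> V i v = T i (V (i + 1) (T i v))"
  by (simp add: V_def upt_conv_Cons)

lemma V_n: "V n = C" by (simp add: V_def fun_eq_iff)

text \<open>Conjugation by T_i sends X_(i+1) to X_i + t T_i and M_(i+1) to M_i - t T_i, so the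
  t-terms cancel in the sum. At i = 1 this expresses U_n through T_0, X_1 and Y_1, which is what
  makes S_0 computable.\<close>

lemma V_eq: "0 < i \<Longrightarrow> i \<le> n \<Longrightarrow> V i v = - X i v - M i v"
proof (induction "n - i" arbitrary: i v)
  case 0
  then have "i = n" by simp
  then show ?case by (simp add: V_n M_n C_def)
next
  case (Suc k)
  have i: "0 < i" "i < n" using Suc by auto
  have IH: "V (i + 1) w = - X (i + 1) w - M (i + 1) w" for w
    using Suc(2) by (intro Suc(1)) auto
  show ?case
    using T_X[of i v] i by (simp add: V_rec IH[simplified] lin_simps M_rec[OF i] algebra_simps)
qed

lemma V_1: "V 1 v = T 0 v - X 1 v - Y 1 v"
  using n_ge_2 by (simp add: V_eq Y_eq Q_1[unfolded One_nat_def])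

section \<open>Commutation of the \<open>Y j\<close> with \<open>T i\<close> and with T_0 -
  X_1\<close>

lemma commute_T_T: "i \<le> n \<Longrightarrow> j \<le> n \<Longrightarrow> i + 1 < j \<or> j + 1 < i \<Longrightarrow> commute (T i) (T j)"
  using T_far[of j i] T_far[of i j] by (auto simp: commute_def)

lemma commute_M_rec:
  assumes "\<And>v w. A (v + w) = A v + A w" "\<And>c v. A (c \<cdot> v) = c \<cdot> A v"
    and "0 < j" "j < n" "commute A (T j)" "commute A (M (j + 1))"
  shows "commute A (M j)"
  unfolding commute_def M_rec[OF assms(3,4)]
  by (simp only: assms(1,2) commuteD[OF assms(5)] commuteD[OF assms(6)] simp_thms)

lemma commute_M_downto:
  assumes "\<And>v w. A (v + w) = A v + A w" "\<And>c v. A (c \<cdot> v) = c \<cdot> A v"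
    and "0 < j" "j \<le> k" "k \<le> n" "commute A (M k)" "\<And>i. j \<le> i \<Longrightarrow> i < k \<Longrightarrow> commute A (T i)"
  shows "commute A (M j)"
  using assms(3-)
proof (induction "k - j" arbitrary: j)
  case (Suc m)
  have "commute A (M (j + 1))" using Suc(2-) by - (rule Suc(1), auto)
  with Suc(2-) assms(1,2) show ?case by - (rule commute_M_rec, auto)
qed simp

lemma commute_Q_upto:
  assumes "0 < k" "k \<le> j" "commute A (Q k)" "\<And>i. k \<le> i \<Longrightarrow> i < j \<Longrightarrow> commute A (T i)"
  shows "commute A (Q j)"
  using assms
proof (induction "j - k" arbitrary: j)
  case (Suc m)
  then obtain l where l: "j = l + 1" by (cases j) auto
  have "commute A (Q l)" using Suc(2-) l by - (rule Suc(1), auto)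
  moreover have "commute A (T l)" using Suc(2-) l by auto
  ultimately show ?case using Suc(2-) by (simp add: l commute_def Q_rec[simplified])
qed simp

text \<open>For j > i + 1 all letters are far from i. Otherwise the critical index is k = i - 1,
  from which lower ones follow by the recursion. There M_k = T_k T_i M_(i+1) T_i T_k + t (T_k T_i
  T_k + T_k): the braid relation moves T_i through the first term, and through the two t-terms only
  jointly. For i = n the claim is \<open>T_braid_n\<close>.\<close>

lemma commute_T_M:
  assumes "0 < i" "i \<le> n" "0 < j" "j \<le> n" "j \<noteq> i" "j \<noteq> i + 1"
  shows "commute (T i) (M j)"
proof (cases "i < j")
  case True
  then have "commute (T i) (M n)" using assms unfolding M_n by (intro commute_T_T) auto
  then show ?thesis
    by (rule commute_M_downto[of "T i" j n, rotated 5])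
      (use assms True in \<open>auto simp: T_add T_scale intro: commute_T_T\<close>)
next
  case False
  then have ji: "j < i" using assms by auto
  have "commute (T i) (M (i - 1))"
  proof (cases "i = n")
    case True
    have "commute (T n) (M (n - 1))"
      using M_rec[of "n - 1"] n_ge_2 T_braid_n by (simp add: commute_def M_n lin_simps)
    then show ?thesis by (simp add: True)
  next
    case False
    obtain k where k: "i = k + 1" using assms(1) by (cases i) auto
    have i: "0 < i" "i < n" using False assms by auto
    have k0: "0 < k" "k + 1 < n" "k < n" using ji assms i k by auto
    have cM: "commute (T k) (M (i + 1))"
    proof (rule commute_M_downto[of "T k" "i + 1" n])
      show "commute (T k) (M n)" unfolding M_n using k0 k by (intro commute_T_T) auto
    qed (use k0 k i in \<open>auto simp: T_add T_scale intro: commute_T_T\<close>)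
    have br: "T i (T k (T i v)) = T k (T i (T k v))" for v
      using T_braid[OF k0(1,2)] k by simp
    have kk: "T k (T k v) = v" "T i (T i v) = v" for v using T_T i k0 by auto
    have "T i (T k (T i (M (i + 1) (T i (T k v))))) = T k (T i (M (i + 1) (T i (T k (T i v)))))" for v
      by (simp add: br commuteD[OF cM, simplified])
    then show ?thesis
      using M_rec[OF k0(1,3)] M_rec[OF i] k
      by (simp add: commute_def lin_simps br[unfolded k, simplified] kk[unfolded k, simplified])
  qed
  then show ?thesis
    by (rule commute_M_downto[of "T i" j "i - 1", rotated 5])
      (use assms ji in \<open>auto simp: T_add T_scale intro: commute_T_T\<close>)
qed

text \<open>For j < i all letters of Q_j are far from i. Otherwise the base case is Q_(i+2) =
  T_(i+1) T_i Q_i T_i T_(i+1): the braid relation turns T_i into T_(i+1), which commutes with Q_i,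
  and then back.\<close>

lemma commute_T_Q:
  assumes "0 < i" "i \<le> n" "0 < j" "j \<le> n" "j \<noteq> i" "j \<noteq> i + 1"
  shows "commute (T i) (Q j)"
proof (cases "j < i")
  case True
  have "commute (T i) (Q 1)" unfolding Q_1 using True assms by (intro commute_T_T) auto
  then show ?thesis
    by (rule commute_Q_upto[of 1 j "T i", rotated 2]) (use assms True in \<open>auto intro: commute_T_T\<close>)
next
  case False
  then have ij: "i + 2 \<le> j" using assms by auto
  have i: "0 < i" "i + 1 < n" "i < n" using assms ij by auto
  have cQ: "commute (T (i + 1)) (Q i)"
    by (rule commute_Q_upto[of 1 i])
      (use i in \<open>auto simp: Q_1[simplified] intro: commute_T_T\<close>)
  note br = T_braid[OF i(1,2), simplified]
  have "commute (T i) (Q (i + 2))"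
    using Q_rec[of i] Q_rec[of "i + 1"] i cQ by (simp add: commute_def br)
  then show ?thesis
    by (rule commute_Q_upto[of "i + 2" j "T i", rotated 2]) (use assms ij in \<open>auto intro: commute_T_T\<close>)
qed

lemma T_Y_commute:
  assumes "0 < i" "i \<le> n" "0 < j" "j \<le> n" "j \<noteq> i" "j \<noteq> i + 1"
  shows "T i (Y j v) = Y j (T i v)"
  using commute_T_M[OF assms] commute_T_Q[OF assms] by (simp add: Y_eq commute_def T_add)

lemma Y_rec:
  assumes "0 < i" "i < n"
  shows "Y i v = T i (Y (i + 1) (T i v)) + t \<cdot> T i v"
  using M_rec[OF assms] Q_rec[of i] assms by (simp add: Y_eq T_add T_T)

lemma Y_T:
  assumes "0 < i" "i < n"
  shows "Y i (T i v) = T i (Y (i + 1) v) + t \<cdot> v" "Y (i + 1) (T i v) = T i (Y i v) - t \<cdot> v"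
  using Y_rec[OF assms, of "T i v"] Y_rec[OF assms, of v] T_T[OF assms] by (simp_all add: lin_simps)

text \<open>Y_n - T_n = Q_n is a conjugate of T_0, so it squares to t0^2; the relation is this
  square expanded.\<close>

lemma Yn_Tn: "Y n (T n v) + T n (Y n v) = Y n (Y n v) + (tn\<^sup>2 - t0\<^sup>2) \<cdot> v"
proof -
  have Q2: "0 < i \<Longrightarrow> i \<le> n \<Longrightarrow> Q i (Q i w) = t0\<^sup>2 \<cdot> w" for i w
  proof (induction i arbitrary: w)
    case (Suc i)
    show ?case
    proof (cases "i = 0")
      case True
      then show ?thesis using T0_T0 by (simp add: Q_1[unfolded One_nat_def])
    next
      case False
      then show ?thesis using Suc Q_rec[of i] by (simp add: T_T T_scale)
    qed
  qed simp
  have "Y n w = T n w + Q n w" for w by (simp add: Y_eq M_n)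
  then show ?thesis using Q2[of n v] n_ge_2
    by (simp add: T_add Q_add Tn_Tn scale_left_diff_distrib)
qed

lemma V_V: "0 < i \<Longrightarrow> i \<le> n \<Longrightarrow> V i (V i v) = un\<^sup>2 \<cdot> v"
proof (induction "n - i" arbitrary: i v)
  case 0
  then have "i = n" by simp
  then show ?case using Xn_Tn[of v] by (simp add: V_n C_def lin_simps algebra_simps)
next
  case (Suc k)
  have i: "0 < i" "i < n" using Suc by auto
  have IH: "V (i + 1) (V (i + 1) w) = un\<^sup>2 \<cdot> w" for w
    using Suc(2) by (intro Suc(1)) auto
  show ?case using IH i by (simp add: V_rec T_T T_scale)
qed

text \<open>T_0 - X_1 is V_1 + Y_1. Commuting this sum with Y_j suffices for S_0, because on a joint
  eigenvector Y_1 contributes only a scalar.\<close>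

lemma V_commute_Y:
  assumes "2 \<le> j" "j \<le> n"
  shows "T 0 (Y j v) - X 1 (Y j v) = Y j (T 0 v - X 1 v)"
proof -
  let ?A = "\<lambda>v. T 0 v - X 1 v"
  have A_add: "?A (v + w) = ?A v + ?A w" for v w by (simp add: lin_simps)
  have A_scale: "?A (c \<cdot> v) = c \<cdot> ?A v" for c v by (simp add: lin_simps)
  have AT: "commute ?A (T i)" if "2 \<le> i" "i \<le> n" for i
    using that commute_T_T[of 0 i] T_X_far[of i] by (simp add: commute_def T_diff)
  have "commute ?A (M j)"
    by (rule commute_M_downto[OF A_add A_scale, of j n]) (use assms AT in \<open>auto simp: M_n\<close>)
  moreover have "commute ?A (Q 2)"
    using Q_rec[of 1] T_braid_0 by (simp add: commute_def Q_1[unfolded One_nat_def] numeral_2_eq_2)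
  then have "commute ?A (Q j)"
    by (rule commute_Q_upto[of 2 j, rotated 2]) (use assms AT in auto)
  ultimately show ?thesis by (simp add: commute_def Y_eq lin_simps add_diff_add)
qed

section \<open>Action of the intertwiners on joint eigenvectors\<close>

definition S :: "nat \<Rightarrow> 'v \<Rightarrow> 'v" where
  "S i v =
     (if i = 0 then V 1 (v - 2 \<cdot> Y 1 v) - (V 1 v - 2 \<cdot> Y 1 (V 1 v))
      else if i = n then T n (2 \<cdot> Y n v) - 2 \<cdot> Y n (T n v)
      else T i (Y i v - Y (i + 1) v) - (Y i (T i v) - Y (i + 1) (T i v)))"

definition eigen :: "point \<Rightarrow> 'v \<Rightarrow> bool" where
  "eigen g v \<longleftrightarrow> (\<forall>j\<in>{1..n}. Y j v = g j \<cdot> v)"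

lemma eigenD: "eigen g v \<Longrightarrow> 0 < j \<Longrightarrow> j \<le> n \<Longrightarrow> Y j v = g j \<cdot> v"
  by (simp add: eigen_def)

text \<open>Coordinates in the span of an eigenvector v and of w = T_i v (or V_1 v). The relations
  make this span stable, so computations with S_i become arithmetic of coefficient pairs. Equal
  coefficients give equal vectors, which is the only direction used, so v and w may be
  dependent.\<close>

definition lc :: "'v \<Rightarrow> 'v \<Rightarrow> complex \<Rightarrow> complex \<Rightarrow> 'v" where
  "lc w v a b = a \<cdot> w + b \<cdot> v"

lemma lc_simps:
  "lc w v a b + lc w v c d = lc w v (a + c) (b + d)"
  "lc w v a b - lc w v c d = lc w v (a - c) (b - d)"
  "c \<cdot> lc w v a b = lc w v (c * a) (c * b)"
  "lc (lc w v a b) (lc w v c d) x y = lc w v (x * a + y * c) (x * b + y * d)"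
  by (simp_all add: lc_def lin_simps algebra_simps)

lemma lc_lin:
  "T i (lc w v a b) = lc (T i w) (T i v) a b"
  "Y i (lc w v a b) = lc (Y i w) (Y i v) a b"
  by (simp_all add: lc_def lin_simps Y_add Y_scale)

lemma lc_eqI: "a = c \<Longrightarrow> b = d \<Longrightarrow> lc w v a b = lc w v c d"
  by simp

lemma lc_right: "lc w v 0 c = c \<cdot> v"
  by (simp add: lc_def)

text \<open>On the span of u = T_i v and v, the operators Y_i and Y_(i+1) are triangular with
  exchanged diagonal entries, and S_i v = 2 (g_i - g_(i+1)) u - 2 t v is the second
  eigenvector.\<close>

lemma eigen_S_mid:
  assumes "eigen g v" "0 < i" "i < n"
  shows "eigen (dot_gen n i g) (S i v)"
    and "S i (S i v) = (- 4 * ((g i - g (i + 1))\<^sup>2 - t\<^sup>2)) \<cdot> v"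
proof -
  define u where "u = T i v"
  have r: "T i v = lc u v 1 0" "T i u = lc u v 0 1" "Y i v = lc u v 0 (g i)"
    "Y (i + 1) v = lc u v 0 (g (i + 1))" "Y i u = lc u v (g (i + 1)) t"
    "Y (i + 1) u = lc u v (g i) (- t)" "v = lc u v 0 1"
    using assms by (simp_all add: lc_def u_def T_T eigenD Y_T[simplified] lin_simps)
  have S: "S i w = T i (Y i w - Y (i + 1) w) - (Y i (T i w) - Y (i + 1) (T i w))" for w
    using assms by (simp add: S_def)
  have S1: "S i v = lc u v (2 * (g i - g (i + 1))) (- 2 * t)"
    unfolding S r(1-4) lc_lin lc_simps r(1-6) by (rule lc_eqI) (simp_all add: algebra_simps)
  show "S i (S i v) = (- 4 * ((g i - g (i + 1))\<^sup>2 - t\<^sup>2)) \<cdot> v"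
    unfolding S1 unfolding S lc_right[of u v, symmetric] lc_lin lc_simps r(1-6)
    by (rule lc_eqI) (simp_all add: power2_eq_square algebra_simps)
  show "eigen (dot_gen n i g) (S i v)"
    unfolding eigen_def
  proof
    fix j assume j: "j \<in> {1..n}"
    consider "j = i" | "j = i + 1" | "j \<noteq> i" "j \<noteq> i + 1" by blast
    then show "Y j (S i v) = dot_gen n i g j \<cdot> S i v"
    proof cases
      case 3
      then have "Y j u = lc u v (g j) 0" "Y j v = lc u v 0 (g j)"
        using j assms T_Y_commute[of i j v] by (simp_all add: lc_def u_def eigenD T_scale)
      then show ?thesis
        using 3 assms unfolding S1 lc_lin by (simp add: lc_simps dot_gen_def gen_def mult.commute)
    next
      case 1
      then show ?thesis using assms unfolding S1 lc_lin 1 lc_simps r(1-6)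
        by (intro lc_eqI) (simp_all add: dot_gen_def gen_def algebra_simps)
    next
      case 2
      then show ?thesis using assms unfolding S1 lc_lin 2 lc_simps r(1-6)
        by (intro lc_eqI) (simp_all add: dot_gen_def gen_def algebra_simps)
    qed
  qed
qed

lemma eigen_S_n:
  assumes "eigen g v"
  defines "k \<equiv> (g n)\<^sup>2 + tn\<^sup>2 - t0\<^sup>2"
  shows "eigen (dot_gen n n g) (S n v)"
    and "S n (S n v) = (- 4 * (4 * (g n)\<^sup>2 * tn\<^sup>2 - k\<^sup>2)) \<cdot> v"
proof -
  define u where "u = T n v"
  \<comment> \<open>\<open>Yn_Tn\<close> solved for Y_n T_n v; inserting Y_n v = g_n v yields the
    coefficients -g_n and k of Y_n u.\<close>
  have "Y n (T n v) = Y n (Y n v) + (tn\<^sup>2 - t0\<^sup>2) \<cdot> v - T n (Y n v)"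
    using Yn_Tn[of v] by (simp add: algebra_simps)
  then have r: "T n v = lc u v 1 0" "T n u = lc u v 0 (tn\<^sup>2)" "Y n v = lc u v 0 (g n)"
    "Y n u = lc u v (- g n) k"
    using assms(1) n_ge_2
    by (simp_all add: lc_def u_def Tn_Tn eigenD lin_simps k_def Y_scale power2_eq_square algebra_simps)
  have S: "S n w = T n (2 \<cdot> Y n w) - 2 \<cdot> Y n (T n w)" for w
    using n_ge_2 by (simp add: S_def)
  have S1: "S n v = lc u v (4 * g n) (- 2 * k)"
    unfolding S r lc_lin lc_simps r by (rule lc_eqI) (simp_all add: algebra_simps)
  show "S n (S n v) = (- 4 * (4 * (g n)\<^sup>2 * tn\<^sup>2 - k\<^sup>2)) \<cdot> v"
    unfolding S1 unfolding S lc_right[of u v, symmetric] lc_lin lc_simps r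
    by (rule lc_eqI) (simp_all add: power2_eq_square algebra_simps)
  show "eigen (dot_gen n n g) (S n v)"
    unfolding eigen_def
  proof
    fix j assume j: "j \<in> {1..n}"
    show "Y j (S n v) = dot_gen n n g j \<cdot> S n v"
    proof (cases "j = n")
      case True
      then show ?thesis using n_ge_2 unfolding S1 lc_lin True lc_simps r
        by (intro lc_eqI) (simp_all add: dot_gen_def gen_def algebra_simps)
    next
      case False
      then have "Y j u = lc u v (g j) 0" "Y j v = lc u v 0 (g j)"
        using j assms T_Y_commute[of n j v] by (simp_all add: lc_def u_def eigenD T_scale)
      then show ?thesis
        using False assms n_ge_2 unfolding S1 lc_lin by (simp add: lc_simps dot_gen_def gen_def mult.commute)
    qed
  qed
qed

text \<open>The dot action of s_0 reflects g_1 in -1/2, hence the centred variable z. The action of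
  Y_1 on V_1 v is extracted from two squares: V_1 + Y_1 + 1/2 = T_0 - X_1 + 1/2 squares to u0^2 and
  V_1 squares to un^2.\<close>

lemma eigen_S_0:
  assumes "eigen g v"
  defines "z \<equiv> g 1 + 1/2"
  defines "k \<equiv> u0\<^sup>2 - un\<^sup>2 - z\<^sup>2"
  shows "eigen (dot_gen n 0 g) (S 0 v)"
    and "S 0 (S 0 v) = (- 4 * (4 * z\<^sup>2 * un\<^sup>2 - k\<^sup>2)) \<cdot> v"
proof -
  define u where "u = V 1 v"
  have V_lc: "V 1 (lc u v a b) = lc (V 1 u) (V 1 v) a b" for u v a b
    unfolding V_1 by (simp add: lc_def lin_simps Y_add Y_scale algebra_simps)
  define D where "D v = T 0 v - X 1 v + (1/2) \<cdot> v" for v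
  have DD: "D (D w) = u0\<^sup>2 \<cdot> w" for w using T0_X1 by (simp add: Let_def D_def)
  have D: "D w = V 1 w + Y 1 w + (1/2) \<cdot> w" for w unfolding V_1 D_def by simp
  have r: "V 1 v = lc u v 1 0" "V 1 u = lc u v 0 (un\<^sup>2)" "Y 1 v = lc u v 0 (z - 1/2)" "v = lc u v 0 1"
    using assms(1) n_ge_2 V_V[of 1 v] eigenD[OF assms(1), of 1] by (simp_all add: lc_def u_def z_def)
  have "D v = lc u v 1 z"
    unfolding D using r(1,3) by (simp add: lc_def lin_simps)
  then have "D (lc u v 1 z) = u0\<^sup>2 \<cdot> v" using DD[of v] by simp
  moreover have "D (lc u v 1 z) = lc u v z (un\<^sup>2) + Y 1 (lc u v 1 z) + lc u v (1/2) (z/2)"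
    unfolding D V_lc r(1,2) lc_simps by simp
  ultimately have "Y 1 (lc u v 1 z) = lc u v 0 (u0\<^sup>2) - lc u v z (un\<^sup>2) - lc u v (1/2) (z/2)"
    by (simp add: algebra_simps lc_right)
  moreover have "Y 1 (lc u v 1 z) = Y 1 u + lc u v 0 (z * (z - 1/2))"
    using r(3) by (simp add: lc_def lin_simps Y_add Y_scale right_diff_distrib)
  ultimately have "Y 1 u = lc u v 0 (u0\<^sup>2) - lc u v z (un\<^sup>2) - lc u v (1/2) (z/2)
      - lc u v 0 (z * (z - 1/2))"
    by (simp add: algebra_simps)
  also have "\<dots> = lc u v (- z - 1/2) k"
    unfolding lc_simps by (rule lc_eqI) (simp_all add: k_def power2_eq_square algebra_simps)
  finally have Yu: "Y 1 u = lc u v (- z - 1/2) k" .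
  have S: "S 0 w = V 1 (w - 2 \<cdot> Y 1 w) - (V 1 w - 2 \<cdot> Y 1 (V 1 w))" for w
    by (simp add: S_def)
  have S1: "S 0 v = lc u v (- 4 * z) (2 * k)"
  proof -
    have "v - 2 \<cdot> Y 1 v = lc u v 0 1 - 2 \<cdot> Y 1 v" by (simp add: lc_def)
    also have "\<dots> = lc u v 0 (2 - 2 * z)"
      unfolding r(3) lc_simps by (rule lc_eqI) (simp_all add: algebra_simps)
    finally have "v - 2 \<cdot> Y 1 v = lc u v 0 (2 - 2 * z)" .
    then show ?thesis
      unfolding S r(1) lc_lin V_lc lc_simps Yu r(2,3)
      by (simp only: V_lc r(1,2) lc_simps) (rule lc_eqI, simp_all add: algebra_simps)
  qed
  show "S 0 (S 0 v) = (- 4 * (4 * z\<^sup>2 * un\<^sup>2 - k\<^sup>2)) \<cdot> v"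
    unfolding S1 unfolding S lc_right[of u v, symmetric] lc_lin V_lc lc_simps Yu r(1-3)
    by (rule lc_eqI) (simp_all add: power2_eq_square algebra_simps)
  show "eigen (dot_gen n 0 g) (S 0 v)"
    unfolding eigen_def
  proof
    fix j assume j: "j \<in> {1..n}"
    show "Y j (S 0 v) = dot_gen n 0 g j \<cdot> S 0 v"
    proof (cases "j = 1")
      case True
      show ?thesis unfolding S1 lc_lin True Yu r(3) lc_simps
        by (intro lc_eqI) (simp_all add: dot_gen_def z_def algebra_simps)
    next
      case False
      have "Y j (V 1 v) = g j \<cdot> V 1 v"
        using V_commute_Y[of j v] j False eigenD[OF assms(1), of j] eigenD[OF assms(1), of 1] n_ge_2
        unfolding V_1 by (simp add: Y_add Y_diff Y_scale lin_simps algebra_simps)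
      then have "Y j u = lc u v (g j) 0" "Y j v = lc u v 0 (g j)"
        using j eigenD[OF assms(1), of j] by (simp_all add: u_def lc_def)
      then show ?thesis
        using j False unfolding S1 lc_lin by (simp add: dot_gen_def lc_simps mult.commute)
    qed
  qed
qed

end

section \<open>The relations on functions of generic points\<close>

lemma minus_notin_Ints: "- (a::complex) \<in> \<int> \<longleftrightarrow> a \<in> \<int>"
  by (metis Ints_minus minus_minus)

lemma int_diff_notin_Ints: "c \<in> \<int> \<Longrightarrow> c - (a::complex) \<in> \<int> \<longleftrightarrow> a \<in> \<int>"
  by (metis Ints_diff cancel_ab_semigroup_add_class.diff_right_commute diff_add_cancel diff_diff_eq2
      add_diff_cancel_left' )

text \<open>
  The generic points are stable under \<open>W\<close> and avoid every wall, so there the divisions in \<open>T\<^sub>i\<close> are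
  genuine, and functions on them form a module to which the algebra applies verbatim.
\<close>

definition generic :: "point \<Rightarrow> bool" where
  "generic x \<longleftrightarrow> (\<forall>i j. x i + x j \<notin> \<int> \<and> (i \<noteq> j \<longrightarrow> x i - x j \<notin> \<int>))"

lemma generic_imaginary: "generic (\<lambda>i. \<i> * of_nat (Suc i))"
proof -
  have "\<i> * of_nat (Suc i) + \<i> * of_nat (Suc j) \<notin> \<int>" for i j
  proof
    assume "\<i> * of_nat (Suc i) + \<i> * of_nat (Suc j) \<in> \<int>"
    then have "Im (\<i> * of_nat (Suc i) + \<i> * of_nat (Suc j)) = 0"
      by (metis complex_is_Int_iff)
    then show False by simp
  qed
  moreover have "\<i> * of_nat (Suc i) - \<i> * of_nat (Suc j) \<notin> \<int>" if "i \<noteq> j" for i j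
  proof
    assume "\<i> * of_nat (Suc i) - \<i> * of_nat (Suc j) \<in> \<int>"
    then have "Im (\<i> * of_nat (Suc i) - \<i> * of_nat (Suc j)) = 0"
      by (metis complex_is_Int_iff)
    with that show False by simp
  qed
  ultimately show ?thesis unfolding generic_def by blast
qed

lemma generic_gen:
  assumes "generic x"
  shows "generic (gen n i x)"
proof -
  have s: "x j + x k \<notin> \<int>" "- x j - x k \<notin> \<int>" "1 - x j + (1 - x k) \<notin> \<int>"
    and d: "j \<noteq> k \<Longrightarrow> x j - x k \<notin> \<int>" "j \<noteq> k \<Longrightarrow> - x j + x k \<notin> \<int>"
      "j \<noteq> k \<Longrightarrow> 1 - x j + x k \<notin> \<int>" "j \<noteq> k \<Longrightarrow> x k + (1 - x j) \<notin> \<int>"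
    and e: "1 - x j - x k \<notin> \<int>" "x j - (1 - x k) \<notin> \<int>" for j k
    using assms minus_notin_Ints[of "x j + x k"] int_diff_notin_Ints[of 2 "x j + x k"]
      int_diff_notin_Ints[of 1 "x j + x k"] int_diff_notin_Ints[of 1 "x j - x k"] int_diff_notin_Ints[of "-1" "- (x j + x k)"]
      minus_notin_Ints[of "x j - x k"]
    by (auto simp: generic_def algebra_simps)
  consider "i = 0" | "i = n" "i \<noteq> 0" | "i \<noteq> 0" "i \<noteq> n" by blast
  then show ?thesis
  proof cases
    case 1
    then show ?thesis using s d e s(1)[of 1 1] unfolding generic_def gen_def by auto
  next
    case 2
    then show ?thesis using s d e s(1)[of n n] unfolding generic_def gen_def by (auto simp: minus_notin_Ints)
  next
    case 3
    then show ?thesis using s d s(1)[of i i] s(1)[of "i + 1" "i + 1"] unfolding generic_def gen_def by auto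
  qed
qed

typedef gpoint = "{x. generic x}"
  morphisms coords Abs_gpoint
  using generic_imaginary by blast

setup_lifting type_definition_gpoint

lift_definition ggen :: "nat \<Rightarrow> nat \<Rightarrow> gpoint \<Rightarrow> gpoint" is gen
  by (rule generic_gen)

lemma coords_generic:
  "coords g i + coords g j \<notin> \<int>" "i \<noteq> j \<Longrightarrow> coords g i - coords g j \<notin> \<int>"
  using coords[of g] by (auto simp: generic_def)

type_synonym gfun = "gpoint \<Rightarrow> complex"

definition gT :: "nat \<Rightarrow> wilson_params \<Rightarrow> nat \<Rightarrow> gfun \<Rightarrow> gfun" where
  "gT n \<tau> i f = (\<lambda>g. chi n \<tau> i * f (ggen n i g) + dcoef n \<tau> i (coords g) * (f (ggen n i g) - f g))"

definition gX :: "nat \<Rightarrow> gfun \<Rightarrow> gfun" where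
  "gX i f = (\<lambda>g. coords g i * f g)"

lemma ggen_ggen: "ggen n i (ggen n i g) = g"
  by transfer (rule gen_gen)

lemma coords_ggen: "coords (ggen n i g) = gen n i (coords g)"
  by (rule ggen.rep_eq)

lemma ggen_far:
  assumes "j \<le> n" "i + 1 < j"
  shows "ggen n i (ggen n j g) = ggen n j (ggen n i g)"
  using assms by transfer (auto simp: gen_def fun_eq_iff)

lemma ggen_braid:
  assumes "0 < i" "i + 1 < n"
  shows "ggen n i (ggen n (i + 1) (ggen n i g)) = ggen n (i + 1) (ggen n i (ggen n (i + 1) g))"
  using assms by transfer (auto simp: gen_def fun_eq_iff)

lemma ggen_braid_n:
  assumes "2 \<le> n"
  shows "ggen n n (ggen n (n - 1) (ggen n n (ggen n (n - 1) g)))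
    = ggen n (n - 1) (ggen n n (ggen n (n - 1) (ggen n n g)))"
  using assms by transfer (auto simp: gen_def fun_eq_iff)

lemma ggen_braid_0:
  assumes "2 \<le> n"
  shows "ggen n 0 (ggen n 1 (ggen n 0 (ggen n 1 g))) = ggen n 1 (ggen n 0 (ggen n 1 (ggen n 0 g)))"
  using assms by transfer (auto simp: gen_def fun_eq_iff)

lemma coords_diff_ne: "i \<noteq> j \<Longrightarrow> coords g i - coords g j \<noteq> 0"
  using coords_generic(2)[of i j g] by (metis Ints_0)

lemma coords_sum_ne: "coords g i + coords g j \<noteq> 0" "coords g i \<noteq> 0" "coords g i + coords g j \<noteq> 1"
  "2 * coords g i \<noteq> 1" "coords g i - 1/2 \<noteq> 0"
  using coords_generic(1)[of g i j] coords_generic(1)[of g i i]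
  by (metis Ints_0, metis Ints_0 add_0, metis Ints_1, metis Ints_1 mult_2, auto simp: field_simps)

text \<open>With s standing for x_n or 1/2 - x_1 and T for T_n or T_0, this is (s + T)^2 = q^2, read
  at a point where the function has value a and at whose mirror image it has value b.\<close>

lemma quadratic_relation:
  fixes s a b q r :: complex
  assumes "s \<noteq> 0"
  shows "s * (s * a + (r * b + (r\<^sup>2 - q\<^sup>2 + s\<^sup>2) / (2 * s) * (b - a)))
    + (r * (- s * b + (r * a + (r\<^sup>2 - q\<^sup>2 + (- s)\<^sup>2) / (2 * - s) * (a - b)))
       + (r\<^sup>2 - q\<^sup>2 + s\<^sup>2) / (2 * s) *
         ((- s * b + (r * a + (r\<^sup>2 - q\<^sup>2 + (- s)\<^sup>2) / (2 * - s) * (a - b)))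
          - (s * a + (r * b + (r\<^sup>2 - q\<^sup>2 + s\<^sup>2) / (2 * s) * (b - a))))) = q\<^sup>2 * a"
  using assms by (simp add: field_simps power2_eq_square)

lemma gT_braid:
  assumes "0 < i" "i + 1 < n"
  shows "gT n \<tau> i (gT n \<tau> (i + 1) (gT n \<tau> i f)) = gT n \<tau> (i + 1) (gT n \<tau> i (gT n \<tau> (i + 1) f))"
proof
  fix g
  let ?x = "coords g i" and ?y = "coords g (i + 1)" and ?z = "coords g (i + 2)"
  let ?a = "ggen n i" and ?b = "ggen n (i + 1)"
  have ne: "?x - ?y \<noteq> 0" "?x - ?z \<noteq> 0" "?y - ?z \<noteq> 0" "?y - ?x \<noteq> 0" "?z - ?x \<noteq> 0" "?z - ?y \<noteq> 0"
    by (rule coords_diff_ne; simp)+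
  define t where "t = par_t \<tau>"
  have d: "gT n \<tau> i h w = h (?a w) + t / (coords w i - coords w (i + 1)) * (h (?a w) - h w)"
    "gT n \<tau> (i + 1) h w = h (?b w) + t / (coords w (i + 1) - coords w (i + 2)) * (h (?b w) - h w)" for h w
    using assms by (simp_all add: gT_def chi_def dcoef_def t_def)
  have c: "coords (?a w) i = coords w (i + 1)" "coords (?a w) (i + 1) = coords w i" "coords (?a w) (i + 2) = coords w (i + 2)"
    "coords (?b w) (i + 1) = coords w (i + 2)" "coords (?b w) (i + 2) = coords w (i + 1)" "coords (?b w) i = coords w i" for w
    using assms by (simp_all add: coords_ggen gen_def)
  define p q r where "p = t / (?x - ?y)" "q = t / (?x - ?z)" "r = t / (?y - ?z)"
  note pqr = p_q_r_def
  have neg: "t / (?y - ?x) = - p" "t / (?z - ?x) = - q" "t / (?z - ?y) = - r"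
    unfolding p_q_r_def by (metis minus_diff_eq minus_divide_right)+
  \<comment> \<open>The partial fraction identity 1/((x-y)(y-z)) = (1/(x-z)) (1/(x-y) + 1/(y-z)); it
    is the only relation between the coefficients that the braid identity needs.\<close>
  have rel: "p * r = q * (p + r)"
    unfolding p_q_r_def using ne by (simp add: divide_simps) (simp add: algebra_simps)
  have br: "?b (?a (?b g)) = ?a (?b (?a g))"
    using ggen_braid[OF assms] by simp
  have br': "?b (?b w) = w" "?a (?a w) = w" "?b (?a (?b (?a g))) = ?a (?b g)" "?a (?b (?a (?b g))) = ?b (?a g)" for w
    using ggen_braid[OF assms, of g] ggen_ggen by metis+
  show "gT n \<tau> i (gT n \<tau> (i + 1) (gT n \<tau> i f)) g = gT n \<tau> (i + 1) (gT n \<tau> i (gT n \<tau> (i + 1) f)) g"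
    unfolding d c br br' neg pqr(1)[symmetric] pqr(2)[symmetric] pqr(3)[symmetric]
    using rel by algebra
qed

text \<open>Both ends of the affine diagram at once: a = s_(n-1), b = s_n with x = x_(n-1), y = x_n,
  and a = s_1, b = s_0 with x = 1/2 - x_2, y = 1/2 - x_1. The first conclusion serves the end n, the
  second the end 0, where B + y is T_0 - X_1 + 1/2.\<close>

lemma dihedral_relation:
  fixes a b :: "'g \<Rightarrow> 'g" and x y :: "'g \<Rightarrow> complex" and t r q :: complex
  assumes inv: "\<And>w. a (a w) = w" "\<And>w. b (b w) = w" "\<And>w. a (b (a (b w))) = b (a (b (a w)))"
    and xy: "\<And>w. x (a w) = y w" "\<And>w. y (a w) = x w" "\<And>w. x (b w) = x w" "\<And>w. y (b w) = - y w"
    and ne: "\<And>w. x w \<noteq> 0" "\<And>w. y w \<noteq> 0" "\<And>w. x w - y w \<noteq> 0" "\<And>w. x w + y w \<noteq> 0"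
  defines "s \<equiv> \<lambda>f w. f (a w) + t / (x w - y w) * (f (a w) - f w)"
    and "B \<equiv> \<lambda>f w. r * f (b w) + (r\<^sup>2 - q\<^sup>2 + (y w)\<^sup>2) / (2 * y w) * (f (b w) - f w)"
  shows "B (\<lambda>w. s (B (s f)) w + t * s f w) g = s (B (s (B f))) g + t * s (B f) g"
    and "B (s (B (s f))) g + y g * s (B (s f)) g = s (B (s (\<lambda>w. B f w + y w * f w))) g"
proof -
  define X Y where "X = x g" "Y = y g"
  note XY = this
  define p p' m where "p = 1 / (X - Y)" "p' = 1 / (X + Y)" "m = 1 / X"
  note pp = this
  define k where "k = r\<^sup>2 - q\<^sup>2"
  define D E where "D = (k + X\<^sup>2) / (2 * X)" "E = (k + Y\<^sup>2) / (2 * Y)"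
  note DE = this
  have bs: "b (a (b (a g))) = a (b (a (b g)))" "a (b (a (b (a g)))) = b (a (b g))" 
    "b (a (b (a (b g)))) = a (b (a g))"
    using inv by metis+
  have sS: "s f w = f (a w) + t * (1 / (x w - y w)) * (f (a w) - f w)" for f w
    by (simp add: s_def)
  have ne': "y g + x g \<noteq> 0" "- x g \<noteq> y g" "- y g \<noteq> x g"
    using ne(4)[of g] by (auto simp: add.commute neg_eq_iff_add_eq_0)
  have fr: "1 / (Y - X) = - p" "1 / (X - Y) = p" "1 / (X + Y) = p'" "1 / (Y + X) = p'"
     "1 / (- X - Y) = - p'" "1 / (- Y - X) = - p'" "1 / (- X + Y) = - p" "1 / (- Y + X) = p" "1 / (Y - - X) = p'"
    "1 / (X - - Y) = p'" "1 / (- Y - - X) = p" "1 / (- X - - Y) = - p"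
    unfolding pp using ne[of g] ne' by (auto simp: XY divide_simps)
  have frD: "(k + X\<^sup>2) / (2 * X) = D" "(k + (- X)\<^sup>2) / (2 * - X) = - D" 
      "(k + Y\<^sup>2) / (2 * Y) = E" "(k + (- Y)\<^sup>2) / (2 * - Y) = - E"
    unfolding DE by simp_all
  have rel: "p * (X - Y) = 1" "p' * (X + Y) = 1" "2 * X * D - X\<^sup>2 = 2 * Y * E - Y\<^sup>2" "X * m = 1"
    unfolding pp DE using ne[of g] by (auto simp: XY)
  note eqs = sS B_def k_def[symmetric] inv(1,2) bs xy XY[symmetric] fr frD minus_minus
  \<comment> \<open>Here p (D - E) = (1 - k/(XY))/2 and p' (D + E) = (1 + k/(XY))/2, so the
    parameter k cancels in the sum.\<close>
  have rel': "p * (D - E) + p' * (D + E) = 1"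
  proof -
    have "(p * (D - E) + p' * (D + E)) * ((X - Y) * (X + Y)) = (X - Y) * (X + Y)"
      using rel by algebra
    then show ?thesis using ne[of g] by (simp add: XY)
  qed
  show *: "B (\<lambda>w. s (B (s f)) w + t * s f w) g = s (B (s (B f))) g + t * s (B f) g"
    unfolding eqs using rel' by algebra
  have B_add: "B (\<lambda>w. h w + t * h' w) g = B h g + t * B h' g" for h h'
    unfolding B_def by (simp add: diff_divide_distrib add_divide_distrib algebra_simps)
  \<comment> \<open>Moving y through s turns it into x, which commutes with B, and moving x through
    s turns it back; the corrections t h are exactly the difference between the two
    conclusions.\<close>
  have sy: "s (\<lambda>w. y w * h w) = (\<lambda>w. x w * s h w + t * h w)" for h
    using ne(3) by (auto simp: fun_eq_iff s_def xy field_simps)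
  have sx: "s (\<lambda>w. x w * h w) w = y w * s h w - t * h w" for h w
    using ne(3)[of w] by (auto simp: s_def xy field_simps)
  have s_lin: "s (\<lambda>w. h w + t * h' w) w = s h w + t * s h' w" for h h' w
    by (simp add: s_def algebra_simps add_divide_distrib diff_divide_distrib)
  have Bx: "B (\<lambda>w. x w * h w + t * h' w) = (\<lambda>w. x w * B h w + t * B h' w)" for h h'
    unfolding B_def xy by (simp add: fun_eq_iff right_diff_distrib distrib_left mult.left_commute)
  have lin: "A + v = r'" if "A + t * c = d + t * e" "v - z = t * (c - e)" "r' = d + z"
    for A c d e v z r' :: complex
    using that by algebra
  have s_plus: "s (\<lambda>w. h w + h' w) = (\<lambda>w. s h w + s h' w)"
    and B_plus: "B (\<lambda>w. h w + h' w) = (\<lambda>w. B h w + B h' w)" for h h'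
    unfolding s_def B_def by (simp_all add: fun_eq_iff right_diff_distrib distrib_left)
  have "y g * s (B (s f)) g - s (B (s (\<lambda>w. y w * f w))) g = t * (B (s f) g - s (B f) g)"
    unfolding sy Bx s_lin sx by (simp add: algebra_simps)
  moreover have "s (B (s (\<lambda>w. B f w + y w * f w))) g = s (B (s (B f))) g + s (B (s (\<lambda>w. y w * f w))) g"
    unfolding s_plus B_plus ..
  ultimately show "B (s (B (s f))) g + y g * s (B (s f)) g = s (B (s (\<lambda>w. B f w + y w * f w))) g"
    using *[unfolded B_add] lin by blast
qed

lemma gT_mid:
  assumes "0 < i" "i < n"
  shows "gT n \<tau> i f = (\<lambda>w. f (ggen n i w) + par_t \<tau> / (coords w i - coords w (i + 1)) * (f (ggen n i w) - f w))"
  using assms by (simp add: gT_def chi_def dcoef_def)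

lemma gT_n:
  assumes "0 < n"
  shows "gT n \<tau> n f = (\<lambda>w. par_tn \<tau> * f (ggen n n w)
     + ((par_tn \<tau>)\<^sup>2 - (par_un \<tau>)\<^sup>2 + (coords w n)\<^sup>2) / (2 * coords w n) * (f (ggen n n w) - f w))"
  using assms by (simp add: gT_def chi_def dcoef_def)

lemma gT_0:
  "gT n \<tau> 0 f = (\<lambda>w. par_t0 \<tau> * f (ggen n 0 w)
     + ((par_t0 \<tau>)\<^sup>2 - (par_u0 \<tau>)\<^sup>2 + (1/2 - coords w 1)\<^sup>2) / (2 * (1/2 - coords w 1)) * (f (ggen n 0 w) - f w))"
  by (simp add: gT_def chi_def dcoef_def right_diff_distrib)

text \<open>d_i changes sign under s_i, so all terms containing it cancel in the square.\<close>

lemma gT_gT: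
  assumes "i \<le> n" "1 \<le> n"
  shows "gT n \<tau> i (gT n \<tau> i f) = (\<lambda>g. (chi n \<tau> i)\<^sup>2 * f g)"
proof
  fix g
  have x: "dcoef n \<tau> i (coords (ggen n i g)) = - dcoef n \<tau> i (coords g)"
  proof -
    have e: "1 - 2 * (1 - c) = - (1 - 2 * c)" "(1/2 - (1 - c))\<^sup>2 = (1/2 - c)\<^sup>2" for c :: complex
      by (simp_all add: power2_eq_square algebra_simps)
    consider "i = 0" | "i = n" "i \<noteq> 0" | "i \<noteq> 0" "i \<noteq> n" by blast
    then show ?thesis
    proof cases
      case 1
      then have "coords (ggen n i g) 1 = 1 - coords g 1" by (simp add: coords_ggen gen_def)
      then show ?thesis using 1 unfolding dcoef_def by (simp only: e if_True minus_divide_right refl)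
    next
      case 2
      then have "coords (ggen n i g) n = - coords g n" by (simp add: coords_ggen gen_def)
      then show ?thesis using 2 by (simp add: dcoef_def)
    next
      case 3
      then have "coords (ggen n i g) i = coords g (i + 1)" "coords (ggen n i g) (i + 1) = coords g i"
        by (simp_all add: coords_ggen gen_def)
      then show ?thesis using 3 minus_divide_right[of "par_t \<tau>" "coords g i - coords g (i + 1)"]
        by (simp add: dcoef_def)
    qed
  qed
  show "gT n \<tau> i (gT n \<tau> i f) g = (chi n \<tau> i)\<^sup>2 * f g"
    by (simp add: gT_def ggen_ggen x power2_eq_square algebra_simps)
qed

lemma degenerate_daha_gT:
  assumes "2 \<le> n"
  shows "degenerate_daha (\<lambda>c (f::gfun) g. c * f g) n (gT n \<tau>) gX
    (par_t0 \<tau>) (par_u0 \<tau>) (par_t \<tau>) (par_tn \<tau>) (par_un \<tau>)"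
proof
  fix f h :: gfun and i j :: nat and c c' :: complex
  show "(\<lambda>g. c * (f + h) g) = (\<lambda>g. c * f g) + (\<lambda>g. c * h g)"
    "(\<lambda>g. (c + c') * f g) = (\<lambda>g. c * f g) + (\<lambda>g. c' * f g)"
    "(\<lambda>g. c * (c' * f g)) = (\<lambda>g. c * c' * f g)" "(\<lambda>g. 1 * f g) = f" "2 \<le> n"
    using assms by (auto simp: fun_eq_iff algebra_simps)
  show "gT n \<tau> i (f + h) = gT n \<tau> i f + gT n \<tau> i h" "gT n \<tau> i (\<lambda>g. c * f g) = (\<lambda>g. c * gT n \<tau> i f g)"
    "gX i (f + h) = gX i f + gX i h" "gX i (\<lambda>g. c * f g) = (\<lambda>g. c * gX i f g)"
    by (auto simp: fun_eq_iff gT_def gX_def algebra_simps)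
  show "gT n \<tau> i (gT n \<tau> i f) = f" if "0 < i" "i < n"
    using gT_gT[of i n \<tau> f] that by (simp add: chi_def)
  show "gT n \<tau> 0 (gT n \<tau> 0 f) = (\<lambda>g. (par_t0 \<tau>)\<^sup>2 * f g)"
    using gT_gT[of 0 n \<tau> f] assms by (simp add: chi_def)
  show "gT n \<tau> n (gT n \<tau> n f) = (\<lambda>g. (par_tn \<tau>)\<^sup>2 * f g)"
    using gT_gT[of n n \<tau> f] assms by (simp add: chi_def)
  show "gT n \<tau> i (gT n \<tau> j f) = gT n \<tau> j (gT n \<tau> i f)" if "j \<le> n" "i + 1 < j"
  proof
    fix g
    have "dcoef n \<tau> i (coords (ggen n j g)) = dcoef n \<tau> i (coords g)"
      "dcoef n \<tau> j (coords (ggen n i g)) = dcoef n \<tau> j (coords g)"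
      using that by (auto simp: dcoef_def coords_ggen gen_def)
    then show "gT n \<tau> i (gT n \<tau> j f) g = gT n \<tau> j (gT n \<tau> i f) g"
      unfolding gT_def by (simp add: ggen_far[OF that] algebra_simps)
  qed
  show "gT n \<tau> i (gT n \<tau> (i + 1) (gT n \<tau> i f)) = gT n \<tau> (i + 1) (gT n \<tau> i (gT n \<tau> (i + 1) f))"
    if "0 < i" "i + 1 < n" by (rule gT_braid[OF that])
  have n: "0 < n - 1" "n - 1 < n" "n - 1 + 1 = n" "0 < n" "n - 1 \<noteq> n" using assms by auto
  have inv_n: "ggen n (n - 1) (ggen n (n - 1) w) = w" "ggen n n (ggen n n w) = w"
    "ggen n (n - 1) (ggen n n (ggen n (n - 1) (ggen n n w))) = ggen n n (ggen n (n - 1) (ggen n n (ggen n (n - 1) w)))"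
    "coords (ggen n (n - 1) w) (n - 1) = coords w n" "coords (ggen n (n - 1) w) n = coords w (n - 1)"
    "coords (ggen n n w) (n - 1) = coords w (n - 1)" "coords (ggen n n w) n = - coords w n"
    "coords w (n - 1) \<noteq> 0" "coords w n \<noteq> 0" "coords w (n - 1) - coords w n \<noteq> 0" "coords w (n - 1) + coords w n \<noteq> 0" for w
    using n ggen_braid_n[OF assms, of w] by (simp_all add: ggen_ggen coords_ggen gen_def coords_sum_ne coords_diff_ne del: right_minus_eq)
  show "gT n \<tau> n (gT n \<tau> (n - 1) (gT n \<tau> n (gT n \<tau> (n - 1) f)) + (\<lambda>g. par_t \<tau> * gT n \<tau> (n - 1) f g))
    = gT n \<tau> (n - 1) (gT n \<tau> n (gT n \<tau> (n - 1) (gT n \<tau> n f))) + (\<lambda>g. par_t \<tau> * gT n \<tau> (n - 1) (gT n \<tau> n f) g)"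
    unfolding gT_mid[OF n(1,2)] gT_n[OF n(4)] n(3) fun_eq_iff plus_fun_apply
    using dihedral_relation(1)[where a = "ggen n (n - 1)" and b = "ggen n n" and x = "\<lambda>w. coords w (n - 1)"
      and y = "\<lambda>w. coords w n", OF inv_n] by blast
  have inv_0: "ggen n 1 (ggen n 1 w) = w" "ggen n 0 (ggen n 0 w) = w"
    "ggen n 1 (ggen n 0 (ggen n 1 (ggen n 0 w))) = ggen n 0 (ggen n 1 (ggen n 0 (ggen n 1 w)))"
    "1/2 - coords (ggen n 1 w) 2 = 1/2 - coords w 1" "1/2 - coords (ggen n 1 w) 1 = 1/2 - coords w 2"
    "1/2 - coords (ggen n 0 w) 2 = 1/2 - coords w 2" "1/2 - coords (ggen n 0 w) 1 = - (1/2 - coords w 1)"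
    "1/2 - coords w 2 \<noteq> 0" "1/2 - coords w 1 \<noteq> 0"
    "1/2 - coords w 2 - (1/2 - coords w 1) \<noteq> 0" "1/2 - coords w 2 + (1/2 - coords w 1) \<noteq> 0" for w
    using assms ggen_braid_0[OF assms, of w] coords_sum_ne(5)[of w 1] coords_sum_ne(5)[of w 2]
      coords_diff_ne[of 1 2 w] coords_sum_ne(3)[of w 2 1]
    by (simp_all add: ggen_ggen coords_ggen gen_def numeral_2_eq_2 algebra_simps)
  have "1/2 - coords w 2 - (1/2 - coords w 1) = coords w 1 - coords w (1 + 1)" for w
    by (simp add: numeral_2_eq_2)
  note D0_eq = this
  have g01: "0 < (1::nat)" "1 < n" using assms by auto
  note D0 = dihedral_relation(2)[where a = "ggen n 1" and b = "ggen n 0" and x = "\<lambda>w. 1/2 - coords w 2"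
      and y = "\<lambda>w. 1/2 - coords w 1", OF inv_0, unfolded D0_eq]
  have "gT n \<tau> 0 (gT n \<tau> 1 (gT n \<tau> 0 (gT n \<tau> 1 f))) g
      + (1/2 - coords g 1) * gT n \<tau> 1 (gT n \<tau> 0 (gT n \<tau> 1 f)) g
      = gT n \<tau> 1 (gT n \<tau> 0 (gT n \<tau> 1 (\<lambda>w. gT n \<tau> 0 f w + (1/2 - coords w 1) * f w))) g" for g
    unfolding gT_mid[OF g01] gT_0
    by (rule D0[where r = "par_t0 \<tau>" and q = "par_u0 \<tau>" and t = "par_t \<tau>" and f = f and g = g])
  moreover have "gT n \<tau> 1 (gT n \<tau> 0 (gT n \<tau> 1 (\<lambda>w. gT n \<tau> 0 f w + (1/2 - coords w 1) * f w))) g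
    = gT n \<tau> 1 (gT n \<tau> 0 (gT n \<tau> 1 (gT n \<tau> 0 f - gX 1 f))) g + 1/2 * gT n \<tau> 1 (gT n \<tau> 0 (gT n \<tau> 1 f)) g" for g
    by (simp add: gT_def gX_def algebra_simps)
  ultimately show "gT n \<tau> 0 (gT n \<tau> 1 (gT n \<tau> 0 (gT n \<tau> 1 f))) - gX 1 (gT n \<tau> 1 (gT n \<tau> 0 (gT n \<tau> 1 f)))
    = gT n \<tau> 1 (gT n \<tau> 0 (gT n \<tau> 1 (gT n \<tau> 0 f - gX 1 f)))"
    by (simp add: fun_eq_iff gX_def algebra_simps)
  show "gT n \<tau> i (gX (i + 1) (gT n \<tau> i f)) = gX i f + (\<lambda>g. par_t \<tau> * gT n \<tau> i f g)" if "0 < i" "i < n"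
  proof
    fix g
    define p where "p = par_t \<tau> / (coords g i - coords g (i + 1))"
    have p: "p * (coords g i - coords g (i + 1)) = par_t \<tau>"
      using coords_diff_ne[of i "i + 1" g] by (simp add: p_def)
    have "par_t \<tau> / (coords g (i + 1) - coords g i) = - p"
      unfolding p_def by (metis minus_diff_eq minus_divide_right)
    then have neg: "(p * (coords g i - coords g (i + 1))) / (coords g (i + 1) - coords g i) = - p"
      by (simp only: p)
    have c: "coords (ggen n i g) (i + 1) = coords g i" "coords (ggen n i g) i = coords g (i + 1)"
      using that by (simp_all add: coords_ggen gen_def)
    have p': "par_t \<tau> / (coords g i - coords g (i + 1)) = p" "par_t \<tau> / (coords g (i + 1) - coords g i) = - p"
      using neg p by (simp_all add: p_def)
    show "gT n \<tau> i (gX (i + 1) (gT n \<tau> i f)) g = (gX i f + (\<lambda>g. par_t \<tau> * gT n \<tau> i f g)) g"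
      unfolding gT_mid[OF that] gX_def plus_fun_apply c ggen_ggen p' unfolding p[symmetric]
      by (simp add: algebra_simps)
  qed
  show "gT n \<tau> i (gX 1 f) = gX 1 (gT n \<tau> i f)" if "1 < i" "i \<le> n"
  proof
    fix g
    have "coords (ggen n i g) 1 = coords g 1" using that by (auto simp: coords_ggen gen_def)
    then show "gT n \<tau> i (gX 1 f) g = gX 1 (gT n \<tau> i f) g"
      unfolding gT_def gX_def by (simp add: right_diff_distrib distrib_left mult.left_commute)
  qed
  show "gX n (gX n f + gT n \<tau> n f) + gT n \<tau> n (gX n f + gT n \<tau> n f) = (\<lambda>g. (par_un \<tau>)\<^sup>2 * f g)"
  proof
    fix g
    have c: "coords (ggen n n g) n = - coords g n" using n by (simp add: coords_ggen gen_def)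
    show "(gX n (gX n f + gT n \<tau> n f) + gT n \<tau> n (gX n f + gT n \<tau> n f)) g = (par_un \<tau>)\<^sup>2 * f g"
      unfolding gT_n[OF n(4)] gX_def plus_fun_apply c ggen_ggen
      by (rule quadratic_relation) (rule coords_sum_ne)
  qed
  show "let D = \<lambda>v. gT n \<tau> 0 v - gX 1 v + (\<lambda>g. 1/2 * v g) in D (D f) = (\<lambda>g. (par_u0 \<tau>)\<^sup>2 * f g)"
  proof -
    define D where "D v = gT n \<tau> 0 v - gX 1 v + (\<lambda>g. 1/2 * v g)" for v
    have D: "D v = (\<lambda>w. (1/2 - coords w 1) * v w + gT n \<tau> 0 v w)" for v
      by (simp add: D_def gX_def algebra_simps fun_eq_iff)
    have "D (D f) g = (par_u0 \<tau>)\<^sup>2 * f g" for g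
      unfolding D gT_0 ggen_ggen inv_0(7)
      by (rule quadratic_relation) (rule inv_0(9))
    then show ?thesis by (simp add: Let_def D_def fun_eq_iff)
  qed
qed

section \<open>Transfer from functions of generic points to polynomials\<close>

definition restr :: "cfun \<Rightarrow> gfun" where
  "restr p = (\<lambda>g. p (coords g))"

lemma Pol_line_continuous:
  "p \<in> Pol n \<Longrightarrow> continuous_on UNIV (\<lambda>z. p (\<lambda>i. x i + z * w i))"
  by (induction rule: Pol.induct) (auto intro!: continuous_intros)

lemma continuous_zero_of_cocountable:
  fixes q :: "complex \<Rightarrow> complex"
  assumes "continuous_on UNIV q" "countable A" "\<And>z. z \<notin> A \<Longrightarrow> q z = 0"
  shows "q z = 0"
proof (rule ccontr)
  assume "q z \<noteq> 0"
  then have "z \<in> {z. q z \<noteq> 0}" by simp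
  moreover have "open {z. q z \<noteq> 0}"
    using open_Collect_neq[of q "\<lambda>_. 0"] assms(1) by simp
  ultimately obtain e where "e > 0" "ball z e \<subseteq> {z. q z \<noteq> 0}"
    by (metis openE)
  then have "ball z e \<subseteq> A" using assms(3) by auto
  then show False using assms(2) \<open>e > 0\<close> uncountable_ball countable_subset by blast
qed

lemma countable_Ints: "countable (\<int> :: complex set)"
  by (simp add: Ints_def)

text \<open>On the line through x in a generic direction w, each of the countably many conditions of
  genericity fails for countably many parameters only, so the polynomials agree off a countable set
  of the line and, by continuity, at x.\<close>

lemma Pol_generic_eqI:
  assumes "p \<in> Pol n" "q \<in> Pol n" "\<And>x. generic x \<Longrightarrow> p x = q x"
  shows "p = q"
proof
  fix x
  obtain w where w: "generic w" using generic_imaginary by blast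
  let ?A = "(\<Union>i. \<Union>j. (\<lambda>m. (m - (x i + x j)) / (w i + w j)) ` \<int> \<union> (\<lambda>m. (m - (x i - x j)) / (w i - w j)) ` \<int>)"
  have w0: "w i + w j \<noteq> 0" "i \<noteq> j \<Longrightarrow> w i - w j \<noteq> 0" for i j
    using w unfolding generic_def by (metis Ints_0)+
  have gen: "generic (\<lambda>i. x i + z * w i)" if "z \<notin> ?A" for z
    unfolding generic_def
  proof (intro allI conjI impI notI)
    fix i j
    assume "x i + z * w i + (x j + z * w j) \<in> \<int>"
    moreover have "z = ((x i + z * w i + (x j + z * w j)) - (x i + x j)) / (w i + w j)"
      using w0(1)[of i j] by (simp add: field_simps)
    ultimately show False using that by blast
  next
    fix i j :: nat
    assume "i \<noteq> j" "x i + z * w i - (x j + z * w j) \<in> \<int>"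
    moreover have "z = ((x i + z * w i - (x j + z * w j)) - (x i - x j)) / (w i - w j)"
      using w0(2)[OF \<open>i \<noteq> j\<close>] by (simp add: field_simps)
    ultimately show False using that by blast
  qed
  have "p (\<lambda>i. x i + 0 * w i) - q (\<lambda>i. x i + 0 * w i) = 0"
    by (rule continuous_zero_of_cocountable[of "\<lambda>z. p (\<lambda>i. x i + z * w i) - q (\<lambda>i. x i + z * w i)" ?A])
      (use assms gen in \<open>auto intro!: continuous_on_diff Pol_line_continuous[OF assms(1)]
          Pol_line_continuous[OF assms(2)] countable_image countable_Ints\<close>)
  then show "p x = q x" by simp
qed

lemma restr_inj:
  assumes "p \<in> Pol n" "q \<in> Pol n" "restr p = restr q"
  shows "p = q"
proof (rule Pol_generic_eqI[OF assms(1,2)])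
  fix x assume "generic x"
  then have "coords (Abs_gpoint x) = x" by (simp add: Abs_gpoint_inverse)
  then show "p x = q x" using fun_cong[OF assms(3), of "Abs_gpoint x"] by (simp add: restr_def)
qed

lemma T_props:
  assumes "1 \<le> n" "i \<le> n" "p \<in> Pol n"
  shows "T n \<tau> i p \<in> Pol n"
    and "aff n i x \<noteq> 0 \<Longrightarrow> T n \<tau> i p x = chi n \<tau> i * p (gen n i x) + dcoef n \<tau> i x * (p (gen n i x) - p x)"
  using theI'[OF T_ex1[OF assms, of \<tau>]] unfolding T_def act_gen by auto

lemma aff_generic: "aff n i (coords g) \<noteq> 0"
  using coords_sum_ne(2)[of g n] coords_sum_ne(4)[of g 1] coords_diff_ne[of i "i + 1" g]
  by (auto simp: aff_def)

lemma restr_T: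
  assumes "1 \<le> n" "i \<le> n" "p \<in> Pol n"
  shows "restr (T n \<tau> i p) = gT n \<tau> i (restr p)"
  by (simp add: fun_eq_iff restr_def gT_def T_props(2)[OF assms aff_generic] coords_ggen)

lemma foldr_T_Pol:
  assumes "1 \<le> n" "set is \<subseteq> {0..n}" "p \<in> Pol n"
  shows "foldr (T n \<tau>) is p \<in> Pol n \<and> restr (foldr (T n \<tau>) is p) = foldr (gT n \<tau>) is (restr p)"
  using assms(2) by (induction "is") (auto simp: T_props(1)[OF assms(1)] restr_T[OF assms(1)] assms(3))

lemma Pol_sum: "(\<And>a. a \<in> A \<Longrightarrow> f a \<in> Pol n) \<Longrightarrow> (\<lambda>x. \<Sum>a\<in>A. f a x) \<in> Pol n"
  by (induction A rule: infinite_finite_induct) (auto intro: Pol.intros)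

lemma sum_fun_apply: "(\<Sum>a\<in>A. f a) x = (\<Sum>a\<in>A. (f a x :: complex))"
  by (induction A rule: infinite_finite_induct) auto

definition eigenfun :: "nat \<Rightarrow> wilson_params \<Rightarrow> point \<Rightarrow> cfun \<Rightarrow> bool" where
  "eigenfun n \<tau> g p \<longleftrightarrow> (\<forall>j\<in>{1..n}. Y n \<tau> j p = (\<lambda>x. g j * p x))"

text \<open>S_i^2 acts on an eigenvector with eigenvalue g by -4 times this number.\<close>

definition S_square :: "nat \<Rightarrow> wilson_params \<Rightarrow> nat \<Rightarrow> point \<Rightarrow> complex" where
  "S_square n \<tau> i g =
     (if i = 0 then 4 * (g 1 + 1/2)\<^sup>2 * (par_un \<tau>)\<^sup>2 - ((par_u0 \<tau>)\<^sup>2 - (par_un \<tau>)\<^sup>2 - (g 1 + 1/2)\<^sup>2)\<^sup>2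
      else if i = n then 4 * (g n)\<^sup>2 * (par_tn \<tau>)\<^sup>2 - ((g n)\<^sup>2 + (par_tn \<tau>)\<^sup>2 - (par_t0 \<tau>)\<^sup>2)\<^sup>2
      else (g i - g (i + 1))\<^sup>2 - (par_t \<tau>)\<^sup>2)"

context
  fixes n :: nat and \<tau> :: wilson_params
  assumes n: "2 \<le> n"
begin

interpretation D: degenerate_daha "\<lambda>c (f::gfun) g. c * f g" n "gT n \<tau>" gX
  "par_t0 \<tau>" "par_u0 \<tau>" "par_t \<tau>" "par_tn \<tau>" "par_un \<tau>"
  by (rule degenerate_daha_gT[OF n])

lemma n1: "1 \<le> n" using n by simp

lemma Y_Pol:
  assumes "p \<in> Pol n" "i \<in> {1..n}"
  shows "Y n \<tau> i p \<in> Pol n" "restr (Y n \<tau> i p) = D.Y i (restr p)"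
proof -
  have 1: "set ([i..<n] @ [n] @ rev [i..<n]) \<subseteq> {0..n}" "set (rev [1..<i] @ [0] @ [1..<i]) \<subseteq> {0..n}"
    using assms by auto
  have 2: "set ([i..<j - 1] @ [j - 1] @ rev [i..<j - 1]) \<subseteq> {0..n}" if "j \<in> {i + 1..n}" for j
    using that by auto
  show "Y n \<tau> i p \<in> Pol n"
    unfolding Y_def T2_def
    by (intro Pol.intros Pol_sum) (use foldr_T_Pol[OF n1 _ assms(1)] 1 2 in blast)+
  have "restr (T2 n \<tau> i j p) = D.R i j (restr p)" if "j \<in> {i + 1..n}" for j
    using foldr_T_Pol[OF n1 2[OF that] assms(1)] unfolding T2_def D.R_def by blast
  then have "(\<Sum>j = i + 1..n. T2 n \<tau> i j p (coords g)) = (\<Sum>j = i + 1..n. D.R i j (restr p) g)" for g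
    by (intro sum.cong refl) (auto simp: restr_def fun_eq_iff)
  then show "restr (Y n \<tau> i p) = D.Y i (restr p)"
    using foldr_T_Pol[OF n1 1(1) assms(1), of \<tau>] foldr_T_Pol[OF n1 1(2) assms(1), of \<tau>]
    unfolding Y_def D.Y_def D.P_def D.Q_def restr_def plus_fun_apply sum_fun_apply fun_eq_iff by metis
qed

lemma U_Pol:
  assumes "p \<in> Pol n"
  shows "U n \<tau> p \<in> Pol n" "restr (U n \<tau> p) = D.V 1 (restr p)"
proof -
  have s: "set [1..<n] \<subseteq> {0..n}" "set (rev [1..<n]) \<subseteq> {0..n}" by auto
  let ?q = "foldr (T n \<tau>) (rev [1..<n]) p"
  have q: "?q \<in> Pol n" "restr ?q = foldr (gT n \<tau>) (rev [1..<n]) (restr p)"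
    using foldr_T_Pol[OF n1 s(2) assms] by blast+
  let ?r = "\<lambda>x. - x n * ?q x - T n \<tau> n ?q x"
  have "(\<lambda>x. (-1) * (x n * ?q x) - T n \<tau> n ?q x) \<in> Pol n"
    by (intro Pol_minus Pol.intros q T_props(1)) (use n in auto)
  then have r: "?r \<in> Pol n" by simp
  have rr: "restr ?r = D.C (restr ?q)"
    using restr_T[OF n1 order_refl q(1), of \<tau>] by (simp add: D.C_def restr_def fun_eq_iff gX_def)
  show "U n \<tau> p \<in> Pol n" "restr (U n \<tau> p) = D.V 1 (restr p)"
    using foldr_T_Pol[OF n1 s(1) r, of \<tau>] unfolding U_def D.V_def rr q(2) by auto
qed

lemma S_gen_Pol:
  assumes "p \<in> Pol n" "i \<le> n"
  shows "S_gen n \<tau> i p \<in> Pol n" "restr (S_gen n \<tau> i p) = D.S i (restr p)"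
proof -
  have r: "restr (\<lambda>x. p x - q x) = restr p - restr q" "restr (\<lambda>x. c * p x) = (\<lambda>g. c * restr p g)" for p q c
    by (auto simp: restr_def)
  let ?A = "if i = 0 then U n \<tau> else T n \<tau> i"
  let ?a = "\<lambda>p x. if i = 0 then p x - 2 * Y n \<tau> 1 p x
     else if i = n then 2 * Y n \<tau> n p x else Y n \<tau> i p x - Y n \<tau> (i + 1) p x"
  have A: "?A p \<in> Pol n" if "p \<in> Pol n" for p
    using that U_Pol T_props(1)[OF n1 assms(2)] by auto
  have a: "?a p \<in> Pol n" if "p \<in> Pol n" for p
  proof -
    consider "i = 0" | "i = n" | "0 < i" "i < n" using assms(2) by linarith
    then show ?thesis
      using n by cases (auto intro!: Pol_minus Pol.Pol_mult Pol.Pol_const Y_Pol(1) that)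
  qed
  show "S_gen n \<tau> i p \<in> Pol n"
    unfolding S_gen_def commutator_def aff_Y_def
    by (intro Pol_minus A a assms)
  have ra: "restr (?a p) = (if i = 0 then restr p - (\<lambda>g. 2 * D.Y 1 (restr p) g)
     else if i = n then (\<lambda>g. 2 * D.Y n (restr p) g) else D.Y i (restr p) - D.Y (i + 1) (restr p))"
    if "p \<in> Pol n" for p
    using that n assms(2) Y_Pol(2)[of p] by (simp add: r)
  have rA: "restr (?A p) = (if i = 0 then D.V 1 (restr p) else gT n \<tau> i (restr p))" if "p \<in> Pol n" for p
    using that U_Pol(2) restr_T[OF n1 assms(2)] by auto
  show "restr (S_gen n \<tau> i p) = D.S i (restr p)"
    unfolding S_gen_def commutator_def aff_Y_def D.S_def r(1) rA[OF a[OF assms(1)]]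
      ra[OF A[OF assms(1)]] rA[OF assms(1)] ra[OF assms(1)] by auto
qed

lemma eigenfun_iff: "p \<in> Pol n \<Longrightarrow> eigenfun n \<tau> g p \<longleftrightarrow> D.eigen g (restr p)"
proof -
  assume p: "p \<in> Pol n"
  have "Y n \<tau> j p = (\<lambda>x. g j * p x) \<longleftrightarrow> D.Y j (restr p) = (\<lambda>w. g j * restr p w)" if "j \<in> {1..n}" for j
  proof -
    have "(\<lambda>x. g j * p x) \<in> Pol n" by (intro Pol.intros p)
    then have "Y n \<tau> j p = (\<lambda>x. g j * p x) \<longleftrightarrow> restr (Y n \<tau> j p) = restr (\<lambda>x. g j * p x)"
      using restr_inj Y_Pol(1)[OF p that] by metis
    then show ?thesis unfolding Y_Pol(2)[OF p that] by (simp add: restr_def)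
  qed
  then show ?thesis unfolding eigenfun_def D.eigen_def by blast
qed

lemma eigenfun_S_gen:
  assumes "p \<in> Pol n" "eigenfun n \<tau> g p" "i \<le> n"
  shows "eigenfun n \<tau> (dot_gen n i g) (S_gen n \<tau> i p)"
    and "S_gen n \<tau> i (S_gen n \<tau> i p) = (\<lambda>x. - 4 * S_square n \<tau> i g * p x)"
proof -
  note e = assms(2)[unfolded eigenfun_iff[OF assms(1)]]
  note Sp = S_gen_Pol(1)[OF assms(1,3)] and S2 = S_gen_Pol(2)[OF S_gen_Pol(1)[OF assms(1,3)] assms(3)]
  consider "i = 0" | "i = n" | "0 < i" "i < n" using assms(3) by linarith
  then have "D.eigen (dot_gen n i g) (D.S i (restr p)) \<and>
      D.S i (D.S i (restr p)) = (\<lambda>w. - 4 * S_square n \<tau> i g * restr p w)"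
  proof cases
    case 1
    then show ?thesis using D.eigen_S_0[OF e] by (simp add: S_square_def)
  next
    case 2
    then show ?thesis using D.eigen_S_n[OF e] n by (simp add: S_square_def)
  next
    case 3
    then show ?thesis using D.eigen_S_mid[OF e 3] by (simp add: S_square_def)
  qed
  note * = conjunct1[OF this] conjunct2[OF this]
  show "eigenfun n \<tau> (dot_gen n i g) (S_gen n \<tau> i p)"
    unfolding eigenfun_iff[OF Sp] S_gen_Pol(2)[OF assms(1,3)] by (rule *)
  show "S_gen n \<tau> i (S_gen n \<tau> i p) = (\<lambda>x. - 4 * S_square n \<tau> i g * p x)"
    by (rule restr_inj[OF S_gen_Pol(1)[OF Sp assms(3)] Pol.Pol_mult[OF Pol.Pol_const assms(1)]])
      (unfold S2 S_gen_Pol(2)[OF assms(1,3)] *(2), simp add: restr_def)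
qed

lemma Y_sum:
  assumes "\<And>a. a \<in> A \<Longrightarrow> f a \<in> Pol n" "j \<in> {1..n}"
  shows "Y n \<tau> j (\<lambda>x. \<Sum>a\<in>A. c a * f a x) = (\<lambda>x. \<Sum>a\<in>A. c a * Y n \<tau> j (f a) x)"
proof -
  have 1: "(\<lambda>x. \<Sum>a\<in>A. c a * f a x) \<in> Pol n" "(\<lambda>x. \<Sum>a\<in>A. c a * Y n \<tau> j (f a) x) \<in> Pol n"
    by (intro Pol_sum Pol.Pol_mult Pol.Pol_const Y_Pol(1) assms; assumption)+
  have D0: "D.Y j 0 = 0" using D.Y_add[of j 0 0] by simp
  have "D.Y j (\<Sum>a\<in>B. (\<lambda>g. c a * restr (f a) g)) = (\<Sum>a\<in>B. (\<lambda>g. c a * D.Y j (restr (f a)) g))" for B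
    by (induction B rule: infinite_finite_induct) (simp_all only: sum.infinite sum.empty sum.insert D0 D.Y_add D.Y_scale
        simp_thms not_False_eq_True)
  moreover have "restr (\<lambda>x. \<Sum>a\<in>A. c a * f a x) = (\<Sum>a\<in>A. (\<lambda>g. c a * restr (f a) g))"
    by (simp add: fun_eq_iff sum_fun_apply restr_def)
  moreover have "restr (\<lambda>x. \<Sum>a\<in>A. c a * Y n \<tau> j (f a) x) = (\<Sum>a\<in>A. (\<lambda>g. c a * D.Y j (restr (f a)) g))"
    using Y_Pol(2)[OF assms(1) assms(2)] by (auto simp: fun_eq_iff sum_fun_apply restr_def intro!: sum.cong)
  ultimately show ?thesis
    using restr_inj[OF Y_Pol(1)[OF 1(1) assms(2)] 1(2)] Y_Pol(2)[OF 1(1) assms(2)] by simp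
qed

lemma T_one: "i \<le> n \<Longrightarrow> T n \<tau> i (\<lambda>x. c) = (\<lambda>x. chi n \<tau> i * c)"
  by (rule Pol_eqI[OF n1, of i]) (auto simp: T_props(1)[OF n1] T_props(2)[OF n1] Pol.intros)

lemma foldr_T_one: "set is \<subseteq> {0..n} \<Longrightarrow> foldr (T n \<tau>) is (\<lambda>x. c) = (\<lambda>x. (\<Prod>i\<leftarrow>is. chi n \<tau> i) * c)"
proof (induction "is")
  case (Cons i "is")
  then have "i \<le> n" "set is \<subseteq> {0..n}" by auto
  then show ?case
    by (simp only: foldr_Cons comp_apply Cons.IH T_one list.map prod_list.Cons mult.assoc)
qed simp

lemma prod_chi_1: "set is \<subseteq> {1..<n} \<Longrightarrow> (\<Prod>i\<leftarrow>is. chi n \<tau> i) = 1"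
  by (induction "is") (auto simp: chi_def)

text \<open>T_i multiplies constants by chi_i. The two long words therefore give t_n and t_0, and
  each of the n - i words in the sum gives 1.\<close>

lemma eigenfun_one: "eigenfun n \<tau> (gamma0 n \<tau>) (\<lambda>x. 1)"
  unfolding eigenfun_def
proof
  fix i assume i: "i \<in> {1..n}"
  have R: "T2 n \<tau> i j (\<lambda>x. 1) = (\<lambda>x. 1)" if "j \<in> {i + 1..n}" for j
  proof -
    have *: "set ([i..<j - 1] @ [j - 1] @ rev [i..<j - 1]) \<subseteq> {1..<n}"
      using i that by auto
    then have "set ([i..<j - 1] @ [j - 1] @ rev [i..<j - 1]) \<subseteq> {0..n}" by fastforce
    then show ?thesis unfolding T2_def by (subst foldr_T_one) (simp_all only: prod_chi_1[OF *] mult_1)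
  qed
  have PQ: "foldr (T n \<tau>) ([i..<n] @ [n] @ rev [i..<n]) (\<lambda>x. 1) = (\<lambda>x. par_tn \<tau>)"
    "foldr (T n \<tau>) (rev [1..<i] @ [0] @ [1..<i]) (\<lambda>x. 1) = (\<lambda>x. par_t0 \<tau>)"
    using i n by (subst foldr_T_one; auto simp: prod_chi_1 chi_def)+
  have "(\<Sum>j = i + 1..n. T2 n \<tau> i j (\<lambda>x. 1) x) = (\<Sum>j = i + 1..n. 1)" for x
    by (intro sum.cong refl) (simp add: R)
  then show "Y n \<tau> i (\<lambda>x. 1) = (\<lambda>x. gamma0 n \<tau> i * 1)"
    unfolding Y_def PQ using i by (simp add: gamma0_def fun_eq_iff)
qed

end

section \<open>The shortest elements and the spectrum\<close>

definition idot :: "nat \<Rightarrow> nat \<Rightarrow> (nat \<Rightarrow> int) \<Rightarrow> nat \<Rightarrow> int" where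
  "idot n i \<nu> =
     (if i = 0 then \<nu>(1 := - \<nu> 1 - 1)
      else if i = n then \<nu>(n := - \<nu> n)
      else \<nu>(i := \<nu> (i + 1), i + 1 := \<nu> i))"

lemma dot_gen_of_int: "dot_gen n i (\<lambda>j. of_int (\<nu> j)) = (\<lambda>j. of_int (idot n i \<nu> j))"
  by (auto simp: dot_gen_def gen_def idot_def fun_eq_iff)

lemma foldr_dot_gen_of_int:
  "foldr (dot_gen n) is (\<lambda>j. of_int (\<nu> j)) = (\<lambda>j. of_int (foldr (idot n) is \<nu> j))"
  by (induction "is") (simp_all add: dot_gen_of_int)

lemma idot_idot: "idot n i (idot n i \<nu>) = \<nu>"
  by (auto simp: idot_def fun_eq_iff)

lemma idot_Lam: "1 \<le> n \<Longrightarrow> i \<le> n \<Longrightarrow> \<nu> \<in> Lam n \<Longrightarrow> idot n i \<nu> \<in> Lam n"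
  by (auto simp: Lam_def idot_def)

lemma foldr_idot_Lam: "1 \<le> n \<Longrightarrow> set is \<subseteq> {0..n} \<Longrightarrow> foldr (idot n) is (\<lambda>i. 0) \<in> Lam n"
  by (induction "is") (auto simp: idot_Lam, auto simp: Lam_def)

definition size1 :: "nat \<Rightarrow> (nat \<Rightarrow> int) \<Rightarrow> nat" where
  "size1 n \<nu> = (\<Sum>i = 1..n. nat \<bar>\<nu> i\<bar>)"

lemma size1_idot:
  assumes "0 < i" "i \<le> n"
  shows "size1 n (idot n i \<nu>) = size1 n \<nu>"
proof (cases "i = n")
  case True
  then show ?thesis using assms unfolding size1_def by (intro sum.cong) (auto simp: idot_def)
next
  case False
  then have i: "0 < i" "i < n" using assms by auto
  have "idot n i \<nu> j = \<nu> (Transposition.transpose i (i + 1) j)" for j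
    using i by (auto simp: idot_def Transposition.transpose_def)
  then show ?thesis unfolding size1_def
    by (intro sum.reindex_bij_witness[where i = "Transposition.transpose i (i + 1)" and j = "Transposition.transpose i (i + 1)"])
      (use i in \<open>auto simp: Transposition.transpose_def\<close>)
qed

lemma size1_idot_0:
  assumes "1 \<le> n" "0 \<le> \<nu> 1"
  shows "size1 n (idot n 0 \<nu>) = size1 n \<nu> + 1"
proof -
  have 1: "{1..n} = insert 1 {2..n}" using assms by auto
  have "(\<Sum>i = 2..n. nat \<bar>idot n 0 \<nu> i\<bar>) = (\<Sum>i = 2..n. nat \<bar>\<nu> i\<bar>)"
    by (intro sum.cong) (auto simp: idot_def)
  then show ?thesis using assms(2) unfolding size1_def 1 by (simp add: idot_def)
qed

text \<open>A negative entry can be carried to position 1, where s_0 shrinks it; a positive one is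
  first carried to position n and changed in sign. Restricting s_0 to \<nu>_1 \<ge> 0 makes every
  affine step raise \<open>size1\<close> by exactly one, as the filtration requires.\<close>

lemma Lam_induct [consumes 2, case_names zero finite_gen affine_gen]:
  assumes "1 \<le> n" "\<nu> \<in> Lam n"
    and zero: "P (\<lambda>i. 0)"
    and fin: "\<And>\<nu> i. \<nu> \<in> Lam n \<Longrightarrow> 0 < i \<Longrightarrow> i \<le> n \<Longrightarrow> P \<nu> \<Longrightarrow> P (idot n i \<nu>)"
    and aff: "\<And>\<nu>. \<nu> \<in> Lam n \<Longrightarrow> 0 \<le> \<nu> 1 \<Longrightarrow> P \<nu> \<Longrightarrow> P (idot n 0 \<nu>)"
  shows "P \<nu>"
  using assms(2)
proof (induction "size1 n \<nu>" arbitrary: \<nu> rule: less_induct)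
  case less
  let ?N = "size1 n \<nu>"
  \<comment> \<open>The generators with i > 0 are involutions preserving the size, so P may be
    proved after applying one of them.\<close>
  have undo: "P \<mu>" if "\<mu> \<in> Lam n" "0 < i" "i \<le> n" "P (idot n i \<mu>)" for \<mu> i
    using fin[OF idot_Lam[OF assms(1) that(3,1)] that(2,3,4)] by (simp add: idot_idot)
  have neg: "P \<mu>" if "\<mu> \<in> Lam n" "size1 n \<mu> = ?N" "k < n" "\<mu> (Suc k) < 0" for \<mu> k
    using that
  proof (induction k arbitrary: \<mu>)
    case 0
    have *: "idot n 0 \<mu> \<in> Lam n" "0 \<le> idot n 0 \<mu> 1"
      using 0 idot_Lam[OF assms(1), of 0] by (auto simp: idot_def)
    then have "size1 n (idot n 0 \<mu>) < ?N"
      using size1_idot_0[OF assms(1), of "idot n 0 \<mu>"] 0(2) by (simp add: idot_idot)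
    then have "P (idot n 0 \<mu>)" using less(1) * by blast
    then show ?case using aff[OF *] by (simp add: idot_idot)
  next
    case (Suc k)
    show ?case
    proof (rule undo[of _ "Suc k"])
      show "P (idot n (Suc k) \<mu>)"
        by (rule Suc.IH) (use Suc.prems in \<open>auto simp: size1_idot idot_Lam\<close>, simp add: idot_def)
    qed (use Suc.prems in auto)
  qed
  have pos: "P \<mu>" if "k \<le> n" "\<mu> \<in> Lam n" "size1 n \<mu> = ?N" "0 < k" "\<mu> k > 0" for \<mu> k
    using that
  proof (induction k arbitrary: \<mu> rule: inc_induct)
    case base
    obtain m where m: "n = Suc m" using base by (cases n) auto
    show ?case
    proof (rule undo[of _ n])
      show "P (idot n n \<mu>)"
        by (rule neg[of _ m]) (use base m in \<open>auto simp: size1_idot idot_Lam\<close>, simp add: idot_def)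
    qed (use base in auto)
  next
    case (step k)
    show ?case
    proof (rule undo[of _ k])
      show "P (idot n k \<mu>)"
        by (rule step.IH) (use step in \<open>auto simp: size1_idot idot_Lam\<close>, simp add: idot_def)
    qed (use step in auto)
  qed
  show ?case
  proof (cases "\<forall>i\<in>{1..n}. \<nu> i = 0")
    case True
    then have "\<nu> = (\<lambda>i. 0)" using less(2) by (auto simp: Lam_def fun_eq_iff)
    then show ?thesis using zero by simp
  next
    case False
    then obtain i where i: "i \<in> {1..n}" "\<nu> i \<noteq> 0" by auto
    then consider "\<nu> i > 0" | "\<nu> i < 0" by linarith
    then show ?thesis
    proof cases
      case 1
      then show ?thesis using pos[of i \<nu>] i less(2) by auto
    next
      case 2
      then show ?thesis using neg[of \<nu> "i - 1"] i less(2) by auto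
    qed
  qed
qed

section \<open>Explicit form of the elements \<open>u n \<nu>\<close>\<close>

text \<open>
  \<open>u\<^sub>\<lambda>\<close> is a translation after a signed permutation: the sign at \<open>i\<close> is that of \<open>\<lambda>\<^sub>i\<close>, and the
  permutation sorts the entries by decreasing \<open>key\<close>, ties between equal entries being broken
  from the left for nonnegative entries and from the right for negative ones.  This order is the
  one that is carried along by every generator that moves \<open>\<lambda>\<close>.
\<close>

definition key :: "int \<Rightarrow> int" where
  "key k = (if 0 \<le> k then 2 * k + 1 else - 2 * k)"

definition before :: "(nat \<Rightarrow> int) \<Rightarrow> nat \<Rightarrow> nat \<Rightarrow> bool" where
  "before \<nu> i j \<longleftrightarrow> key (\<nu> j) < key (\<nu> i) \<or> \<nu> i = \<nu> j \<and> (if 0 \<le> \<nu> i then i < j else j < i)"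

definition place :: "nat \<Rightarrow> (nat \<Rightarrow> int) \<Rightarrow> nat \<Rightarrow> nat" where
  "place n \<nu> i = card {j \<in> {1..n}. before \<nu> j i} + 1"

definition eps :: "int \<Rightarrow> complex" where
  "eps k = (if 0 \<le> k then 1 else -1)"

text \<open>The candidate for u_\<lambda>. The translation part is -\<nu> because the dot action is
  the action of \<open>gen\<close> conjugated by negation, as in
  \<open>foldr_dot_gen\<close>.\<close>

definition vmap :: "nat \<Rightarrow> (nat \<Rightarrow> int) \<Rightarrow> point \<Rightarrow> point" where
  "vmap n \<nu> x = (\<lambda>i. if i \<in> {1..n} then - of_int (\<nu> i) + eps (\<nu> i) * x (place n \<nu> i) else x i)"

lemma vmap_zero: "vmap n (\<lambda>i. 0) = (\<lambda>x. x)"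
proof -
  have "place n (\<lambda>i. 0) i = i" if "i \<in> {1..n}" for i
  proof -
    have "{j \<in> {1..n}. before (\<lambda>i. 0) j i} = {1..<i}"
      using that by (auto simp: before_def)
    then show ?thesis using that by (simp add: place_def)
  qed
  then show ?thesis by (auto simp: vmap_def eps_def fun_eq_iff)
qed

text \<open>For k \<ge> 0, s_0 exchanges k and -k-1, whose keys 2k+1 and 2k+2 are adjacent. So only
  comparisons with another entry k or -k-1 are affected; there a tie and a strict comparison replace
  each other, and the tie rules are chosen so that position 1 keeps its rank.\<close>

lemma before_0:
  assumes "j \<in> {1..n}" "k \<in> {1..n}"
  shows "before (idot n 0 \<nu>) j k = before \<nu> j k"
proof -
  consider "j = 1" "k = 1" | "j = 1" "k > 1" | "j > 1" "k = 1" | "j > 1" "k > 1"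
    using assms by force
  then show ?thesis by cases (auto simp: before_def idot_def key_def; presburger)+
qed

text \<open>The same with the pair k, -k for k > 0, whose keys 2k+1 and 2k are adjacent, and with
  the rightmost position, for which the tie rules again agree.\<close>

lemma before_n:
  assumes "j \<in> {1..n}" "k \<in> {1..n}" "\<nu> n \<noteq> 0"
  shows "before (idot n n \<nu>) j k = before \<nu> j k"
proof -
  consider "j = n" "k = n" | "j = n" "k < n" | "j < n" "k = n" | "j < n" "k < n"
    using assms by force
  then show ?thesis using assms by cases (auto simp: before_def idot_def key_def; presburger)+
qed

text \<open>The swap reverses the left-right order of positions i and i + 1 only, and as their
  entries differ this pair is compared by its keys alone.\<close>

lemma before_mid:
  assumes "0 < i" "i < n" "\<nu> i \<noteq> \<nu> (i + 1)"
  shows "before (idot n i \<nu>) (Transposition.transpose i (i + 1) j) (Transposition.transpose i (i + 1) k) = before \<nu> j k"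
proof -
  have v: "idot n i \<nu> (Transposition.transpose i (i + 1) l) = \<nu> l" for l
    using assms(1,2) by (auto simp: idot_def Transposition.transpose_def)
  have "Transposition.transpose i (i + 1) j < Transposition.transpose i (i + 1) k \<longleftrightarrow> j < k"
    "Transposition.transpose i (i + 1) k < Transposition.transpose i (i + 1) j \<longleftrightarrow> k < j" if "\<nu> j = \<nu> k"
    using that assms(3) by (auto simp: Transposition.transpose_def)
  then show ?thesis unfolding before_def v by auto
qed

lemma place_mid:
  assumes "0 < i" "i < n" "\<nu> i \<noteq> \<nu> (i + 1)"
  shows "place n (idot n i \<nu>) (Transposition.transpose i (i + 1) k) = place n \<nu> k"
proof -
  let ?s = "Transposition.transpose i (i + 1)"
  have s: "?s j \<in> {1..n} \<longleftrightarrow> j \<in> {1..n}" for j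
    using assms by (auto simp: Transposition.transpose_def)
  have "{j \<in> {1..n}. before (idot n i \<nu>) j (?s k)} = ?s ` {j \<in> {1..n}. before \<nu> j k}"
  proof (intro equalityI subsetI)
    fix j assume j: "j \<in> {j \<in> {1..n}. before (idot n i \<nu>) j (?s k)}"
    then have "before \<nu> (?s j) k" "?s j \<in> {1..n}"
      using before_mid[OF assms, of "?s j" k] s[of j] by auto
    then show "j \<in> ?s ` {j \<in> {1..n}. before \<nu> j k}"
      by (intro image_eqI[of _ _ "?s j"]) auto
  next
    fix j assume "j \<in> ?s ` {j \<in> {1..n}. before \<nu> j k}"
    then show "j \<in> {j \<in> {1..n}. before (idot n i \<nu>) j (?s k)}"
      using before_mid[OF assms] s by auto
  qed
  moreover have "inj_on ?s A" for A by (rule inj_onI) (metis transpose_involutory)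
  ultimately show ?thesis unfolding place_def by (simp add: card_image)
qed

text \<open>\<open>vmap\<close> follows every generator that moves \<nu>. For a generator fixing
  \<nu> the equation would be false, which is why the words below must move the point at each
  letter.\<close>

lemma vmap_idot:
  assumes "1 \<le> n" "i \<le> n" "idot n i \<nu> \<noteq> \<nu>"
  shows "vmap n (idot n i \<nu>) x = gen n i (vmap n \<nu> x)"
proof -
  consider "i = 0" | "i = n" "i \<noteq> 0" | "0 < i" "i < n" using assms(2) by linarith
  then show ?thesis
  proof cases
    case 1
    have "place n (idot n 0 \<nu>) j = place n \<nu> j" if "j \<in> {1..n}" for j
      unfolding place_def using before_0[OF _ that, of _ \<nu>] by (metis (mono_tags, lifting) Collect_cong)
    then show ?thesis using 1 assms(1)
      by (auto simp: fun_eq_iff vmap_def gen_def) (auto simp: idot_def eps_def)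
  next
    case 2
    then have "\<nu> n \<noteq> 0" using assms(3) by (auto simp: idot_def)
    then have "place n (idot n n \<nu>) j = place n \<nu> j" if "j \<in> {1..n}" for j
      unfolding place_def using before_n[OF _ that, of _ \<nu>] by (metis (mono_tags, lifting) Collect_cong)
    then show ?thesis using 2 \<open>\<nu> n \<noteq> 0\<close>
      by (auto simp: fun_eq_iff vmap_def gen_def) (auto simp: idot_def eps_def)
  next
    case 3
    let ?s = "Transposition.transpose i (i + 1)"
    have "\<nu> i \<noteq> \<nu> (i + 1)" using 3 assms(3) by (auto simp: idot_def fun_eq_iff split: if_splits)
    note r = place_mid[OF 3 this]
    have "vmap n (idot n i \<nu>) x (?s k) = gen n i (vmap n \<nu> x) (?s k)" for k
    proof -
      have "idot n i \<nu> (?s k) = \<nu> k" using 3 by (auto simp: idot_def Transposition.transpose_def)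
      moreover have "gen n i (vmap n \<nu> x) (?s k) = vmap n \<nu> x k"
        using 3 by (auto simp: gen_def Transposition.transpose_def)
      moreover have "?s k \<in> {1..n} \<longleftrightarrow> k \<in> {1..n}" using 3 by (auto simp: Transposition.transpose_def)
      moreover have "?s k = k" if "k \<notin> {1..n}" using 3 that by (auto simp: Transposition.transpose_def)
      ultimately show ?thesis unfolding vmap_def r by auto
    qed
    then show ?thesis by (metis ext transpose_involutory)
  qed
qed

section \<open>Words of minimal length reaching a lattice point\<close>

definition shortest :: "nat \<Rightarrow> nat list \<Rightarrow> (nat \<Rightarrow> int) \<Rightarrow> bool" where
  "shortest n is \<nu> \<longleftrightarrow> set is \<subseteq> {0..n} \<and> foldr (idot n) is (\<lambda>i. 0) = \<nu> \<and>
     (\<forall>js. set js \<subseteq> {0..n} \<longrightarrow> foldr (idot n) js (\<lambda>i. 0) = \<nu> \<longrightarrow> length is \<le> length js)"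

text \<open>A letter that fixes the point could be deleted, contradicting minimality.\<close>

lemma shortest_Cons:
  assumes "shortest n (i # is) \<nu>"
  shows "shortest n is (idot n i \<nu>)" "idot n i \<nu> \<noteq> \<nu>" "i \<le> n"
proof -
  let ?\<mu> = "foldr (idot n) is (\<lambda>i. 0)"
  have 1: "set is \<subseteq> {0..n}" "i \<le> n" "idot n i ?\<mu> = \<nu>" "?\<mu> = idot n i \<nu>"
    using assms by (auto simp: shortest_def idot_idot)
  have "length is \<le> length js" if "set js \<subseteq> {0..n}" "foldr (idot n) js (\<lambda>i. 0) = ?\<mu>" for js
    using assms 1 that unfolding shortest_def
    by (metis (no_types, lifting) Suc_le_mono atLeastAtMost_iff foldr_Cons comp_apply insert_subset
        le0 length_Cons list.simps(15))
  then show "shortest n is (idot n i \<nu>)" using 1 by (simp add: shortest_def)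
  show "idot n i \<nu> \<noteq> \<nu>"
  proof
    assume "idot n i \<nu> = \<nu>"
    then have "foldr (idot n) is (\<lambda>i. 0) = \<nu>" using 1 by simp
    then have "length (i # is) \<le> length is"
      using assms 1(1) unfolding shortest_def by blast
    then show False by simp
  qed
  show "i \<le> n" by (rule 1)
qed

text \<open>Consequently all shortest words for \<nu> represent one and the same group element; this
  takes the place of the theory of minimal coset representatives.\<close>

lemma shortest_vmap:
  assumes "1 \<le> n" "shortest n is \<nu>"
  shows "foldr (gen n) is = vmap n \<nu>"
  using assms(2)
proof (induction "is" arbitrary: \<nu>)
  case Nil
  then show ?case by (auto simp: shortest_def vmap_zero)
next
  case (Cons i "is")
  note s = shortest_Cons[OF Cons.prems]
  have "vmap n (idot n i (idot n i \<nu>)) x = gen n i (vmap n (idot n i \<nu>) x)" for x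
    by (rule vmap_idot) (use s assms(1) in \<open>simp_all add: idot_idot eq_commute\<close>)
  then show ?case using fun_cong[OF Cons.IH[OF s(1)]] by (auto simp: idot_idot)
qed

lemma shortest_exists:
  assumes "1 \<le> n" "\<nu> \<in> Lam n"
  shows "\<exists>is. shortest n is \<nu>"
proof -
  let ?P = "\<lambda>is. set is \<subseteq> {0..n} \<and> foldr (idot n) is (\<lambda>i. 0) = \<nu>"
  have "\<exists>is. ?P is"
    using assms
  proof (induction rule: Lam_induct)
    case zero
    show ?case by (intro exI[of _ "[]"]) simp
  next
    case (finite_gen \<nu> i)
    then obtain "is" where "set is \<subseteq> {0..n}" "foldr (idot n) is (\<lambda>i. 0) = \<nu>" by blast
    then show ?case using finite_gen(3) by (intro exI[of _ "i # is"]) simp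
  next
    case (affine_gen \<nu>)
    then obtain "is" where "set is \<subseteq> {0..n}" "foldr (idot n) is (\<lambda>i. 0) = \<nu>" by blast
    then show ?case by (intro exI[of _ "0 # is"]) simp
  qed
  then obtain "is" where "?P is" "\<forall>js. ?P js \<longrightarrow> length is \<le> length js"
    using ex_has_least_nat[of ?P _ length] by blast
  then have "shortest n is \<nu>" unfolding shortest_def by blast
  then show ?thesis by blast
qed

text \<open>\<open>u\<close> is a definite description, so the minimiser must be unique: the reduced
  word of any minimal w is a shortest word for \<nu>, and \<open>shortest_vmap\<close> determines w.
  The second conclusion concerns the very word along which \<open>wilson_poly\<close> is
  computed.\<close>

lemma u_eq_vmap:
  assumes "1 \<le> n" "\<nu> \<in> Lam n"
  shows "u n \<nu> = vmap n \<nu>" "shortest n (red n (u n \<nu>)) \<nu>"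
proof -
  let ?P = "\<lambda>w. w \<in> W n \<and> dot n w (\<lambda>i. 0) = (\<lambda>i. of_int (\<nu> i))"
  obtain "is" where s: "shortest n is \<nu>" using shortest_exists[OF assms] by blast
  have red: "set (red n w) \<subseteq> {0..n}" "foldr (idot n) (red n w) (\<lambda>i. 0) = \<nu>"
    "foldr (gen n) (red n w) = w" "length (red n w) = len n w" if "?P w" for w
  proof -
    have r: "reduced_expr n w (red n w)" using that reduced_expr_red by blast
    then show "set (red n w) \<subseteq> {0..n}" "foldr (gen n) (red n w) = w" "length (red n w) = len n w"
      by (auto simp: reduced_expr_def)
    have "(\<lambda>j. complex_of_int (foldr (idot n) (red n w) (\<lambda>i. 0) j)) = (\<lambda>i. of_int (\<nu> i))"
      using that foldr_dot_gen_of_int[of n "red n w" "\<lambda>i. 0"] unfolding dot_def by simp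
    then show "foldr (idot n) (red n w) (\<lambda>i. 0) = \<nu>" by (simp add: fun_eq_iff)
  qed
  have le: "length is \<le> len n w" if "?P w" for w
    using s red[OF that] unfolding shortest_def by metis
  let ?w = "vmap n \<nu>"
  have w: "foldr (gen n) is = ?w" by (rule shortest_vmap[OF assms(1) s])
  have Pw: "?P ?w"
    using s w dot_eq[of "is" n ?w] foldr_dot_gen_of_int[of n "is" "\<lambda>i. 0"]
    by (auto simp: shortest_def W_def intro!: exI[of _ "is"])
  have "len n ?w \<le> length is"
    unfolding len_def using s w by (intro Least_le) (auto simp: shortest_def)
  then have lw: "len n ?w = length is" using le[OF Pw] by simp
  have short: "shortest n (red n w) \<nu>" if "?P w" "len n w \<le> length is" for w
    using red[OF that(1)] that(2) s unfolding shortest_def by fastforce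
  show u: "u n \<nu> = ?w"
    unfolding u_def
  proof (rule the_equality)
    show "is_arg_min (len n) ?P ?w"
      unfolding is_arg_min_def using Pw le lw by (auto simp: not_less)
  next
    fix w assume "is_arg_min (len n) ?P w"
    then have "?P w" "len n w \<le> length is" using Pw lw by (auto simp: is_arg_min_def not_less)
    then show "w = ?w"
      using shortest_vmap[OF assms(1) short] red(3) by metis
  qed
  show "shortest n (red n (u n \<nu>)) \<nu>" unfolding u using short[OF Pw] lw by simp
qed

lemma gamma_eq:
  assumes "1 \<le> n" "\<nu> \<in> Lam n"
  shows "gamma n \<tau> \<nu> = (\<lambda>i. if i \<in> {1..n} then of_int (\<nu> i) + eps (\<nu> i) * gamma0 n \<tau> (place n \<nu> i) else 0)"
proof -
  have s: "shortest n (red n (u n \<nu>)) \<nu>" "u n \<nu> = vmap n \<nu>"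
    using u_eq_vmap[OF assms] by auto
  have "gamma n \<tau> \<nu> = (\<lambda>i. - vmap n \<nu> (\<lambda>j. - gamma0 n \<tau> j) i)"
    unfolding gamma_def dot_def foldr_dot_gen shortest_vmap[OF assms(1) s(1)] ..
  then show ?thesis by (auto simp: vmap_def fun_eq_iff gamma0_def)
qed

text \<open>\<open>gamma\<close> is \<open>vmap\<close> conjugated by negation and evaluated at
  gamma_0, so \<open>vmap_idot\<close> applies. This matches the new eigenvalue in
  \<open>eigenfun_S_gen\<close> with the new index.\<close>

lemma gamma_idot:
  assumes "1 \<le> n" "\<nu> \<in> Lam n" "i \<le> n" "idot n i \<nu> \<noteq> \<nu>"
  shows "dot_gen n i (gamma n \<tau> \<nu>) = gamma n \<tau> (idot n i \<nu>)"
proof -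
  have g: "gamma n \<tau> \<mu> = (\<lambda>i. - vmap n \<mu> (\<lambda>j. - gamma0 n \<tau> j) i)" if "\<mu> \<in> Lam n" for \<mu>
    unfolding gamma_eq[OF assms(1) that] by (auto simp: vmap_def gamma0_def fun_eq_iff)
  have "dot_gen n i (\<lambda>j. - y j) = (\<lambda>j. - gen n i y j)" for y
    by (auto simp: dot_gen_def gen_def fun_eq_iff)
  then show ?thesis
    unfolding g[OF assms(2)] g[OF idot_Lam[OF assms(1,3,2)]] vmap_idot[OF assms(1,3,4)] by simp
qed

lemma gamma_zero: "1 \<le> n \<Longrightarrow> gamma n \<tau> (\<lambda>i. 0) = gamma0 n \<tau>"
  using gamma_eq[of n "\<lambda>i. 0" \<tau>] fun_cong[OF vmap_zero, of n "gamma0 n \<tau>"]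
  by (auto simp: Lam_def vmap_def gamma0_def fun_eq_iff split: if_splits)

section \<open>Positivity and the nonvanishing of the squared intertwiners\<close>

text \<open>Heron's factorization: both expressions are minus the product of the four factors. They
  are \<open>S_square\<close> at the ends i = 0 and i = n in real variables.\<close>

lemma four_factors:
  fixes z u v :: real
  assumes "z + u + v \<noteq> 0" "z + u - v \<noteq> 0" "z - u + v \<noteq> 0" "z - u - v \<noteq> 0"
  shows "4 * z\<^sup>2 * u\<^sup>2 - (v\<^sup>2 - u\<^sup>2 - z\<^sup>2)\<^sup>2 \<noteq> 0"
    and "4 * z\<^sup>2 * u\<^sup>2 - (z\<^sup>2 + u\<^sup>2 - v\<^sup>2)\<^sup>2 \<noteq> 0"
proof -
  have "4 * z\<^sup>2 * u\<^sup>2 - (z\<^sup>2 + u\<^sup>2 - v\<^sup>2)\<^sup>2 = - ((z + u + v) * (z + u - v) * ((z - u + v) * (z - u - v)))"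
    by (simp add: power2_eq_square algebra_simps)
  then show "4 * z\<^sup>2 * u\<^sup>2 - (z\<^sup>2 + u\<^sup>2 - v\<^sup>2)\<^sup>2 \<noteq> 0" using assms by simp
  moreover have "(v\<^sup>2 - u\<^sup>2 - z\<^sup>2)\<^sup>2 = (z\<^sup>2 + u\<^sup>2 - v\<^sup>2)\<^sup>2"
    by (simp add: power2_eq_square algebra_simps)
  ultimately show "4 * z\<^sup>2 * u\<^sup>2 - (v\<^sup>2 - u\<^sup>2 - z\<^sup>2)\<^sup>2 \<noteq> 0" by simp
qed

lemma before_irrefl: "\<not> before \<nu> i i"
  by (simp add: before_def)

lemma before_trans: "before \<nu> i j \<Longrightarrow> before \<nu> j k \<Longrightarrow> before \<nu> i k"
  by (auto simp: before_def split: if_splits)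

lemma place_less:
  assumes "before \<nu> i j" "i \<in> {1..n}"
  shows "place n \<nu> i < place n \<nu> j"
proof -
  have "{k \<in> {1..n}. before \<nu> k i} \<subset> {k \<in> {1..n}. before \<nu> k j}"
    using assms before_trans before_irrefl by blast
  then show ?thesis unfolding place_def by (simp add: psubset_card_mono)
qed

lemma place_bounds: "i \<in> {1..n} \<Longrightarrow> 1 \<le> place n \<nu> i \<and> place n \<nu> i \<le> n"
proof -
  assume i: "i \<in> {1..n}"
  have "{k \<in> {1..n}. before \<nu> k i} \<subset> {1..n}"
    using i before_irrefl by blast
  then have "card {k \<in> {1..n}. before \<nu> k i} < card {1..n}" by (intro psubset_card_mono) auto
  then show ?thesis unfolding place_def by simp
qed

definition rgamma :: "nat \<Rightarrow> real \<Rightarrow> real \<Rightarrow> (nat \<Rightarrow> int) \<Rightarrow> nat \<Rightarrow> real" where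
  "rgamma n s t \<nu> i = (if 0 \<le> \<nu> i then of_int (\<nu> i) + (s + of_nat (n - place n \<nu> i) * t)
     else of_int (\<nu> i) - (s + of_nat (n - place n \<nu> i) * t))"

text \<open>For entries of equal sign, the sorting adds at least t to an integer difference of at
  least 1. For opposite signs the places are distinct, so the two multiples of t sum to at least t,
  and the integer difference outweighs 2s > -1. Differences of absolute value t are where S_i^2
  degenerates.\<close>

lemma rgamma_separation:
  assumes "\<nu> j < \<nu> i" "i \<in> {1..n}" "j \<in> {1..n}" "0 < t" "-1 < 2 * s"
  shows "t < rgamma n s t \<nu> i - rgamma n s t \<nu> j"
proof -
  note b = place_bounds[OF assms(2), of \<nu>] place_bounds[OF assms(3), of \<nu>]
  have mono: "t \<le> of_nat (n - p) * t - of_nat (n - q) * t" if "p < q" "q \<le> n" for p q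
  proof -
    have "1 * t \<le> of_nat (n - p - (n - q)) * t"
      using that assms(4) by (intro mult_right_mono) auto
    then show ?thesis using that by (simp add: of_nat_diff left_diff_distrib)
  qed
  have 1: "of_int (\<nu> j) + 1 \<le> (of_int (\<nu> i) :: real)" using assms(1) by linarith
  consider "0 \<le> \<nu> j" | "\<nu> i < 0" | "\<nu> j < 0" "0 \<le> \<nu> i" by linarith
  then show ?thesis
  proof cases
    case 1
    then have "before \<nu> i j" using assms(1) by (simp add: before_def key_def)
    from mono[OF place_less[OF this assms(2)]] show ?thesis
      using 1 \<open>of_int (\<nu> j) + 1 \<le> (of_int (\<nu> i) :: real)\<close> assms(1) b by (simp add: rgamma_def)
  next
    case 2
    then have "before \<nu> j i" using assms(1) by (simp add: before_def key_def)
    from mono[OF place_less[OF this assms(3)]] show ?thesis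
      using 2 \<open>of_int (\<nu> j) + 1 \<le> (of_int (\<nu> i) :: real)\<close> assms(1) b by (simp add: rgamma_def)
  next
    case 3
    have "before \<nu> i j \<or> before \<nu> j i"
    proof -
      have "key (\<nu> i) \<noteq> key (\<nu> j)" using 3 by (simp add: key_def) presburger
      then show ?thesis by (auto simp: before_def)
    qed
    then have "place n \<nu> i \<noteq> place n \<nu> j"
      using place_less assms(2,3) by (metis nat_neq_iff)
    then have "1 * t \<le> of_nat (n - place n \<nu> i + (n - place n \<nu> j)) * t"
      using b assms(4) by (intro mult_right_mono) auto
    then have "t \<le> of_nat (n - place n \<nu> i) * t + of_nat (n - place n \<nu> j) * t"
      by (simp add: distrib_right)
    then show ?thesis using 3 1 assms(5) by (simp add: rgamma_def)
  qed
qed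

locale positive_params =
  fixes n :: nat and \<tau> :: wilson_params
  assumes n: "2 \<le> n"
    and pos: "par_a \<tau> > 0" "par_b \<tau> > 0" "par_c \<tau> > 0" "par_d \<tau> > 0" "par_t \<tau> > 0"
begin

definition rt :: real where "rt = Re (par_t \<tau>)"
definition ra :: real where "ra = Re (par_a \<tau>)"
definition rb :: real where "rb = Re (par_b \<tau>)"
definition rc :: real where "rc = Re (par_c \<tau>)"
definition rd :: real where "rd = Re (par_d \<tau>)"

lemma real_pos: "0 < rt" "0 < ra" "0 < rb" "0 < rc" "0 < rd"
  using pos by (auto simp: less_complex_def rt_def ra_def rb_def rc_def rd_def)

lemma par_real: "par_t \<tau> = of_real rt" "par_a \<tau> = of_real ra" "par_b \<tau> = of_real rb"
  "par_c \<tau> = of_real rc" "par_d \<tau> = of_real rd"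
  using pos by (auto simp: less_complex_def rt_def ra_def rb_def rc_def rd_def complex_eq_iff)

lemma par_real':
  "par_tn \<tau> = of_real ((ra + rb) / 2)" "par_un \<tau> = of_real ((ra - rb) / 2)"
  "par_t0 \<tau> = of_real ((rc + rd - 1) / 2)" "par_u0 \<tau> = of_real ((rc - rd) / 2)"
proof -
  have "par_tn \<tau> = (par_a \<tau> + par_b \<tau>) / 2" "par_un \<tau> = (par_a \<tau> - par_b \<tau>) / 2"
    "par_t0 \<tau> = (par_c \<tau> + par_d \<tau> - 1) / 2" "par_u0 \<tau> = (par_c \<tau> - par_d \<tau>) / 2"
    by (simp_all add: par_a_def par_b_def par_c_def par_d_def)
  then show "par_tn \<tau> = of_real ((ra + rb) / 2)" "par_un \<tau> = of_real ((ra - rb) / 2)"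
    "par_t0 \<tau> = of_real ((rc + rd - 1) / 2)" "par_u0 \<tau> = of_real ((rc - rd) / 2)"
    unfolding par_real by simp_all
qed

text \<open>This is t0 + tn; positivity of a, b, c, d enters through 2 rs > -1.\<close>

definition rs :: real where "rs = (ra + rb + rc + rd - 1) / 2"

lemma n1: "1 \<le> n" using n by simp

lemma gamma_real:
  assumes "\<nu> \<in> Lam n" "i \<in> {1..n}"
  shows "gamma n \<tau> \<nu> i = of_real (rgamma n rs rt \<nu> i)"
  using assms place_bounds[OF assms(2), of \<nu>]
  by (simp add: gamma_eq[OF n1 assms(1)] gamma0_def par_real par_real' eps_def rgamma_def rs_def field_simps)

lemma S_square_nonzero:
  assumes "\<nu> \<in> Lam n" "i \<le> n" "idot n i \<nu> \<noteq> \<nu>"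
  shows "S_square n \<tau> i (gamma n \<tau> \<nu>) \<noteq> 0"
proof -
  let ?G = "rgamma n rs rt \<nu>"
  have s: "-1 < 2 * rs" using real_pos by (simp add: rs_def)
  have t: "0 \<le> of_nat (n - place n \<nu> j) * rt" for j using real_pos by simp
  consider "i = 0" | "i = n" "i \<noteq> 0" | "0 < i" "i < n" using assms(2) by linarith
  then show ?thesis
  proof cases
    case 1
    let ?z = "?G 1 + 1/2" and ?u = "(ra - rb) / 2" and ?v = "(rc - rd) / 2"
    \<comment> \<open>rs + 1/2 is (a + b + c + d)/2, which by positivity exceeds every |(a - b) + (c
      - d)|/2 and |(a - b) - (c - d)|/2, that is, |u + v| and |u - v|.\<close>
    have z: "rs + 1/2 \<le> \<bar>?z\<bar>"
    proof (cases "0 \<le> \<nu> 1")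
      case True
      then show ?thesis using t[of 1] by (simp add: rgamma_def)
    next
      case False
      then have "of_int (\<nu> 1) \<le> (-1 :: real)" by linarith
      then show ?thesis using t[of 1] False s by (simp add: rgamma_def)
    qed
    have "?z + ?u + ?v \<noteq> 0" "?z + ?u - ?v \<noteq> 0" "?z - ?u + ?v \<noteq> 0" "?z - ?u - ?v \<noteq> 0"
      using z real_pos unfolding rs_def by (auto simp: abs_if field_simps split: if_splits)
    note four_factors(1)[OF this]
    moreover have "gamma n \<tau> \<nu> 1 + 1/2 = of_real ?z" using gamma_real[OF assms(1), of 1] n by simp
    then have "S_square n \<tau> i (gamma n \<tau> \<nu>)
      = of_real (4 * ?z\<^sup>2 * ?u\<^sup>2 - (?v\<^sup>2 - ?u\<^sup>2 - ?z\<^sup>2)\<^sup>2)"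
      unfolding S_square_def using 1 by (simp only: par_real' of_real_diff of_real_mult of_real_power
          of_real_numeral if_True refl)
    ultimately show ?thesis by (simp only: of_real_eq_0_iff not_False_eq_True)
  next
    case 2
    then have nz: "\<nu> n \<noteq> 0" using assms(3) by (auto simp: idot_def)
    let ?z = "?G n" and ?u = "(ra + rb) / 2" and ?v = "(rc + rd - 1) / 2"
    \<comment> \<open>The 1 comes from \<nu>_n \<noteq> 0. While u + v is rs itself, u - v may
      exceed rs when v < 0, but by less than 1 since v > -1/2.\<close>
    have z: "rs + 1 \<le> \<bar>?z\<bar>"
    proof (cases "0 \<le> \<nu> n")
      case True
      then have "1 \<le> (of_int (\<nu> n) :: real)" using nz by linarith
      then show ?thesis using t[of n] True by (simp add: rgamma_def)
    next
      case False
      then have "of_int (\<nu> n) \<le> (-1 :: real)" by linarith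
      then show ?thesis using t[of n] False s by (simp add: rgamma_def)
    qed
    have "?z + ?u + ?v \<noteq> 0" "?z + ?u - ?v \<noteq> 0" "?z - ?u + ?v \<noteq> 0" "?z - ?u - ?v \<noteq> 0"
      using z real_pos unfolding rs_def by (auto simp: abs_if field_simps split: if_splits)
    note four_factors(2)[OF this]
    moreover have "gamma n \<tau> \<nu> n = of_real ?z" using gamma_real[OF assms(1), of n] n by simp
    then have "S_square n \<tau> i (gamma n \<tau> \<nu>)
      = of_real (4 * ?z\<^sup>2 * ?u\<^sup>2 - (?z\<^sup>2 + ?u\<^sup>2 - ?v\<^sup>2)\<^sup>2)"
      unfolding S_square_def using 2 by (simp only: par_real' of_real_diff of_real_add of_real_mult of_real_power
          of_real_numeral if_True if_False refl)
    ultimately show ?thesis by (simp only: of_real_eq_0_iff not_False_eq_True)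
  next
    case 3
    then have "\<nu> i \<noteq> \<nu> (i + 1)" using assms(3) by (auto simp: idot_def fun_eq_iff split: if_splits)
    then have d: "rt < \<bar>?G i - ?G (i + 1)\<bar>"
      using rgamma_separation[of \<nu> i "i + 1" n rt rs] rgamma_separation[of \<nu> "i + 1" i n rt rs] s real_pos 3
      by (cases "\<nu> i < \<nu> (i + 1)") auto
    then have "(?G i - ?G (i + 1))\<^sup>2 - rt\<^sup>2 \<noteq> 0"
      using real_pos(1) by (auto simp: power2_eq_iff)
    moreover have "gamma n \<tau> \<nu> i = of_real (?G i)" "gamma n \<tau> \<nu> (i + 1) = of_real (?G (i + 1))"
      using 3 by (simp_all add: gamma_real[OF assms(1)])
    then have "S_square n \<tau> i (gamma n \<tau> \<nu>) = of_real ((?G i - ?G (i + 1))\<^sup>2 - rt\<^sup>2)"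
      unfolding S_square_def using 3 by (simp add: par_real)
    ultimately show ?thesis by (simp only: of_real_eq_0_iff not_False_eq_True)
  qed
qed

definition good :: "(nat \<Rightarrow> int) \<Rightarrow> cfun \<Rightarrow> bool" where
  "good \<nu> p \<longleftrightarrow> p \<in> Pol n \<and> eigenfun n \<tau> (gamma n \<tau> \<nu>) p \<and> p \<noteq> (\<lambda>x. 0)"

lemma S_gen_zero:
  assumes "i \<le> n"
  shows "S_gen n \<tau> i (\<lambda>x. 0) = (\<lambda>x. 0)"
proof -
  have T: "foldr (T n \<tau>) is (\<lambda>x. 0) = (\<lambda>x. 0)" if "set is \<subseteq> {0..n}" for "is"
    using foldr_T_one[OF n that, of \<tau> 0] by simp
  have Y: "Y n \<tau> j (\<lambda>x. 0) = (\<lambda>x. 0)" if "j \<in> {1..n}" for j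
    using Y_sum[OF n _ that, of "{}" "\<lambda>_ x. 0" \<tau> "\<lambda>_. 0"] by simp
  have U: "U n \<tau> (\<lambda>x. 0) = (\<lambda>x. 0)"
    using T[of "[1..<n]"] T[of "rev [1..<n]"] T[of "[n]"] by (simp add: U_def subset_iff)
  have *: "(if i = 0 then U n \<tau> else T n \<tau> i) (\<lambda>x. 0) = (\<lambda>x. 0)"
    using U T[of "[i]"] assms by simp
  have "aff_Y n \<tau> i (\<lambda>x. 0) = (\<lambda>x. 0)"
    using Y n assms by (auto simp: aff_Y_def)
  then show ?thesis using * by (simp add: S_gen_def commutator_def)
qed

text \<open>S_i p cannot vanish, because applying S_i once more returns a nonzero multiple of
  p.\<close>

lemma good_step:
  assumes "good \<nu> p" "\<nu> \<in> Lam n" "i \<le> n" "idot n i \<nu> \<noteq> \<nu>"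
  shows "good (idot n i \<nu>) (S_gen n \<tau> i p)"
proof -
  have p: "p \<in> Pol n" "eigenfun n \<tau> (gamma n \<tau> \<nu>) p" "p \<noteq> (\<lambda>x. 0)"
    using assms(1) by (auto simp: good_def)
  note e = eigenfun_S_gen[OF n p(1,2) assms(3)]
  have "S_gen n \<tau> i p \<noteq> (\<lambda>x. 0)"
  proof
    assume 0: "S_gen n \<tau> i p = (\<lambda>x. 0)"
    have "S_gen n \<tau> i (\<lambda>x. 0) = (\<lambda>x. 0)" by (rule S_gen_zero[OF assms(3)])
    then show False using e(2) 0 p(3) S_square_nonzero[OF assms(2-4)] by (auto simp: fun_eq_iff)
  qed
  then show ?thesis
    using e(1) S_gen_Pol(1)[OF n p(1) assms(3)] gamma_idot[OF n1 assms(2-4)]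
    by (simp add: good_def)
qed

lemma good_zero: "good (\<lambda>i. 0) (\<lambda>x. 1)"
  using eigenfun_one[OF n] by (auto simp: good_def gamma_zero[OF n1] fun_eq_iff Pol.Pol_const)

lemma good_wilson:
  assumes "\<nu> \<in> Lam n"
  shows "good \<nu> (wilson_poly n \<tau> \<nu>)"
proof -
  have "good \<nu> (foldr (S_gen n \<tau>) is (\<lambda>x. 1))" if "shortest n is \<nu>" for "is" \<nu>
    using that
  proof (induction "is" arbitrary: \<nu>)
    case Nil
    then show ?case using good_zero by (auto simp: shortest_def)
  next
    case (Cons i "is")
    note s = shortest_Cons[OF Cons.prems]
    have "idot n i \<nu> \<in> Lam n" using s(1) foldr_idot_Lam[OF n1, of "is"] unfolding shortest_def by metis
    from good_step[OF Cons.IH[OF s(1)] this s(3)] s(2) show ?case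
      by (simp add: idot_idot eq_commute)
  qed
  then show ?thesis using u_eq_vmap(2)[OF n1 assms] by (simp add: wilson_poly_def S_def)
qed

end

section \<open>A filtration of the polynomials\<close>

text \<open>In this weight x_i^k counts as the ceiling of k/2. Generating the filtration by products
  instead of reading it off from monomials permits inductions by a Leibniz rule.\<close>

inductive Fil :: "nat \<Rightarrow> nat \<Rightarrow> cfun \<Rightarrow> bool" for n where
  const: "Fil n d (\<lambda>x. c)"
| var: "i \<in> {1..n} \<Longrightarrow> Fil n (Suc d) (\<lambda>x. x i)"
| square: "i \<in> {1..n} \<Longrightarrow> Fil n (Suc d) (\<lambda>x. (x i)\<^sup>2)"
| add: "Fil n d p \<Longrightarrow> Fil n d q \<Longrightarrow> Fil n d (\<lambda>x. p x + q x)"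
| mult: "Fil n d p \<Longrightarrow> Fil n e q \<Longrightarrow> Fil n (d + e) (\<lambda>x. p x * q x)"

lemma Fil_mono:
  assumes "Fil n d p" "d \<le> e"
  shows "Fil n e p"
  using assms
proof (induction arbitrary: e)
  case (var i d)
  then show ?case using Fil.var[of i n "e - 1"] by simp
next
  case (square i d)
  then show ?case using Fil.square[of i n "e - 1"] by simp
next
  case (mult d p d' q)
  then have "Fil n (d + (e - d)) (\<lambda>x. p x * q x)" by (intro Fil.mult mult.IH) auto
  then show ?case using mult.prems by simp
qed (auto intro: Fil.intros)

lemma Fil_scale: "Fil n d p \<Longrightarrow> Fil n d (\<lambda>x. c * p x)"
  using Fil.mult[OF Fil.const[of n 0 c]] by simp

lemma Fil_diff: "Fil n d p \<Longrightarrow> Fil n d q \<Longrightarrow> Fil n d (\<lambda>x. p x - q x)"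
  using Fil.add[OF _ Fil_scale[of n d q "-1"]] by simp

lemma Fil_sum: "(\<And>a. a \<in> A \<Longrightarrow> Fil n d (f a)) \<Longrightarrow> Fil n d (\<lambda>x. \<Sum>a\<in>A. f a x)"
  by (induction A rule: infinite_finite_induct) (auto intro: Fil.intros)

lemma Fil_Pol: "Fil n d p \<Longrightarrow> p \<in> Pol n"
proof (induction rule: Fil.induct)
  case (square i d)
  then show ?case by (intro Pol_power Pol.Pol_var)
qed (auto intro: Pol.intros)

lemma Pol_Fil: "p \<in> Pol n \<Longrightarrow> \<exists>d. Fil n d p"
proof (induction rule: Pol.induct)
  case (Pol_add p q)
  then obtain d e where "Fil n d p" "Fil n e q" by blast
  then have "Fil n (max d e) (\<lambda>x. p x + q x)" by (intro Fil.add) (auto intro: Fil_mono)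
  then show ?case by blast
qed (blast intro: Fil.intros)+

definition dnum :: "nat \<Rightarrow> wilson_params \<Rightarrow> nat \<Rightarrow> point \<Rightarrow> complex" where
  "dnum n \<tau> i x = (if i = 0 then (par_t0 \<tau>)\<^sup>2 - (par_u0 \<tau>)\<^sup>2 + (1/2 - x 1)\<^sup>2
     else if i = n then (par_tn \<tau>)\<^sup>2 - (par_un \<tau>)\<^sup>2 + (x n)\<^sup>2 else par_t \<tau>)"

lemma dcoef_dnum: "dcoef n \<tau> i x = dnum n \<tau> i x / aff n i x"
  by (simp add: dcoef_def dnum_def aff_def)

lemma Fil_dnum:
  assumes "1 \<le> n" "i \<le> n"
  shows "Fil n (Suc d) (dnum n \<tau> i)"
proof -
  consider "i = 0" | "i = n" "i \<noteq> 0" | "i \<noteq> 0" "i \<noteq> n" by blast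
  then show ?thesis
  proof cases
    case 1
    have "Fil n (Suc d) (\<lambda>x. (par_t0 \<tau>)\<^sup>2 - (par_u0 \<tau>)\<^sup>2 + 1/4 + ((x 1)\<^sup>2 - 1 * x 1))"
      by (intro Fil.add Fil_diff Fil_scale Fil.const Fil.var Fil.square) (use assms in auto)
    then show ?thesis using 1 unfolding dnum_def
      by (simp add: power2_eq_square algebra_simps)
  next
    case 2
    have "Fil n (Suc d) (\<lambda>x. (par_tn \<tau>)\<^sup>2 - (par_un \<tau>)\<^sup>2 + (x n)\<^sup>2)"
      by (intro Fil.add Fil_diff Fil.const Fil.square) (use assms in auto)
    then show ?thesis using 2 unfolding dnum_def by simp
  next
    case 3
    then show ?thesis unfolding dnum_def by (simp add: Fil.const)
  qed
qed

lemma Fil_gen_coord: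
  assumes "1 \<le> n" "i \<le> n" "j \<in> {1..n}"
  shows "Fil n (Suc d) (\<lambda>x. gen n i x j) \<and> Fil n (Suc d) (\<lambda>x. (gen n i x j)\<^sup>2)"
proof -
  consider "i = 0" "j = 1" | "i = n" "j = n" "i \<noteq> 0" | "i \<noteq> 0" "i \<noteq> n" "j = i"
    | "i \<noteq> 0" "i \<noteq> n" "j = i + 1" | "\<And>x. gen n i x j = x j"
    using gen_coord_cases[of i j n] by metis
  then show ?thesis
  proof cases
    case 1
    have "Fil n (Suc d) (\<lambda>x. 1 - x 1)" "Fil n (Suc d) (\<lambda>x. (x 1)\<^sup>2 + (1 - 2 * x 1))"
      by (intro Fil.add Fil_diff Fil_scale Fil.const Fil.var Fil.square; use assms in simp)+
    moreover have "(1 - z)\<^sup>2 = z\<^sup>2 + (1 - 2 * z)" for z :: complex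
      by (simp add: power2_eq_square algebra_simps)
    ultimately show ?thesis using 1 by (simp add: gen_def)
  next
    case 2
    then show ?thesis using assms Fil_scale[OF Fil.var[of n n d], of "-1"] Fil.square[of n n d] by (simp add: gen_def)
  next
    case 3
    then show ?thesis using assms Fil.var[of "i + 1" n d] Fil.square[of "i + 1" n d] by (simp add: gen_def)
  next
    case 4
    then show ?thesis using assms Fil.var[of i n d] Fil.square[of i n d] by (simp add: gen_def)
  next
    case 5
    then show ?thesis using assms Fil.var[of j n d] Fil.square[of j n d] by simp
  qed
qed

lemma Fil_gen:
  assumes "1 \<le> n" "i \<le> n" "Fil n d p"
  shows "Fil n d (\<lambda>x. p (gen n i x))"
  using assms(3)
  by induction (use Fil_gen_coord[OF assms(1,2)] in \<open>auto intro: Fil.intros\<close>)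

text \<open>A coordinate changes by a constant multiple of the wall, which leaves the numerator
  \<open>dnum\<close> of weight one. Its square changes under s_0 by exactly 1 - 2 x_1 and under s_n
  not at all, so again no weight is gained. Products follow by the twisted Leibniz rule.\<close>

lemma Fil_divided_difference:
  assumes "1 \<le> n" "i \<le> n" "Fil n d p"
  shows "\<exists>q. Fil n d q \<and> (\<forall>x. dnum n \<tau> i x * (p (gen n i x) - p x) = aff n i x * q x)"
  using assms(3)
proof induction
  case (const d c)
  then show ?case by (intro exI[of _ "\<lambda>x. 0"]) (auto intro: Fil.const)
next
  case (var j d)
  obtain c where "\<And>x. gen n i x j = x j + aff n i x * c"
    using gen_coord_diff[OF assms(1,2)] by blast
  then show ?case
    by (intro exI[of _ "\<lambda>x. c * dnum n \<tau> i x"]) (auto intro: Fil_scale Fil_dnum[OF assms(1,2)])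
next
  case (square j d)
  consider "i = 0" "j = 1" | "i = n" "j = n" "i \<noteq> 0" | "i \<noteq> 0" "i \<noteq> n" "j = i"
    | "i \<noteq> 0" "i \<noteq> n" "j = i + 1" | "\<And>x. gen n i x j = x j"
    using gen_coord_cases[of i j n] by metis
  then show ?case
  proof cases
    case 1
    then show ?thesis using Fil_dnum[OF assms(1,2), of d \<tau>]
      by (intro exI[of _ "dnum n \<tau> i"]) (simp add: gen_def aff_def power2_eq_square algebra_simps)
  next
    case 2
    then show ?thesis
      by (intro exI[of _ "\<lambda>x. 0"]) (simp add: gen_def Fil.const)
  next
    case 3
    have "Fil n (Suc d) (\<lambda>x. (- par_t \<tau>) * (x i + x (i + 1)))"
      using 3 assms square by (intro Fil_scale Fil.add Fil.var) auto
    then show ?thesis using 3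
      by (intro exI[of _ "\<lambda>x. (- par_t \<tau>) * (x i + x (i + 1))"])
        (simp add: gen_def aff_def dnum_def power2_eq_square algebra_simps)
  next
    case 4
    have "Fil n (Suc d) (\<lambda>x. par_t \<tau> * (x i + x (i + 1)))"
      using 4 assms square by (intro Fil_scale Fil.add Fil.var) auto
    then show ?thesis using 4
      by (intro exI[of _ "\<lambda>x. par_t \<tau> * (x i + x (i + 1))"])
        (simp add: gen_def aff_def dnum_def power2_eq_square algebra_simps)
  next
    case 5
    then show ?thesis by (intro exI[of _ "\<lambda>x. 0"]) (simp add: Fil.const)
  qed
next
  case (add d p q)
  then obtain p' q' where p': "Fil n d p'" "\<And>x. dnum n \<tau> i x * (p (gen n i x) - p x) = aff n i x * p' x"
    and q': "Fil n d q'" "\<And>x. dnum n \<tau> i x * (q (gen n i x) - q x) = aff n i x * q' x"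
    by blast
  have "dnum n \<tau> i x * (p (gen n i x) + q (gen n i x) - (p x + q x)) = aff n i x * (p' x + q' x)" for x
    using p'(2)[of x] q'(2)[of x] by (simp add: algebra_simps)
  then show ?case using Fil.add[OF p'(1) q'(1)] by (intro exI[of _ "\<lambda>x. p' x + q' x"]) simp
next
  case (mult d p e q)
  then obtain p' q' where p': "Fil n d p'" "\<And>x. dnum n \<tau> i x * (p (gen n i x) - p x) = aff n i x * p' x"
    and q': "Fil n e q'" "\<And>x. dnum n \<tau> i x * (q (gen n i x) - q x) = aff n i x * q' x"
    by blast
  have "dnum n \<tau> i x * (p (gen n i x) * q (gen n i x) - p x * q x)
      = aff n i x * (p' x * q (gen n i x) + p x * q' x)" for x
  proof -
    have "dnum n \<tau> i x * (p (gen n i x) * q (gen n i x) - p x * q x) =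
      dnum n \<tau> i x * (p (gen n i x) - p x) * q (gen n i x) + p x * (dnum n \<tau> i x * (q (gen n i x) - q x))"
      by (simp add: algebra_simps)
    then show ?thesis unfolding p'(2) q'(2) by (simp add: algebra_simps)
  qed
  moreover have "Fil n (d + e) (\<lambda>x. p' x * q (gen n i x) + p x * q' x)"
    by (intro Fil.add Fil.mult p' q' mult.hyps Fil_gen assms)
  ultimately show ?case by blast
qed

lemma Fil_T:
  assumes "1 \<le> n" "i \<le> n" "Fil n d p"
  shows "Fil n d (T n \<tau> i p)"
proof -
  obtain q where q: "Fil n d q" "\<And>x. dnum n \<tau> i x * (p (gen n i x) - p x) = aff n i x * q x"
    using Fil_divided_difference[OF assms] by blast
  have F: "Fil n d (\<lambda>x. chi n \<tau> i * p (gen n i x) + q x)"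
    by (intro Fil.add Fil_scale Fil_gen assms q)
  have "T n \<tau> i p = (\<lambda>x. chi n \<tau> i * p (gen n i x) + q x)"
  proof (rule Pol_eqI[OF assms(1,2) T_props(1)[OF assms(1,2) Fil_Pol[OF assms(3)]] Fil_Pol[OF F]])
    fix x assume a: "aff n i x \<noteq> 0"
    then have "dcoef n \<tau> i x * (p (gen n i x) - p x) = q x"
      using q(2)[of x] by (simp add: dcoef_dnum field_simps)
    then show "T n \<tau> i p x = chi n \<tau> i * p (gen n i x) + q x"
      using T_props(2)[OF assms(1,2) Fil_Pol[OF assms(3)] a] by simp
  qed
  with F show ?thesis by simp
qed

lemma Fil_foldr_T:
  assumes "1 \<le> n" "set is \<subseteq> {0..n}" "Fil n d p"
  shows "Fil n d (foldr (T n \<tau>) is p)"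
  using assms(2) by (induction "is") (auto simp: assms(3) intro: Fil_T[OF assms(1)])

lemma Fil_Y:
  assumes "1 \<le> n" "i \<in> {1..n}" "Fil n d p"
  shows "Fil n d (Y n \<tau> i p)"
  unfolding Y_def T2_def
  by (intro Fil.add Fil_scale Fil_sum Fil_foldr_T assms(1,3)) (use assms(2) in auto)

lemma Fil_U:
  assumes "1 \<le> n" "Fil n d p"
  shows "Fil n (d + 1) (U n \<tau> p)"
proof -
  let ?q = "foldr (T n \<tau>) (rev [1..<n]) p"
  have q: "Fil n d ?q" by (rule Fil_foldr_T[OF assms(1) _ assms(2)]) auto
  have "Fil n (1 + d) (\<lambda>x. x n * ?q x)"
    using Fil.mult[OF Fil.var[of n n 0] q] assms(1) by simp
  then have "Fil n (d + 1) (\<lambda>x. (-1) * (x n * ?q x) - T n \<tau> n ?q x)"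
    using Fil_mono[OF Fil_T[OF assms(1) order_refl q], of "d + 1"]
    by (intro Fil_diff Fil_scale) auto
  then show ?thesis unfolding U_def by (intro Fil_foldr_T[OF assms(1)]) auto
qed

lemma Fil_S_gen:
  assumes "1 \<le> n" "0 < i" "i \<le> n" "Fil n d p"
  shows "Fil n d (S_gen n \<tau> i p)"
proof -
  have a: "Fil n d (aff_Y n \<tau> i q)" if "Fil n d q" for q
    using that assms unfolding aff_Y_def
    by (cases "i = n") (auto intro!: Fil_diff Fil_scale Fil_Y)
  have "Fil n d (\<lambda>x. T n \<tau> i (aff_Y n \<tau> i p) x - aff_Y n \<tau> i (T n \<tau> i p) x)"
    by (intro Fil_diff Fil_T a assms)
  then show ?thesis using assms by (simp add: S_gen_def commutator_def)
qed

lemma Fil_S_gen_0: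
  assumes "1 \<le> n" "Fil n d p"
  shows "Fil n (d + 1) (S_gen n \<tau> 0 p)"
proof -
  have a: "Fil n e (aff_Y n \<tau> 0 q)" if "Fil n e q" for q e
    using that assms unfolding aff_Y_def by (auto intro!: Fil_diff Fil_scale Fil_Y)
  have "Fil n (d + 1) (\<lambda>x. U n \<tau> (aff_Y n \<tau> 0 p) x - aff_Y n \<tau> 0 (U n \<tau> p) x)"
    by (intro Fil_diff Fil_U a assms)
  then show ?thesis by (simp add: S_gen_def commutator_def)
qed

section \<open>Monomials and the dimension count\<close>

definition monomial :: "nat \<Rightarrow> (nat \<Rightarrow> nat) \<Rightarrow> cfun" where
  "monomial n e x = (\<Prod>i = 1..n. x i ^ e i)"

text \<open>
  The exponents 0, 1, 2, 3, 4, \<dots> correspond to the entries 0, -1, 1, -2, 2, \<dots>, so that the weight of the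
  monomial is the sum of the absolute values of the entries.
\<close>

definition expo :: "(nat \<Rightarrow> int) \<Rightarrow> nat \<Rightarrow> nat" where
  "expo \<nu> i = (if 0 \<le> \<nu> i then 2 * nat (\<nu> i) else 2 * nat (- \<nu> i) - 1)"

definition lbox :: "nat \<Rightarrow> nat \<Rightarrow> (nat \<Rightarrow> int) set" where
  "lbox n d = {\<nu> \<in> Lam n. size1 n \<nu> \<le> d}"

lemma finite_lbox: "finite (lbox n d)"
proof -
  have "lbox n d \<subseteq> {f. \<forall>i. (i \<in> {1..n} \<longrightarrow> f i \<in> {- int d..int d}) \<and> (i \<notin> {1..n} \<longrightarrow> f i = 0)}"
  proof (clarify, intro conjI impI)
    fix \<nu> i assume v: "\<nu> \<in> lbox n d"
    show "\<nu> i = 0" if "i \<notin> {1..n}" using v that by (auto simp: lbox_def Lam_def)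
    show "\<nu> i \<in> {- int d..int d}" if "i \<in> {1..n}"
    proof -
      have "nat \<bar>\<nu> i\<bar> \<le> size1 n \<nu>" unfolding size1_def by (rule member_le_sum) (use that in auto)
      then show ?thesis using v by (auto simp: lbox_def)
    qed
  qed
  then show ?thesis
    by (rule finite_subset) (rule finite_set_of_finite_funs; simp)
qed

lemma monomial_in_lbox:
  assumes "(\<Sum>i = 1..n. (e i + 1) div 2) \<le> d"
  shows "monomial n e \<in> (\<lambda>\<nu>. monomial n (expo \<nu>)) ` lbox n d"
proof -
  define \<nu> where "\<nu> i = (if i \<in> {1..n} then if even (e i) then int (e i div 2) else - int ((e i + 1) div 2) else 0)" for i
  have "expo \<nu> i = e i" if "i \<in> {1..n}" for i
    using that by (auto simp: expo_def \<nu>_def elim!: oddE evenE)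
  then have "monomial n (expo \<nu>) = monomial n e" by (simp add: monomial_def fun_eq_iff)
  moreover have "size1 n \<nu> = (\<Sum>i = 1..n. (e i + 1) div 2)"
    unfolding size1_def by (intro sum.cong refl) (auto simp: \<nu>_def elim!: oddE evenE)
  then have "\<nu> \<in> lbox n d" using assms by (auto simp: lbox_def Lam_def \<nu>_def)
  ultimately show ?thesis by force
qed

lemma span_mult:
  assumes "\<And>a b. a \<in> A \<Longrightarrow> b \<in> B \<Longrightarrow> (\<lambda>x. a x * b x) \<in> cfun.span C"
    and "p \<in> cfun.span A" "q \<in> cfun.span B"
  shows "(\<lambda>x. p x * q x) \<in> cfun.span C"
proof -
  have 1: "(\<lambda>x. a x * q x) \<in> cfun.span C" if a: "a \<in> A" for a
    using assms(3)
  proof (induction rule: cfun.span_induct_alt)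
    case base
    show ?case using cfun.span_zero[of C] by (simp add: zero_fun_def)
  next
    case (step c b q)
    have "(\<lambda>x. a x * (c * b x + q x)) = (\<lambda>x. c * (a x * b x)) + (\<lambda>x. a x * q x)"
      by (auto simp: algebra_simps)
    then show ?case
      using cfun.span_add[OF cfun.span_scale[OF assms(1)[OF a step(1)], of c] step(2)] by simp
  qed
  show ?thesis
    using assms(2)
  proof (induction rule: cfun.span_induct_alt)
    case base
    show ?case using cfun.span_zero[of C] by (simp add: zero_fun_def)
  next
    case (step c a p)
    have "(\<lambda>x. (c * a x + p x) * q x) = (\<lambda>x. c * (a x * q x)) + (\<lambda>x. p x * q x)"
      by (auto simp: algebra_simps)
    then show ?case
      using cfun.span_add[OF cfun.span_scale[OF 1[OF step(1)], of c] step(2)] by simp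
  qed
qed

text \<open>Its use is an upper bound for a dimension: polynomials of weight at most d lie in a
  space spanned by at most as many monomials as there are points in \<open>lbox n d\<close>.\<close>

lemma Fil_span: "Fil n d p \<Longrightarrow> p \<in> cfun.span ((\<lambda>\<nu>. monomial n (expo \<nu>)) ` lbox n d)"
proof -
  let ?M = "\<lambda>d. {monomial n e | e. (\<Sum>i = 1..n. (e i + 1) div 2) \<le> d}"
  have memI: "monomial n e \<in> ?M d" if "(\<Sum>i = 1..n. (e i + 1) div 2) \<le> d" for e d
    using that by blast
  assume "Fil n d p"
  then have "p \<in> cfun.span (?M d)"
  proof induction
    case (const d c)
    have "monomial n (\<lambda>i. 0) \<in> ?M d" by force
    moreover have "monomial n (\<lambda>i. 0) = (\<lambda>x. 1)" by (simp add: monomial_def fun_eq_iff)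
    ultimately have "(\<lambda>x. 1) \<in> cfun.span (?M d)" by (metis (no_types, lifting) cfun.span_base)
    from cfun.span_scale[OF this, of c] show ?case by simp
  next
    case (var i d)
    have m: "monomial n (\<lambda>j. if j = i then 1 else 0) = (\<lambda>x. x i)"
      using var by (simp add: monomial_def fun_eq_iff if_distrib[of "\<lambda>k. _ ^ k"] prod.delta cong: if_cong)
    have "(\<Sum>j = 1..n. ((if j = i then 1 else 0) + 1) div 2) = (\<Sum>j = 1..n. if j = i then 1 else (0::nat))"
      by (intro sum.cong) auto
    then have "(\<Sum>j = 1..n. ((if j = i then 1 else 0) + 1) div 2) \<le> Suc d" by simp
    then have "monomial n (\<lambda>j. if j = i then 1 else 0) \<in> ?M (Suc d)"
      by (rule memI)
    from cfun.span_base[OF this] show ?case unfolding m .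
  next
    case (square i d)
    have m: "monomial n (\<lambda>j. if j = i then 2 else 0) = (\<lambda>x. (x i)\<^sup>2)"
      using square by (simp add: monomial_def fun_eq_iff if_distrib[of "\<lambda>k. _ ^ k"] prod.delta cong: if_cong)
    have "(\<Sum>j = 1..n. ((if j = i then 2 else 0) + 1) div 2) = (\<Sum>j = 1..n. if j = i then 1 else (0::nat))"
      by (intro sum.cong) auto
    then have "(\<Sum>j = 1..n. ((if j = i then 2 else 0) + 1) div 2) \<le> Suc d" by simp
    then have "monomial n (\<lambda>j. if j = i then 2 else 0) \<in> ?M (Suc d)"
      by (rule memI)
    from cfun.span_base[OF this] show ?case unfolding m .
  next
    case (add d p q)
    show ?case using cfun.span_add[OF add.IH] by (simp add: plus_fun_def)
  next
    case (mult d p d' q)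
    show ?case
    proof (rule span_mult[OF _ mult.IH])
      fix a b assume "a \<in> ?M d" "b \<in> ?M d'"
      then obtain e e' where e: "a = monomial n e" "(\<Sum>i = 1..n. (e i + 1) div 2) \<le> d"
        and e': "b = monomial n e'" "(\<Sum>i = 1..n. (e' i + 1) div 2) \<le> d'" by blast
      have "(\<lambda>x. a x * b x) = monomial n (\<lambda>i. e i + e' i)"
        by (simp add: e e' monomial_def fun_eq_iff power_add prod.distrib)
      moreover have "(\<Sum>i = 1..n. (e i + e' i + 1) div 2)
          \<le> (\<Sum>i = 1..n. (e i + 1) div 2 + (e' i + 1) div 2)"
        by (intro sum_mono) linarith
      then have "(\<Sum>i = 1..n. (e i + e' i + 1) div 2) \<le> d + d'"
        using e(2) e'(2) by (simp add: sum.distrib)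
      ultimately show "(\<lambda>x. a x * b x) \<in> cfun.span (?M (d + d'))"
        by (intro cfun.span_base) blast
    qed
  qed
  moreover have "?M d \<subseteq> (\<lambda>\<nu>. monomial n (expo \<nu>)) ` lbox n d"
    using monomial_in_lbox by blast
  ultimately show ?thesis using cfun.span_mono by blast
qed

section \<open>The eigenfunctions form a basis\<close>

context positive_params
begin

lemma gamma_ne_coord:
  assumes "\<mu> \<in> Lam n" "\<nu> \<in> Lam n" "gamma n \<tau> \<mu> \<noteq> gamma n \<tau> \<nu>"
  shows "\<exists>j\<in>{1..n}. gamma n \<tau> \<mu> j \<noteq> gamma n \<tau> \<nu> j"
proof -
  obtain j where j: "gamma n \<tau> \<mu> j \<noteq> gamma n \<tau> \<nu> j" using assms(3) by (auto simp: fun_eq_iff)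
  then have "j \<in> {1..n}"
    unfolding gamma_eq[OF n1 assms(1)] gamma_eq[OF n1 assms(2)] by (metis (full_types))
  with j show ?thesis by blast
qed

text \<open>These eigenfunctions are built along \<open>Lam_induct\<close>, where s_0 only raises
  the size, and not along the word of \<open>u n \<nu>\<close>. Letters fixing \<nu> are skipped,
  because S_i is known to be nonzero only where \<nu> moves.\<close>

lemma good_filtered:
  assumes "\<nu> \<in> Lam n"
  shows "\<exists>q. good \<nu> q \<and> Fil n (size1 n \<nu>) q"
  using n1 assms
proof (induction rule: Lam_induct)
  case zero
  show ?case using good_zero Fil.const by blast
next
  case (finite_gen \<nu> i)
  then obtain q where q: "good \<nu> q" "Fil n (size1 n \<nu>) q" by blast
  show ?case
  proof (cases "idot n i \<nu> = \<nu>")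
    case True
    then show ?thesis using q by auto
  next
    case False
    then show ?thesis
      using good_step[OF q(1) finite_gen(1,3)] Fil_S_gen[OF n1 finite_gen(2,3) q(2)]
        size1_idot[OF finite_gen(2,3)] by metis
  qed
next
  case (affine_gen \<nu>)
  then obtain q where q: "good \<nu> q" "Fil n (size1 n \<nu>) q" by blast
  have "idot n 0 \<nu> \<noteq> \<nu>" using affine_gen(2) by (auto simp: idot_def fun_eq_iff intro!: exI[of _ 1])
  then show ?case
    using good_step[OF q(1) affine_gen(1)] Fil_S_gen_0[OF n1 q(2)] size1_idot_0[of n \<nu>, OF n1 affine_gen(2)]
    by (metis le0)
qed

text \<open>Applying Y_j minus its eigenvalue at \<mu>, for a coordinate j that separates \<mu> from
  \<nu>, removes \<mu> from the relation and leaves the coefficient at \<nu> multiplied by a nonzero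
  number.\<close>

lemma good_independent:
  assumes "finite A" "A \<subseteq> Lam n" "inj_on (gamma n \<tau>) A" "\<And>\<nu>. \<nu> \<in> A \<Longrightarrow> good \<nu> (f \<nu>)"
    and "(\<lambda>x. \<Sum>\<nu>\<in>A. c \<nu> * f \<nu> x) = (\<lambda>x. 0)" "\<nu> \<in> A"
  shows "c \<nu> = 0"
  using assms
proof (induction A arbitrary: c \<nu> rule: finite_induct)
  case (insert \<mu> A)
  have sub: "A \<subseteq> Lam n" "inj_on (gamma n \<tau>) A" "\<And>\<nu>. \<nu> \<in> A \<Longrightarrow> good \<nu> (f \<nu>)"
    using insert.prems by (auto simp: inj_on_def)
  have fP: "f \<nu> \<in> Pol n" if "\<nu> \<in> insert \<mu> A" for \<nu>
    using insert.prems(3)[OF that] by (simp add: good_def)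
  have zero: "c \<nu> = 0" if \<nu>: "\<nu> \<in> A" for \<nu>
  proof -
    have "gamma n \<tau> \<nu> \<noteq> gamma n \<tau> \<mu>"
      using insert.prems(2) insert.hyps(2) \<nu> by (auto simp: inj_on_def)
    then obtain j where j: "gamma n \<tau> \<nu> j \<noteq> gamma n \<tau> \<mu> j" and jn: "j \<in> {1..n}"
      using gamma_ne_coord[of \<nu> \<mu>] insert.prems(1) \<nu> by blast
    let ?g = "\<lambda>\<nu>. gamma n \<tau> \<nu> j"
    have Yf: "Y n \<tau> j (f \<nu>) = (\<lambda>x. ?g \<nu> * f \<nu> x)" if "\<nu> \<in> insert \<mu> A" for \<nu>
      using insert.prems(3)[OF that] jn by (simp add: good_def eigenfun_def)
    have Y1: "Y n \<tau> j (\<lambda>x. \<Sum>\<nu>\<in>insert \<mu> A. c \<nu> * f \<nu> x) = (\<lambda>x. \<Sum>\<nu>\<in>insert \<mu> A. c \<nu> * Y n \<tau> j (f \<nu>) x)"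
      by (rule Y_sum[OF n fP jn])
    have "(\<lambda>x. \<Sum>\<nu>\<in>insert \<mu> A. c \<nu> * (?g \<nu> * f \<nu> x)) = (\<lambda>x. \<Sum>\<nu>\<in>insert \<mu> A. c \<nu> * Y n \<tau> j (f \<nu>) x)"
      by (intro ext sum.cong refl) (simp add: Yf)
    also have "\<dots> = Y n \<tau> j (\<lambda>x. \<Sum>\<nu>\<in>insert \<mu> A. c \<nu> * f \<nu> x)" by (rule Y1[symmetric])
    also have "\<dots> = (\<lambda>x. 0)"
      unfolding insert.prems(4) using Y_sum[OF n _ jn, of "{}" "\<lambda>_ x. 0" \<tau> "\<lambda>_. 0"] by simp
    finally have 1: "(\<Sum>\<nu>\<in>insert \<mu> A. c \<nu> * (?g \<nu> * f \<nu> x)) = 0" for x by (simp add: fun_eq_iff)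
    have 2: "(\<Sum>\<nu>\<in>insert \<mu> A. c \<nu> * f \<nu> x) = 0" for x using insert.prems(4) by (simp add: fun_eq_iff)
    have "(\<Sum>\<nu>\<in>A. (c \<nu> * (?g \<nu> - ?g \<mu>)) * f \<nu> x) = 0" for x
    proof -
      have "(\<Sum>\<nu>\<in>insert \<mu> A. (c \<nu> * (?g \<nu> - ?g \<mu>)) * f \<nu> x)
        = (\<Sum>\<nu>\<in>insert \<mu> A. c \<nu> * (?g \<nu> * f \<nu> x)) - ?g \<mu> * (\<Sum>\<nu>\<in>insert \<mu> A. c \<nu> * f \<nu> x)"
        unfolding sum_distrib_left sum_subtractf[symmetric] by (intro sum.cong) (simp_all add: algebra_simps)
      then show ?thesis using insert.hyps unfolding 1 2 by simp
    qed
    then have "(\<lambda>x. \<Sum>\<nu>\<in>A. (c \<nu> * (?g \<nu> - ?g \<mu>)) * f \<nu> x) = (\<lambda>x. 0)" by (rule ext)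
    from insert.IH[OF sub this \<nu>] have "c \<nu> * (?g \<nu> - ?g \<mu>) = 0" .
    then show ?thesis using j by simp
  qed
  then have "c \<mu> * f \<mu> x = 0" for x
    using fun_cong[OF insert.prems(4), of x] insert.hyps by simp
  then have "c \<mu> = 0" using insert.prems(3)[of \<mu>] by (auto simp: good_def fun_eq_iff)
  then show ?case using zero insert.prems(5) by auto
qed simp

lemma good_inj:
  assumes "inj_on (gamma n \<tau>) (Lam n)" "\<And>\<nu>. \<nu> \<in> Lam n \<Longrightarrow> good \<nu> (f \<nu>)"
  shows "inj_on f (Lam n)"
proof (rule inj_onI, rule ccontr)
  fix \<mu> \<nu> assume a: "\<mu> \<in> Lam n" "\<nu> \<in> Lam n" "f \<mu> = f \<nu>" "\<mu> \<noteq> \<nu>"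
  have "(if \<mu> = \<mu> then 1 else -1 :: complex) = 0"
    by (rule good_independent[of "{\<mu>, \<nu>}" f "\<lambda>\<kappa>. if \<kappa> = \<mu> then 1 else -1"])
      (use a assms in \<open>auto simp: inj_on_def\<close>)
  then show False by simp
qed

lemma good_cfun_independent:
  assumes "inj_on (gamma n \<tau>) (Lam n)" "\<And>\<nu>. \<nu> \<in> Lam n \<Longrightarrow> good \<nu> (f \<nu>)"
  shows "cfun.independent (f ` Lam n)"
proof
  assume "cfun.dependent (f ` Lam n)"
  then obtain U c v where U: "finite U" "U \<subseteq> f ` Lam n" "(\<Sum>v\<in>U. (\<lambda>x. c v * v x)) = 0" "v \<in> U" "c v \<noteq> 0"
    unfolding cfun.dependent_explicit by blast
  then obtain A where A: "A \<subseteq> Lam n" "finite A" "U = f ` A"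
    by (meson finite_subset_image)
  have inj: "inj_on f A" using good_inj[OF assms] A(1) inj_on_subset by blast
  obtain \<nu> where \<nu>: "\<nu> \<in> A" "v = f \<nu>" using U(4) A(3) by blast
  have "(\<Sum>\<nu>\<in>A. c (f \<nu>) * f \<nu> x) = 0" for x
    using fun_cong[OF U(3), of x] sum.reindex[OF inj, of "\<lambda>v. c v * v x"]
    by (simp add: A(3) sum_fun_apply)
  then have "(\<lambda>x. \<Sum>\<nu>\<in>A. c (f \<nu>) * f \<nu> x) = (\<lambda>x. 0)" by (simp add: fun_eq_iff)
  moreover have "inj_on (gamma n \<tau>) A" using assms(1) A(1) by (rule inj_on_subset)
  ultimately have "c (f \<nu>) = 0"
    using good_independent[OF A(2,1) _ _ _ \<nu>(1), of f "\<lambda>\<nu>. c (f \<nu>)"] assms(2) A(1) by blast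
  then show False using U(5) \<nu>(2) by simp
qed

text \<open>The images of \<open>lbox n d\<close> are independent and no fewer than the spanning
  monomials, so adjoining one more independent vector p would exceed the dimension.\<close>

lemma good_span:
  assumes "inj_on (gamma n \<tau>) (Lam n)" "\<And>\<nu>. \<nu> \<in> Lam n \<Longrightarrow> good \<nu> (f \<nu>)"
    and fil: "\<And>\<nu>. \<nu> \<in> Lam n \<Longrightarrow> Fil n (size1 n \<nu>) (f \<nu>)" and "Fil n d p"
  shows "p \<in> cfun.span (f ` lbox n d)"
proof -
  let ?M = "(\<lambda>\<nu>. monomial n (expo \<nu>)) ` lbox n d"
  have sub: "lbox n d \<subseteq> Lam n" by (auto simp: lbox_def)
  have ind: "cfun.independent (f ` lbox n d)"
    using good_cfun_independent[OF assms(1,2)] sub by (metis cfun.independent_mono image_mono)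
  have "f \<nu> \<in> cfun.span ?M" if "\<nu> \<in> lbox n d" for \<nu>
    using that Fil_mono[OF fil] by (intro Fil_span) (auto simp: lbox_def)
  then have "f ` lbox n d \<subseteq> cfun.span ?M" by blast
  moreover have "p \<in> cfun.span ?M" using assms(4) by (rule Fil_span)
  ultimately have sp: "insert p (f ` lbox n d) \<subseteq> cfun.span ?M" by blast
  show ?thesis
  proof (rule ccontr)
    assume p: "p \<notin> cfun.span (f ` lbox n d)"
    then have "p \<notin> f ` lbox n d" using cfun.span_base by blast
    then have "card (insert p (f ` lbox n d)) = card (lbox n d) + 1"
      using finite_lbox[of n d] good_inj[OF assms(1,2)] sub
      by (simp add: card_image inj_on_subset)
    moreover have "card (insert p (f ` lbox n d)) \<le> card ?M"
      using cfun.independent_span_bound[OF _ cfun.independent_insertI[OF p ind] sp] finite_lbox by blast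
    moreover have "card ?M \<le> card (lbox n d)" using finite_lbox by (rule card_image_le)
    ultimately show False by simp
  qed
qed

text \<open>An eigenfunction expanded in the filtered family involves only the index with its own
  eigenvalue. This is what carries the spanning property over to \<open>wilson_poly\<close>.\<close>

lemma good_unique:
  assumes inj: "inj_on (gamma n \<tau>) (Lam n)" and \<nu>: "\<nu> \<in> Lam n" and "good \<nu> p" "good \<nu> q"
  shows "\<exists>c. q = (\<lambda>x. c * p x)"
proof -
  obtain f where f: "\<And>\<nu>. \<nu> \<in> Lam n \<Longrightarrow> good \<nu> (f \<nu>) \<and> Fil n (size1 n \<nu>) (f \<nu>)"
    using good_filtered by metis
  have scal: "\<exists>c. c \<noteq> 0 \<and> p = (\<lambda>x. c * f \<nu> x)" if p: "good \<nu> p" for p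
  proof -
    obtain d where "Fil n d p" using p Pol_Fil by (auto simp: good_def)
    then have "p \<in> cfun.span (f ` lbox n d)" using good_span[OF inj] f by blast
    moreover have "inj_on f (lbox n d)"
      using good_inj[OF inj, of f] f by (auto simp: lbox_def inj_on_def)
    ultimately obtain c where c: "p = (\<lambda>x. \<Sum>\<mu>\<in>lbox n d. c \<mu> * f \<mu> x)"
    proof -
      from \<open>p \<in> cfun.span (f ` lbox n d)\<close> obtain r where "p = (\<Sum>v\<in>f ` lbox n d. (\<lambda>x. r v * v x))"
        unfolding cfun.span_finite[OF finite_imageI[OF finite_lbox]] by blast
      then have "p x = (\<Sum>\<mu>\<in>lbox n d. r (f \<mu>) * f \<mu> x)" for x
        using sum.reindex[OF \<open>inj_on f (lbox n d)\<close>, of "\<lambda>v. r v * v x"] by (simp add: sum_fun_apply)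
      then have "p = (\<lambda>x. \<Sum>\<mu>\<in>lbox n d. r (f \<mu>) * f \<mu> x)" by (rule ext)
      then show thesis by (rule that)
    qed
    \<comment> \<open>\<nu> need not lie in the box belonging to the weight of p, so it is adjoined
      with coefficient 0.\<close>
    let ?A = "insert \<nu> (lbox n d)"
    have A: "finite ?A" "?A \<subseteq> Lam n" using finite_lbox \<nu> by (auto simp: lbox_def)
    define c' where "c' \<mu> = (if \<mu> \<in> lbox n d then c \<mu> else 0)" for \<mu>
    have c': "p = (\<lambda>x. \<Sum>\<mu>\<in>?A. c' \<mu> * f \<mu> x)"
      unfolding c by (intro ext sum.mono_neutral_cong_left) (use finite_lbox in \<open>auto simp: c'_def\<close>)
    have off: "c' \<mu> = 0" if \<mu>: "\<mu> \<in> ?A" "\<mu> \<noteq> \<nu>" for \<mu>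
    proof -
      have "gamma n \<tau> \<mu> \<noteq> gamma n \<tau> \<nu>" using inj \<mu> A(2) \<nu> by (auto simp: inj_on_def)
      then obtain j where j: "gamma n \<tau> \<mu> j \<noteq> gamma n \<tau> \<nu> j" and jn: "j \<in> {1..n}"
        using gamma_ne_coord[of \<mu> \<nu>] A(2) \<mu>(1) \<nu> by blast
      let ?g = "\<lambda>\<nu>. gamma n \<tau> \<nu> j"
      have Yf: "Y n \<tau> j (f \<nu>) = (\<lambda>x. ?g \<nu> * f \<nu> x)" if "\<nu> \<in> ?A" for \<nu>
        using f that A(2) jn by (auto simp: good_def eigenfun_def)
      have "Y n \<tau> j p = (\<lambda>x. \<Sum>\<mu>\<in>?A. c' \<mu> * (?g \<mu> * f \<mu> x))"
      proof -
        have fP: "f \<mu> \<in> Pol n" if "\<mu> \<in> ?A" for \<mu> using f that A(2) by (auto simp: good_def)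
        have "Y n \<tau> j p = Y n \<tau> j (\<lambda>x. \<Sum>\<mu>\<in>?A. c' \<mu> * f \<mu> x)" using c' by simp
        also have "\<dots> = (\<lambda>x. \<Sum>\<mu>\<in>?A. c' \<mu> * Y n \<tau> j (f \<mu>) x)"
          by (rule Y_sum[OF n fP jn])
        also have "\<dots> = (\<lambda>x. \<Sum>\<mu>\<in>?A. c' \<mu> * (?g \<mu> * f \<mu> x))"
          by (intro ext sum.cong refl) (simp add: Yf)
        finally show ?thesis .
      qed
      moreover have "Y n \<tau> j p = (\<lambda>x. ?g \<nu> * p x)"
        using p jn by (simp add: good_def eigenfun_def)
      ultimately have "(\<Sum>\<mu>\<in>?A. c' \<mu> * (?g \<mu> * f \<mu> x)) = ?g \<nu> * (\<Sum>\<mu>\<in>?A. c' \<mu> * f \<mu> x)" for x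
        using c' by (metis (no_types, lifting))
      then have "(\<Sum>\<mu>\<in>?A. (c' \<mu> * (?g \<mu> - ?g \<nu>)) * f \<mu> x) = 0" for x
        unfolding sum_distrib_left
        by (simp add: algebra_simps sum_subtractf)
      then have "(\<lambda>x. \<Sum>\<mu>\<in>?A. (c' \<mu> * (?g \<mu> - ?g \<nu>)) * f \<mu> x) = (\<lambda>x. 0)" by (simp add: fun_eq_iff)
      moreover have "inj_on (gamma n \<tau>) ?A" using inj A(2) by (rule inj_on_subset)
      ultimately have "c' \<mu> * (?g \<mu> - ?g \<nu>) = 0"
        using good_independent[OF A _ _ _ \<mu>(1), of f "\<lambda>\<mu>. c' \<mu> * (?g \<mu> - ?g \<nu>)"] f A(2) by blast
      then show ?thesis using j by simp
    qed
    have "p = (\<lambda>x. c' \<nu> * f \<nu> x)"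
    proof
      fix x
      have "p x = (\<Sum>\<mu>\<in>?A. c' \<mu> * f \<mu> x)" using c' by metis
      also have "\<dots> = (\<Sum>\<mu>\<in>{\<nu>}. c' \<mu> * f \<mu> x)"
        by (rule sum.mono_neutral_right) (use A off in auto)
      finally show "p x = c' \<nu> * f \<nu> x" by simp
    qed
    moreover from this have "c' \<nu> \<noteq> 0" using p by (auto simp: good_def)
    ultimately show ?thesis by blast
  qed
  obtain c where c: "c \<noteq> 0" "p = (\<lambda>x. c * f \<nu> x)" using scal[OF assms(3)] by blast
  obtain c' where "q = (\<lambda>x. c' * f \<nu> x)" using scal[OF assms(4)] by blast
  then have "q = (\<lambda>x. c' / c * p x)" using c by simp
  then show ?thesis by blast
qed

lemma good_basis:
  assumes inj: "inj_on (gamma n \<tau>) (Lam n)" and f: "\<And>\<nu>. \<nu> \<in> Lam n \<Longrightarrow> good \<nu> (f \<nu>)"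
  shows "cfun.span (f ` Lam n) = Pol n"
proof
  have sub: "cfun.subspace (Pol n)"
    unfolding cfun.subspace_def zero_fun_def plus_fun_def by (auto intro: Pol.intros)
  have "f ` Lam n \<subseteq> Pol n" using f by (auto simp: good_def)
  then show "cfun.span (f ` Lam n) \<subseteq> Pol n" using sub by (rule cfun.span_minimal)
next
  obtain q where q: "\<And>\<nu>. \<nu> \<in> Lam n \<Longrightarrow> good \<nu> (q \<nu>) \<and> Fil n (size1 n \<nu>) (q \<nu>)"
    using good_filtered by metis
  have "q \<nu> \<in> cfun.span (f ` Lam n)" if \<nu>: "\<nu> \<in> Lam n" for \<nu>
  proof -
    obtain c where "q \<nu> = (\<lambda>x. c * f \<nu> x)"
      using good_unique[OF inj \<nu> f[OF \<nu>]] q[OF \<nu>] by blast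
    then show ?thesis using \<nu> by (simp add: cfun.span_scale cfun.span_base)
  qed
  then have *: "cfun.span (q ` Lam n) \<subseteq> cfun.span (f ` Lam n)"
    by (intro cfun.span_minimal cfun.subspace_span) auto
  show "Pol n \<subseteq> cfun.span (f ` Lam n)"
  proof
    fix p assume "p \<in> Pol n"
    then obtain d where "Fil n d p" using Pol_Fil by blast
    then have "p \<in> cfun.span (q ` lbox n d)" using good_span[OF inj] q by blast
    moreover have "q ` lbox n d \<subseteq> q ` Lam n" by (auto simp: lbox_def)
    ultimately show "p \<in> cfun.span (f ` Lam n)" using * cfun.span_mono by blast
  qed
qed

end

section \<open>Growth of the weight and the contour shift\<close>

text \<open>The ratio |z + k| / (Re z + k) decreases as z moves to the right, so the inequality
  holds factor by factor in the Pochhammer products and passes to the limit. It carries estimates on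
  one vertical line to the lines on its left, in place of Stirling's formula.\<close>

lemma norm_rGamma_ratio:
  fixes z :: complex and s :: real
  assumes "0 < Re z" "0 \<le> s"
  shows "rGamma (Re z) * cmod (rGamma (z + of_real s)) \<le> cmod (rGamma z) * rGamma (Re z + s)"
proof -
  let ?x = "Re z"
  have factor: "(?x + k) * cmod (z + of_real s + of_real k) \<le> cmod (z + of_real k) * (?x + s + k)" if "0 \<le> k" for k :: real
  proof (rule power2_le_imp_le)
    have "(?x + k)\<^sup>2 \<le> (?x + s + k)\<^sup>2" using assms that by (intro power_mono) auto
    then have "(?x + k)\<^sup>2 * (Im z)\<^sup>2 \<le> (?x + s + k)\<^sup>2 * (Im z)\<^sup>2" by (intro mult_right_mono) auto
    then show "((?x + k) * cmod (z + of_real s + of_real k))\<^sup>2 \<le> (cmod (z + of_real k) * (?x + s + k))\<^sup>2"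
      unfolding power_mult_distrib cmod_power2 by (simp add: algebra_simps)
  qed (use assms that in simp)
  have poch: "pochhammer ?x m * cmod (pochhammer (z + of_real s) m) \<le> cmod (pochhammer z m) * pochhammer (?x + s) m" for m
  proof -
    have "(\<Prod>k<m. (?x + real k) * cmod (z + of_real s + of_nat k)) \<le> (\<Prod>k<m. cmod (z + of_nat k) * (?x + s + real k))"
      using factor[of "real k" for k] assms(1) by (intro prod_mono) auto
    then show ?thesis
      by (simp add: pochhammer_prod prod.distrib atLeast0LessThan prod_norm)
  qed
  have series: "rGamma_series ?x m * cmod (rGamma_series (z + of_real s) m)
      \<le> cmod (rGamma_series z m) * rGamma_series (?x + s) m" for m
  proof -
    let ?L = "ln (real m)"
    have "fact m * exp (?x * ?L) * (fact m * exp ((?x + s) * ?L)) > 0" by simp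
    moreover have n1: "cmod (fact m * exp ((z + of_real s) * of_real ?L)) = fact m * exp ((?x + s) * ?L)"
      by (simp add: norm_mult norm_fact)
    moreover have n2: "cmod (fact m * exp (z * of_real ?L)) = fact m * exp (?x * ?L)"
      by (simp add: norm_mult norm_fact)
    ultimately show ?thesis
      using poch[of "m + 1"] unfolding rGamma_series_def norm_divide n1 n2
      by (simp add: times_divide_times_eq divide_right_mono mult.commute[of "fact m * exp (?x * ?L)"] mult_ac)
  qed
  show ?thesis
  proof (rule LIMSEQ_le)
    show "(\<lambda>m. rGamma_series ?x m * cmod (rGamma_series (z + of_real s) m))
        \<longlonglongrightarrow> rGamma ?x * cmod (rGamma (z + of_real s))"
      "(\<lambda>m. cmod (rGamma_series z m) * rGamma_series (?x + s) m) \<longlonglongrightarrow> cmod (rGamma z) * rGamma (?x + s)"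
      by (intro tendsto_intros)+
  qed (use series in blast)
qed

lemma norm_Gamma_ratio:
  fixes z :: complex and s :: real
  assumes "0 < Re z" "0 \<le> s"
  shows "cmod (Gamma z) \<le> Gamma (Re z) / Gamma (Re z + s) * cmod (Gamma (z + of_real s))"
proof -
  have pos: "0 < Gamma (Re z)" "0 < Gamma (Re z + s)" using assms by (auto intro: Gamma_real_pos)
  have "z \<notin> \<int>\<^sub>\<le>\<^sub>0" "z + of_real s \<notin> \<int>\<^sub>\<le>\<^sub>0"
    using assms by (auto elim!: nonpos_Ints_cases' simp: complex_eq_iff)
  then have "Gamma z \<noteq> 0" "Gamma (z + of_real s) \<noteq> 0" by (auto simp: Gamma_eq_zero_iff)
  then show ?thesis
    using norm_rGamma_ratio[OF assms] pos unfolding rGamma_inverse_Gamma norm_inverse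
    by (simp add: field_simps)
qed

lemma div_sinh_le:
  assumes "0 < (r::real)"
  shows "r / sinh r \<le> 2 * (1 + r) * exp (- r)"
proof -
  have "(1 + r) * exp (- r) * exp (- r) \<le> exp r * exp (- r) * exp (- r)"
    by (intro mult_right_mono) auto
  also have "\<dots> = exp (- r)" by (simp add: exp_minus)
  also have "\<dots> \<le> 1" using assms by simp
  finally have "(1 + r) * exp (- r) * exp (- r) \<le> 1" .
  then have "r \<le> (1 + r) * exp (- r) * (exp r - exp (- r))"
  proof -
    have "(1 + r) * exp (- r) * (exp r - exp (- r)) = (1 + r) * (exp (- r) * exp r) - (1 + r) * exp (- r) * exp (- r)"
      by (simp only: right_diff_distrib mult.assoc)
    moreover have "exp (- r) * exp r = 1" by (simp add: exp_minus)
    ultimately show ?thesis using \<open>(1 + r) * exp (- r) * exp (- r) \<le> 1\<close> by simp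
  qed
  also have "\<dots> = 2 * (1 + r) * exp (- r) * sinh r"
    by (simp add: sinh_def algebra_simps)
  finally show ?thesis using assms by (simp add: pos_divide_le_eq)
qed

text \<open>The reflection formula gives Gamma(1 + iy) Gamma(1 - iy) = pi y / sinh(pi y), and the
  two factors are complex conjugates.\<close>

lemma norm_Gamma_1_imaginary:
  "cmod (Gamma (1 + \<i> * of_real y)) \<le> 4 * (1 + \<bar>y\<bar>) * exp (- pi * \<bar>y\<bar> / 2)"
proof (cases "y = 0")
  case False
  let ?z = "\<i> * of_real y"
  have "Gamma (1 - ?z) = cnj (Gamma (1 + ?z))" by (simp add: cnj_Gamma)
  then have "(cmod (Gamma (1 + ?z)))\<^sup>2 = cmod (Gamma (1 + ?z) * Gamma (1 - ?z))"
    by (simp add: norm_mult power2_eq_square)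
  also have "Gamma (1 + ?z) = ?z * Gamma ?z"
  proof -
    have "?z \<notin> \<int>\<^sub>\<le>\<^sub>0" using False by (auto simp: complex_eq_iff elim!: nonpos_Ints_cases')
    from Gamma_plus1[OF this] show ?thesis by (simp add: add.commute)
  qed
  then have "Gamma (1 + ?z) * Gamma (1 - ?z) = ?z * (of_real pi / sin (of_real pi * ?z))"
    using Gamma_reflection_complex[of ?z] by (simp add: mult.assoc)
  also have "cmod \<dots> = \<bar>y\<bar> * pi / \<bar>sinh (pi * y)\<bar>"
  proof -
    have "sin (of_real pi * ?z) = \<i> * of_real (sinh (pi * y))"
      by (simp add: sin_exp_eq sinh_def exp_minus exp_of_real[symmetric] mult_ac scaleR_conv_of_real field_simps)
    then show ?thesis by (simp add: norm_mult norm_divide)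
  qed
  also have "\<dots> = (pi * \<bar>y\<bar>) / sinh (pi * \<bar>y\<bar>)"
  proof -
    have "sinh (pi * \<bar>y\<bar>) = \<bar>sinh (pi * y)\<bar>"
      using sinh_real_neg_iff[of "pi * y"] by (auto simp: abs_if mult_less_0_iff)
    then show ?thesis by (simp add: mult.commute)
  qed
  also have "\<dots> \<le> 2 * (1 + pi * \<bar>y\<bar>) * exp (- (pi * \<bar>y\<bar>))"
    using False by (intro div_sinh_le) simp
  also have "\<dots> \<le> (4 * (1 + \<bar>y\<bar>) * exp (- pi * \<bar>y\<bar> / 2))\<^sup>2"
  proof -
    have e: "(exp (- pi * \<bar>y\<bar> / 2))\<^sup>2 = exp (- (pi * \<bar>y\<bar>))" by (simp add: power2_eq_square exp_add[symmetric])
    have "pi * \<bar>y\<bar> \<le> 4 * \<bar>y\<bar>" using pi_less_4 by (intro mult_right_mono) auto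
    then have "2 * (1 + pi * \<bar>y\<bar>) \<le> 16 * (1 + \<bar>y\<bar>)\<^sup>2"
    proof -
      have "(1 + \<bar>y\<bar>)\<^sup>2 = 1 + 2 * \<bar>y\<bar> + \<bar>y\<bar>\<^sup>2" by (simp only: power2_eq_square) (simp add: algebra_simps)
      then have "1 + 2 * \<bar>y\<bar> \<le> (1 + \<bar>y\<bar>)\<^sup>2" by simp
      moreover have "2 * (1 + p) \<le> 16 * q" if "p \<le> 4 * r" "1 + 2 * r \<le> q" "0 \<le> r" for p q r :: real
        using that by argo
      ultimately show ?thesis using \<open>pi * \<bar>y\<bar> \<le> 4 * \<bar>y\<bar>\<close> abs_ge_zero by blast
    qed
    then show ?thesis unfolding power_mult_distrib e by (intro mult_right_mono) auto
  qed
  finally show ?thesis by (rule power2_le_imp_le) simp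
qed simp

lemma norm_Gamma_Suc_imaginary:
  "\<exists>C\<ge>0. \<forall>y. cmod (Gamma (of_nat (Suc m) + \<i> * of_real y)) \<le> C * (1 + \<bar>y\<bar>) ^ Suc m * exp (- pi * \<bar>y\<bar> / 2)"
proof (induction m)
  case 0
  show ?case using norm_Gamma_1_imaginary by (intro exI[of _ 4]) simp
next
  case (Suc m)
  then obtain C where C: "C \<ge> 0" "\<And>y. cmod (Gamma (of_nat (Suc m) + \<i> * of_real y)) \<le> C * (1 + \<bar>y\<bar>) ^ Suc m * exp (- pi * \<bar>y\<bar> / 2)"
    by blast
  show ?case
  proof (intro exI[of _ "real (Suc m) * C"] conjI allI)
    fix y :: real
    let ?z = "of_nat (Suc m) + \<i> * of_real y :: complex"
    have "?z \<notin> \<int>\<^sub>\<le>\<^sub>0" by (auto elim!: nonpos_Ints_cases' simp: complex_eq_iff)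
    then have "Gamma (of_nat (Suc (Suc m)) + \<i> * of_real y) = ?z * Gamma ?z"
      using Gamma_plus1[of ?z] by (simp add: algebra_simps)
    moreover have "cmod ?z \<le> real (Suc m) * (1 + \<bar>y\<bar>)"
    proof -
      have "cmod ?z \<le> real (Suc m) + \<bar>y\<bar>"
        using norm_triangle_ineq[of "of_nat (Suc m) :: complex" "\<i> * of_real y"] by (simp add: norm_mult del: of_nat_Suc)
      also have "\<dots> \<le> real (Suc m) * (1 + \<bar>y\<bar>)" by (simp add: algebra_simps)
      finally show ?thesis .
    qed
    then have "cmod ?z * cmod (Gamma ?z) \<le> real (Suc m) * (1 + \<bar>y\<bar>) * (C * (1 + \<bar>y\<bar>) ^ Suc m * exp (- pi * \<bar>y\<bar> / 2))"
      using C by (intro mult_mono) auto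
    ultimately show "cmod (Gamma (of_nat (Suc (Suc m)) + \<i> * of_real y))
        \<le> real (Suc m) * C * (1 + \<bar>y\<bar>) ^ Suc (Suc m) * exp (- pi * \<bar>y\<bar> / 2)"
      by (simp add: norm_mult mult_ac)
  qed (use C in simp)
qed

text \<open>The functional equation treats the line Re z = m + 1 on the right of the strip;
  \<open>norm_Gamma_ratio\<close> transports its bound into the strip.\<close>

lemma norm_Gamma_strip:
  assumes "0 < \<alpha>"
  shows "\<exists>C\<ge>0. \<exists>N. \<forall>z. \<alpha> \<le> Re z \<longrightarrow> Re z \<le> \<beta> \<longrightarrow>
    cmod (Gamma z) \<le> C * (1 + \<bar>Im z\<bar>) ^ N * exp (- pi * \<bar>Im z\<bar> / 2)"
proof -
  define m where "m = nat \<lceil>\<beta>\<rceil>"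
  have m: "\<beta> \<le> real (Suc m)" unfolding m_def by linarith
  obtain C where C: "C \<ge> 0" "\<And>y. cmod (Gamma (of_nat (Suc m) + \<i> * of_real y)) \<le> C * (1 + \<bar>y\<bar>) ^ Suc m * exp (- pi * \<bar>y\<bar> / 2)"
    using norm_Gamma_Suc_imaginary[of m] by blast
  have "continuous_on {\<alpha>..\<beta>} (Gamma :: real \<Rightarrow> real)"
    using assms by (intro continuous_on_Gamma) (auto elim!: nonpos_Ints_cases')
  then have "bounded (Gamma ` {\<alpha>..\<beta>})"
    by (intro compact_imp_bounded compact_continuous_image) auto
  then obtain K where K: "K > 0" "\<And>x. x \<in> {\<alpha>..\<beta>} \<Longrightarrow> \<bar>Gamma x\<bar> \<le> K"
    unfolding bounded_pos by force
  have G: "0 < Gamma (real (Suc m))" by (rule Gamma_real_pos) simp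
  show ?thesis
  proof (intro exI[of _ "K / Gamma (real (Suc m)) * C"] conjI exI[of _ "Suc m"] allI impI)
    fix z assume z: "\<alpha> \<le> Re z" "Re z \<le> \<beta>"
    have eq: "z + of_real (real (Suc m) - Re z) = of_nat (Suc m) + \<i> * of_real (Im z)"
      by (simp add: complex_eq_iff)
    have "cmod (Gamma z) \<le> Gamma (Re z) / Gamma (real (Suc m)) * cmod (Gamma (of_nat (Suc m) + \<i> * of_real (Im z)))"
      using norm_Gamma_ratio[of z "real (Suc m) - Re z"] assms z m unfolding eq by simp
    also have "\<dots> \<le> K / Gamma (real (Suc m)) * (C * (1 + \<bar>Im z\<bar>) ^ Suc m * exp (- pi * \<bar>Im z\<bar> / 2))"
    proof (intro mult_mono C divide_right_mono)
      show "Gamma (Re z) \<le> K" using K(2)[of "Re z"] z by auto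
    qed (use G K in auto)
    finally show "cmod (Gamma z) \<le> K / Gamma (real (Suc m)) * C * (1 + \<bar>Im z\<bar>) ^ Suc m * exp (- pi * \<bar>Im z\<bar> / 2)"
      by (simp add: mult_ac)
  qed (use K G C in auto)
qed

lemma integrable_poly_exp:
  assumes "0 < (\<epsilon>::real)"
  shows "integrable lborel (\<lambda>y. (1 + \<bar>y\<bar>) ^ N * exp (- (1 + \<epsilon>) * \<bar>y\<bar>))"
proof -
  have "set_integrable lborel (einterval (-\<infinity>) \<infinity>) (\<lambda>x. inverse (1 + x^2 :: real))"
    by (rule integrable_inverse_1_plus_square)
  then have int: "integrable lborel (\<lambda>x. inverse (1 + x\<^sup>2 :: real))"
    by (simp add: set_integrable_def einterval_def)
  show ?thesis
  proof (rule Bochner_Integration.integrable_bound)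
    \<comment> \<open>From u^(N+2) \<le> (N+2)! exp u with u = 1 + |y|. Two powers of u pay for 1 +
      y^2, and the rate 1 + \<epsilon> leaves exp(-\<epsilon> |y|) \<le> 1.\<close>
    let ?K = "exp 1 * fact (N + 2) :: real"
    show "integrable lborel (\<lambda>y. ?K * inverse (1 + y\<^sup>2))" using int by simp
    show "AE y in lborel. norm ((1 + \<bar>y\<bar>) ^ N * exp (- (1 + \<epsilon>) * \<bar>y\<bar>)) \<le> norm (?K * inverse (1 + y\<^sup>2 :: real))"
    proof (rule AE_I2)
      fix y :: real
      let ?u = "1 + \<bar>y\<bar>"
      have "?u ^ (N + 2) / fact (N + 2) \<le> exp ?u"
      proof -
        have "(\<Sum>k\<in>{N + 2}. ?u ^ k /\<^sub>R fact k) \<le> (\<Sum>k. ?u ^ k /\<^sub>R fact k)"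
          by (rule sum_le_suminf[OF summable_exp_generic]) simp_all
        then show ?thesis by (simp add: exp_def field_simps)
      qed
      then have 1: "?u ^ N * ?u\<^sup>2 \<le> fact (N + 2) * exp ?u"
        by (simp add: power_add power2_eq_square pos_divide_le_eq mult_ac del: fact_Suc)
      have "?u ^ N * ?u\<^sup>2 * exp (- (1 + \<epsilon>) * \<bar>y\<bar>) \<le> fact (N + 2) * exp ?u * exp (- (1 + \<epsilon>) * \<bar>y\<bar>)"
        by (intro mult_right_mono 1) auto
      also have "\<dots> = fact (N + 2) * exp 1 * exp (- \<epsilon> * \<bar>y\<bar>)"
      proof -
        have "exp ?u * exp (- (1 + \<epsilon>) * \<bar>y\<bar>) = exp 1 * exp (- \<epsilon> * \<bar>y\<bar>)"
          unfolding exp_add[symmetric] by (rule arg_cong[of _ _ exp]) (simp add: algebra_simps)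
        then show ?thesis by (simp only: mult.assoc)
      qed
      also have "\<dots> \<le> fact (N + 2) * exp 1 * 1"
        using assms by (intro mult_left_mono) auto
      finally have 2: "?u ^ N * exp (- (1 + \<epsilon>) * \<bar>y\<bar>) * ?u\<^sup>2 \<le> ?K" by (simp add: mult_ac)
      have "1 + y\<^sup>2 \<le> ?u\<^sup>2" by (simp add: power2_eq_square algebra_simps)
      then have "?u ^ N * exp (- (1 + \<epsilon>) * \<bar>y\<bar>) * (1 + y\<^sup>2) \<le> ?u ^ N * exp (- (1 + \<epsilon>) * \<bar>y\<bar>) * ?u\<^sup>2"
        by (intro mult_left_mono) auto
      from this 2 have "?u ^ N * exp (- (1 + \<epsilon>) * \<bar>y\<bar>) * (1 + y\<^sup>2) \<le> ?K" by (rule order_trans)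
      moreover have "0 < 1 + y\<^sup>2" by (simp add: add_pos_nonneg)
      ultimately have "?u ^ N * exp (- (1 + \<epsilon>) * \<bar>y\<bar>) \<le> ?K * inverse (1 + y\<^sup>2)"
        by (simp only: divide_inverse[symmetric] pos_le_divide_eq)
      moreover have "0 \<le> ?u ^ N * exp (- (1 + \<epsilon>) * \<bar>y\<bar>)" by simp
      moreover have "0 \<le> ?K * inverse (1 + y\<^sup>2)" by simp
      ultimately show "norm (?u ^ N * exp (- (1 + \<epsilon>) * \<bar>y\<bar>)) \<le> norm (?K * inverse (1 + y\<^sup>2))"
        unfolding real_norm_def by (simp only: abs_of_nonneg)
    qed
  qed simp
qed

text \<open>
  Cauchy's theorem moves the line \<open>Re z = 0\<close> to \<open>Re z = 1\<close>, and \<open>z \<mapsto> 1 - z\<close> moves it back with a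
  change of sign.
\<close>

lemma integral_antisymmetric_strip:
  assumes hol: "\<Phi> holomorphic_on {z. - \<delta> < Re z \<and> Re z < 1 + \<delta>}" and \<delta>: "0 < \<delta>"
    and anti: "\<And>z. \<Phi> (1 - z) = - \<Phi> z"
    and decay: "\<And>z. 0 \<le> Re z \<Longrightarrow> Re z \<le> 1 \<Longrightarrow> 1 \<le> \<bar>Im z\<bar> \<Longrightarrow> cmod (\<Phi> z) \<le> g \<bar>Im z\<bar>"
    and g: "(g \<longlongrightarrow> 0) at_top"
    and int: "integrable lborel (\<lambda>y. \<Phi> (\<i> * of_real y))"
  shows "(\<integral>y. \<Phi> (\<i> * of_real y) \<partial>lborel) = 0"
proof -
  let ?S = "{z. - \<delta> < Re z \<and> Re z < 1 + \<delta>}"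
  have "?S = {z. - \<delta> < Re z} \<inter> {z. Re z < 1 + \<delta>}" by auto
  then have S: "convex ?S" "open ?S"
    by (auto intro!: convex_Int open_Int convex_halfspace_Re_gt convex_halfspace_Re_lt open_halfspace_Re_gt open_halfspace_Re_lt)
  obtain G where G: "\<And>z. z \<in> ?S \<Longrightarrow> (G has_field_derivative \<Phi> z) (at z within ?S)"
    using holomorphic_convex_primitive'[OF S hol] by blast
  have G': "(G has_field_derivative \<Phi> z) (at z)" if "z \<in> ?S" for z
    using G[OF that] unfolding at_within_open[OF that S(2)] .
  have line: "((\<lambda>s. \<Phi> (of_real r + \<i> * of_real s)) has_integral (G (of_real r + \<i> * of_real R) - G (of_real r - \<i> * of_real R)) / \<i>) {-R..R}"
    if "0 \<le> r" "r \<le> 1" "0 \<le> R" for r R :: real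
  proof -
    have "((\<lambda>s. G (of_real r + \<i> * of_real s) / \<i>) has_vector_derivative \<Phi> (of_real r + \<i> * of_real s)) (at s within {-R..R})" for s
    proof -
      have "((\<lambda>s. of_real r + \<i> * of_real s) has_vector_derivative \<i>) (at s within {-R..R})"
        by (auto intro!: derivative_eq_intros)
      from field_vector_diff_chain_within[OF this has_field_derivative_at_within[OF G']]
      have "(G \<circ> (\<lambda>s. of_real r + \<i> * of_real s) has_vector_derivative \<i> * \<Phi> (of_real r + \<i> * of_real s)) (at s within {-R..R})"
        using that \<delta> by simp
      from has_vector_derivative_mult_right[OF this, of "1 / \<i>"] show ?thesis
        by (simp add: o_def)
    qed
    from fundamental_theorem_of_calculus[OF _ this] that(3) show ?thesis
      by (simp add: diff_divide_distrib right_diff_distrib)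
  qed
  define I where "I R = (G (\<i> * of_real R) - G (- (\<i> * of_real R))) / \<i>" for R :: real
  have I: "((\<lambda>s. \<Phi> (\<i> * of_real s)) has_integral I R) {-R..R}" if "0 \<le> R" for R
    using line[of 0 R] that by (simp add: I_def)
  have I1: "(G (1 + \<i> * of_real R) - G (1 - \<i> * of_real R)) / \<i> = - I R" if "0 \<le> R" for R
  proof -
    have "((\<lambda>s. \<Phi> (1 + \<i> * of_real s)) has_integral (G (1 + \<i> * of_real R) - G (1 - \<i> * of_real R)) / \<i>) {-R..R}"
      using line[of 1 R] that by simp
    moreover have "((\<lambda>s. \<Phi> (\<i> * of_real (- s))) has_integral I R) {-R..R}"
      using has_integral_reflect_real[where a = "-R" and b = R and f = "\<lambda>s. \<Phi> (\<i> * of_real s)" and i = "I R"]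
        I[OF that] by (simp del: has_integral_reflect_real)
    from has_integral_neg[OF this]
    have "((\<lambda>s. \<Phi> (1 + \<i> * of_real s)) has_integral - I R) {-R..R}"
      using anti[of "\<i> * of_real (- s)" for s] by simp
    ultimately show ?thesis by (rule has_integral_unique)
  qed
  have bound: "cmod (I R) \<le> g R" if R: "1 \<le> R" for R
  proof -
    have seg: "cmod (G (1 + \<i> * of_real t) - G (\<i> * of_real t)) \<le> g \<bar>t\<bar>" if "1 \<le> \<bar>t\<bar>" for t
    proof -
      have "cmod (G (1 + \<i> * of_real t) - G (\<i> * of_real t)) \<le> g \<bar>t\<bar> * cmod ((1 + \<i> * of_real t) - \<i> * of_real t)"
      proof (rule field_differentiable_bound[of "closed_segment (\<i> * of_real t) (1 + \<i> * of_real t)" G \<Phi>])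
        fix z assume "z \<in> closed_segment (\<i> * of_real t) (1 + \<i> * of_real t)"
        then obtain w where w: "0 \<le> w" "w \<le> 1" "z = (1 - w) *\<^sub>R (\<i> * of_real t) + w *\<^sub>R (1 + \<i> * of_real t)"
          by (auto simp: closed_segment_def)
        then have z: "Re z = w" "Im z = t" by (auto simp: algebra_simps)
        show "(G has_field_derivative \<Phi> z) (at z within closed_segment (\<i> * of_real t) (1 + \<i> * of_real t))"
        proof -
          have "z \<in> ?S" using z(1) w(1,2) \<delta> by simp
          then show ?thesis by (rule has_field_derivative_at_within[OF G'])
        qed
        show "cmod (\<Phi> z) \<le> g \<bar>t\<bar>" using decay[of z] z w that by simp
      qed auto
      then show ?thesis by simp
    qed
    \<comment> \<open>By antisymmetry the two vertical sides of the rectangle contribute equally, so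
      2 I R is a sum over the two horizontal sides, where the decay hypothesis applies.\<close>
    have "2 * I R = ((G (\<i> * of_real R) - G (1 + \<i> * of_real R)) + (G (1 - \<i> * of_real R) - G (- (\<i> * of_real R)))) / \<i>"
      using I1[of R] R unfolding I_def by (simp add: field_simps)
    then have "cmod (2 * I R) = cmod ((G (\<i> * of_real R) - G (1 + \<i> * of_real R)) + (G (1 - \<i> * of_real R) - G (- (\<i> * of_real R))))"
      by (simp only: norm_divide norm_ii div_by_1)
    also have "\<dots> \<le> cmod (G (1 + \<i> * of_real R) - G (\<i> * of_real R)) + cmod (G (1 - \<i> * of_real R) - G (- (\<i> * of_real R)))"
      using norm_triangle_ineq[of "G (\<i> * of_real R) - G (1 + \<i> * of_real R)" "G (1 - \<i> * of_real R) - G (- (\<i> * of_real R))"]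
      by (simp only: norm_minus_commute[of "G (\<i> * of_real R)"])
    also have "\<dots> \<le> g R + g R"
      using seg[of R] seg[of "- R"] R by (intro add_mono) auto
    finally show ?thesis by (simp add: norm_mult)
  qed
  let ?h = "\<lambda>y. \<Phi> (\<i> * of_real y)"
  \<comment> \<open>Cauchy's theorem speaks about truncations only; integrability makes them
    converge to the full integral by dominated convergence.\<close>
  have "(\<lambda>k. \<integral>y. indicator {- real k..real k} y *\<^sub>R ?h y \<partial>lborel) \<longlonglongrightarrow> (\<integral>y. ?h y \<partial>lborel)"
  proof (rule integral_dominated_convergence[where w = "\<lambda>y. cmod (?h y)"])
    show "AE y in lborel. (\<lambda>k. indicator {- real k..real k} y *\<^sub>R ?h y) \<longlonglongrightarrow> ?h y"
    proof (rule AE_I2)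
      fix y :: real
      obtain k0 where k0: "\<bar>y\<bar> \<le> real k0" using real_arch_simple by blast
      have "\<forall>\<^sub>F k in sequentially. indicator {- real k..real k} y *\<^sub>R ?h y = ?h y"
        using eventually_ge_at_top[of k0] by eventually_elim (use k0 in \<open>auto simp: indicator_def\<close>)
      then show "(\<lambda>k. indicator {- real k..real k} y *\<^sub>R ?h y) \<longlonglongrightarrow> ?h y"
        by (rule tendsto_eventually)
    qed
    show "?h \<in> borel_measurable lborel" using int by auto
    then show "(\<lambda>y. indicator {- real k..real k} y *\<^sub>R ?h y) \<in> borel_measurable lborel" for k by simp
    show "integrable lborel (\<lambda>y. cmod (?h y))" using int by simp
    show "AE y in lborel. norm (indicator {- real k..real k} y *\<^sub>R ?h y) \<le> cmod (?h y)" for k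
      by (auto simp: indicator_def)
  qed
  moreover have "(\<integral>y. indicator {- real k..real k} y *\<^sub>R ?h y \<partial>lborel) = I (real k)" for k
  proof -
    have "set_integrable lborel {- real k..real k} ?h"
      using int unfolding set_integrable_def by (intro integrable_mult_indicator) auto
    from has_integral_integral[THEN iffD1, OF set_borel_integral_eq_integral(1)[OF this]]
    have "((\<lambda>y. ?h y) has_integral (LINT y:{- real k..real k}|lborel. ?h y)) {- real k..real k}"
      unfolding set_borel_integral_eq_integral(2)[OF \<open>set_integrable lborel {- real k..real k} ?h\<close>] .
    from has_integral_unique[OF this I[of "real k"]] show ?thesis
      by (simp add: set_lebesgue_integral_def)
  qed
  moreover have "(\<lambda>k. I (real k)) \<longlonglongrightarrow> 0"
  proof (rule Lim_null_comparison)
    show "\<forall>\<^sub>F k in sequentially. norm (I (real k)) \<le> g (real k)"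
      using eventually_ge_at_top[of 1] by eventually_elim (use bound in auto)
    show "(\<lambda>k. g (real k)) \<longlonglongrightarrow> 0"
      using g filterlim_real_sequentially by (rule filterlim_compose)
  qed
  ultimately show ?thesis using LIMSEQ_unique by force
qed

section \<open>Growth of the weight factors on the strip\<close>

text \<open>Contains the contour Re z = 0, needed for integrability, and the far horizontal
  segments, needed for the shift. On it |1 - 2z| \<ge> 1, and 1 - 2z has to be divided out in
  \<open>rGamma_pair_bound\<close>.\<close>

definition pole_free :: "complex set" where
  "pole_free = {z. 0 \<le> Re z \<and> Re z \<le> 1 \<and> (Re z = 0 \<or> 1 \<le> \<bar>Im z\<bar>)}"

text \<open>Decay at rate e up to polynomial factors, a negative e meaning growth. Rates add under
  multiplication, so estimates reduce to counting Gamma and sine factors.\<close>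

definition growth :: "real \<Rightarrow> (complex \<Rightarrow> complex) \<Rightarrow> bool" where
  "growth e f \<longleftrightarrow> (\<exists>C\<ge>0. \<exists>N. \<forall>z\<in>pole_free. cmod (f z) \<le> C * (1 + \<bar>Im z\<bar>) ^ N * exp (- e * \<bar>Im z\<bar>))"

lemma growthI:
  assumes "0 \<le> C" "\<And>z. z \<in> pole_free \<Longrightarrow> cmod (f z) \<le> C * (1 + \<bar>Im z\<bar>) ^ N * exp (- e * \<bar>Im z\<bar>)"
  shows "growth e f"
  using assms unfolding growth_def by blast

lemma growth_const: "growth 0 (\<lambda>z. c)"
  by (rule growthI[of "cmod c" _ 0]) auto

lemma growth_mult:
  assumes "growth e f" "growth e' g"
  shows "growth (e + e') (\<lambda>z. f z * g z)"
proof -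
  obtain C N C' N' where C: "0 \<le> C" "\<And>z. z \<in> pole_free \<Longrightarrow> cmod (f z) \<le> C * (1 + \<bar>Im z\<bar>) ^ N * exp (- e * \<bar>Im z\<bar>)"
    and C': "0 \<le> C'" "\<And>z. z \<in> pole_free \<Longrightarrow> cmod (g z) \<le> C' * (1 + \<bar>Im z\<bar>) ^ N' * exp (- e' * \<bar>Im z\<bar>)"
    using assms unfolding growth_def by blast
  show ?thesis
  proof (rule growthI[of "C * C'" _ "N + N'"])
    fix z assume z: "z \<in> pole_free"
    have "cmod (f z * g z) \<le> (C * (1 + \<bar>Im z\<bar>) ^ N * exp (- e * \<bar>Im z\<bar>)) * (C' * (1 + \<bar>Im z\<bar>) ^ N' * exp (- e' * \<bar>Im z\<bar>))"
      unfolding norm_mult by (intro mult_mono C(2) C'(2) z) (use C in auto)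
    also have "\<dots> = C * C' * (1 + \<bar>Im z\<bar>) ^ (N + N') * (exp (- e * \<bar>Im z\<bar>) * exp (- e' * \<bar>Im z\<bar>))"
      by (simp add: power_add mult_ac)
    also have "exp (- e * \<bar>Im z\<bar>) * exp (- e' * \<bar>Im z\<bar>) = exp (- (e + e') * \<bar>Im z\<bar>)"
      unfolding exp_add[symmetric] by (rule arg_cong[of _ _ exp]) (simp add: algebra_simps)
    finally show "cmod (f z * g z) \<le> C * C' * (1 + \<bar>Im z\<bar>) ^ (N + N') * exp (- (e + e') * \<bar>Im z\<bar>)" .
  qed (use C C' in auto)
qed

lemma growth_add:
  assumes "growth e f" "growth e g"
  shows "growth e (\<lambda>z. f z + g z)"
proof -
  obtain C N C' N' where C: "0 \<le> C" "\<And>z. z \<in> pole_free \<Longrightarrow> cmod (f z) \<le> C * (1 + \<bar>Im z\<bar>) ^ N * exp (- e * \<bar>Im z\<bar>)"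
    and C': "0 \<le> C'" "\<And>z. z \<in> pole_free \<Longrightarrow> cmod (g z) \<le> C' * (1 + \<bar>Im z\<bar>) ^ N' * exp (- e * \<bar>Im z\<bar>)"
    using assms unfolding growth_def by blast
  show ?thesis
  proof (rule growthI[of "C + C'" _ "N + N'"])
    fix z assume z: "z \<in> pole_free"
    have "C * (1 + \<bar>Im z\<bar>) ^ N * exp (- e * \<bar>Im z\<bar>) \<le> C * (1 + \<bar>Im z\<bar>) ^ (N + N') * exp (- e * \<bar>Im z\<bar>)"
      "C' * (1 + \<bar>Im z\<bar>) ^ N' * exp (- e * \<bar>Im z\<bar>) \<le> C' * (1 + \<bar>Im z\<bar>) ^ (N + N') * exp (- e * \<bar>Im z\<bar>)"
      using C(1) C'(1) by (intro mult_right_mono mult_left_mono power_increasing; simp)+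
    from add_mono[OF order_trans[OF C(2)[OF z] this(1)] order_trans[OF C'(2)[OF z] this(2)]]
    show "cmod (f z + g z) \<le> (C + C') * (1 + \<bar>Im z\<bar>) ^ (N + N') * exp (- e * \<bar>Im z\<bar>)"
      unfolding distrib_right by (rule order_trans[OF norm_triangle_ineq])
  qed (use C C' in auto)
qed

lemma growth_prod:
  assumes "\<And>a. a \<in> A \<Longrightarrow> growth 0 (f a)"
  shows "growth 0 (\<lambda>z. \<Prod>a\<in>A. f a z)"
  using assms
proof (induction A rule: infinite_finite_induct)
  case (insert a A)
  then have "growth (0 + 0) (\<lambda>z. f a z * (\<Prod>a\<in>A. f a z))" by (intro growth_mult) auto
  then show ?case using insert by simp
qed (simp_all add: growth_const)

lemma growth_ident: "growth 0 (\<lambda>z. z)"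
proof (rule growthI[of 2 _ 1])
  fix z assume "z \<in> pole_free"
  then have "\<bar>Re z\<bar> \<le> 1" by (auto simp: pole_free_def)
  then show "cmod z \<le> 2 * (1 + \<bar>Im z\<bar>) ^ 1 * exp (- 0 * \<bar>Im z\<bar>)"
    using cmod_le[of z] by simp
qed simp

lemma growth_Pol:
  assumes "p \<in> Pol n"
  shows "growth 0 (\<lambda>z. p (x(1 := z)))"
  using assms
proof induction
  case (Pol_var i)
  then show ?case by (cases "i = 1") (simp_all add: growth_const growth_ident)
next
  case (Pol_add p q)
  then show ?case by (intro growth_add)
next
  case (Pol_mult p q)
  then show ?case using growth_mult[of 0 _ 0] by simp
qed (rule growth_const)

lemma cmod_sin_le: "cmod (sin (of_real pi * w)) \<le> exp (pi * \<bar>Im w\<bar>)"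
  using cmod_sin_le_exp[of 1 "of_real pi * w"] by (simp add: abs_mult)

text \<open>Gamma(a + w) Gamma(a - w) from the weight after absorbing the factor a - w. The result
  is invariant under w \<mapsto> 1 - w and has no poles for -a < Re w < 1 + a.\<close>

definition Gpair :: "real \<Rightarrow> complex \<Rightarrow> complex" where
  "Gpair a w = Gamma (of_real a + w) * Gamma (of_real a + 1 - w)"

lemma Gpair_bound:
  assumes "0 < a"
  shows "\<exists>C\<ge>0. \<exists>N. \<forall>w. 0 \<le> Re w \<longrightarrow> Re w \<le> 1 \<longrightarrow> cmod (Gpair a w) \<le> C * (1 + \<bar>Im w\<bar>) ^ N * exp (- pi * \<bar>Im w\<bar>)"
proof -
  obtain C N where C: "0 \<le> C" "\<And>z. a \<le> Re z \<Longrightarrow> Re z \<le> a + 1 \<Longrightarrow>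
      cmod (Gamma z) \<le> C * (1 + \<bar>Im z\<bar>) ^ N * exp (- pi * \<bar>Im z\<bar> / 2)"
    using norm_Gamma_strip[OF assms, of "a + 1"] by blast
  show ?thesis
  proof (intro exI[of _ "C * C"] conjI exI[of _ "N + N"] allI impI)
    fix w assume w: "0 \<le> Re w" "Re w \<le> 1"
    let ?b = "C * (1 + \<bar>Im w\<bar>) ^ N * exp (- pi * \<bar>Im w\<bar> / 2)"
    have "cmod (Gamma (of_real a + w)) \<le> ?b" "cmod (Gamma (of_real a + 1 - w)) \<le> ?b"
      using C(2)[of "of_real a + w"] C(2)[of "of_real a + 1 - w"] w by simp_all
    then have "cmod (Gpair a w) \<le> ?b * ?b"
      unfolding Gpair_def norm_mult by (intro mult_mono) (use C in auto)
    also have "\<dots> = C * C * (1 + \<bar>Im w\<bar>) ^ (N + N) * (exp (- pi * \<bar>Im w\<bar> / 2) * exp (- pi * \<bar>Im w\<bar> / 2))"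
      by (simp add: power_add mult_ac)
    also have "exp (- pi * \<bar>Im w\<bar> / 2) * exp (- pi * \<bar>Im w\<bar> / 2) = exp (- pi * \<bar>Im w\<bar>)"
      unfolding exp_add[symmetric] by (rule arg_cong[of _ _ exp]) simp
    finally show "cmod (Gpair a w) \<le> C * C * (1 + \<bar>Im w\<bar>) ^ (N + N) * exp (- pi * \<bar>Im w\<bar>)" .
  qed (use C in auto)
qed

lemma growth_Gpair:
  assumes "0 < a"
  shows "growth pi (Gpair a)"
  using Gpair_bound[OF assms] unfolding growth_def pole_free_def by blast

text \<open>As sin(pi w)/pi is 1/(Gamma(w) Gamma(1 - w)), this is a quotient of two such pairs, with
  parameters a and 0, and the exponential rates cancel.\<close>

definition Epair :: "real \<Rightarrow> complex \<Rightarrow> complex" where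
  "Epair a w = Gpair a w * (sin (of_real pi * w) / of_real pi)"

lemma Epair_bound:
  assumes "0 < a"
  shows "\<exists>C\<ge>0. \<exists>N. \<forall>w. 0 \<le> Re w \<longrightarrow> Re w \<le> 1 \<longrightarrow> cmod (Epair a w) \<le> C * (1 + \<bar>Im w\<bar>) ^ N"
proof -
  obtain C N where C: "0 \<le> C" "\<And>w. 0 \<le> Re w \<Longrightarrow> Re w \<le> 1 \<Longrightarrow> cmod (Gpair a w) \<le> C * (1 + \<bar>Im w\<bar>) ^ N * exp (- pi * \<bar>Im w\<bar>)"
    using Gpair_bound[OF assms] by blast
  show ?thesis
  proof (intro exI[of _ C] conjI exI[of _ N] allI impI C(1))
    fix w assume w: "0 \<le> Re w" "Re w \<le> 1"
    have "cmod (sin (of_real pi * w) / of_real pi) \<le> exp (pi * \<bar>Im w\<bar>)"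
    proof -
      have "cmod (sin (of_real pi * w)) / pi \<le> cmod (sin (of_real pi * w)) / 1"
        using pi_gt3 by (intro divide_left_mono) auto
      then show ?thesis using cmod_sin_le[of w] by (simp add: norm_divide)
    qed
    then have "cmod (Epair a w) \<le> (C * (1 + \<bar>Im w\<bar>) ^ N * exp (- pi * \<bar>Im w\<bar>)) * exp (pi * \<bar>Im w\<bar>)"
      unfolding Epair_def norm_mult by (intro mult_mono C(2) w) (use C in auto)
    then show "cmod (Epair a w) \<le> C * (1 + \<bar>Im w\<bar>) ^ N"
      by (simp add: mult.assoc exp_add[symmetric])
  qed
qed

lemma growth_Epair:
  assumes "0 < a" "Re c = 0"
  shows "growth 0 (\<lambda>z. Epair a (z + c))"
proof -
  obtain C N where C: "0 \<le> C" "\<And>w. 0 \<le> Re w \<Longrightarrow> Re w \<le> 1 \<Longrightarrow> cmod (Epair a w) \<le> C * (1 + \<bar>Im w\<bar>) ^ N"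
    using Epair_bound[OF assms(1)] by blast
  show ?thesis
  proof (rule growthI[of "C * (1 + \<bar>Im c\<bar>) ^ N" _ N])
    fix z assume "z \<in> pole_free"
    then have z: "0 \<le> Re (z + c)" "Re (z + c) \<le> 1" using assms(2) by (auto simp: pole_free_def)
    have "1 + \<bar>Im (z + c)\<bar> \<le> (1 + \<bar>Im c\<bar>) * (1 + \<bar>Im z\<bar>)"
      proof -
      have "0 \<le> \<bar>Im c\<bar> * \<bar>Im z\<bar>" by simp
      then show ?thesis using abs_triangle_ineq[of "Im z" "Im c"]
        by (simp only: distrib_left distrib_right mult_1 mult_1_right plus_complex.sel; linarith)
    qed
    then have "(1 + \<bar>Im (z + c)\<bar>) ^ N \<le> ((1 + \<bar>Im c\<bar>) * (1 + \<bar>Im z\<bar>)) ^ N"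
      by (intro power_mono) auto
    then have "C * (1 + \<bar>Im (z + c)\<bar>) ^ N \<le> C * ((1 + \<bar>Im c\<bar>) * (1 + \<bar>Im z\<bar>)) ^ N"
      using C(1) by (intro mult_left_mono)
    then show "cmod (Epair a (z + c)) \<le> C * (1 + \<bar>Im c\<bar>) ^ N * (1 + \<bar>Im z\<bar>) ^ N * exp (- 0 * \<bar>Im z\<bar>)"
      using C(2)[OF z] by (simp add: power_mult_distrib mult.assoc)
  qed (use C in auto)
qed

lemma Gpair_reflect: "Gpair a (1 - w) = Gpair a w"
proof -
  have "of_real a + (1 - w) = of_real a + 1 - w" "of_real a + 1 - (1 - w) = of_real a + w" by simp_all
  then show ?thesis unfolding Gpair_def by (simp only: mult.commute)
qed

lemma Epair_reflect: "Epair a (1 - w) = Epair a w"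
proof -
  have "sin (of_real pi * (1 - w)) = sin (of_real pi * w)"
    by (simp add: right_diff_distrib sin_diff)
  then show ?thesis by (simp add: Epair_def Gpair_reflect)
qed

text \<open>By reflection the product is sin(2 pi z) / (pi (1 - 2z)). Its rate -2 pi consumes half
  of the decay 4 pi of the four \<open>Gpair\<close> factors in \<open>Hs\<close>.\<close>

lemma rGamma_pair_bound: "growth (- (2 * pi)) (\<lambda>z. rGamma (2 * z) * rGamma (2 - 2 * z))"
proof (rule growthI[of 1 _ 0])
  fix z assume z: "z \<in> pole_free"
  have ne: "1 \<le> cmod (1 - 2 * z)"
  proof (cases "Re z = 0")
    case True
    then show ?thesis using abs_Re_le_cmod[of "1 - 2 * z"] by simp
  next
    case False
    then show ?thesis using z abs_Im_le_cmod[of "1 - 2 * z"] by (auto simp: pole_free_def)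
  qed
  have "(1 - 2 * z) * rGamma (2 - 2 * z) = rGamma (1 - 2 * z)"
    using rGamma_plus1[of "1 - 2 * z"] by simp
  then have "(1 - 2 * z) * (rGamma (2 * z) * rGamma (2 - 2 * z)) = sin (of_real pi * (2 * z)) / of_real pi"
    using rGamma_reflection_complex[of "2 * z"] by (simp add: mult_ac)
  then have "cmod (1 - 2 * z) * cmod (rGamma (2 * z) * rGamma (2 - 2 * z)) = cmod (sin (of_real pi * (2 * z))) / pi"
    by (metis norm_mult norm_divide norm_of_real abs_of_pos pi_gt_zero)
  also have "\<dots> \<le> cmod (sin (of_real pi * (2 * z))) / 1"
    using pi_gt3 by (intro divide_left_mono) auto
  also have "\<dots> \<le> exp (pi * \<bar>Im (2 * z)\<bar>)" using cmod_sin_le[of "2 * z"] by simp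
  also have "\<dots> = exp (2 * pi * \<bar>Im z\<bar>)" by (simp add: abs_mult mult_ac)
  finally have "cmod (1 - 2 * z) * cmod (rGamma (2 * z) * rGamma (2 - 2 * z)) \<le> exp (2 * pi * \<bar>Im z\<bar>)" .
  moreover have "1 * cmod (rGamma (2 * z) * rGamma (2 - 2 * z)) \<le> cmod (1 - 2 * z) * cmod (rGamma (2 * z) * rGamma (2 - 2 * z))"
    using ne by (intro mult_right_mono) auto
  ultimately show "cmod (rGamma (2 * z) * rGamma (2 - 2 * z)) \<le> 1 * (1 + \<bar>Im z\<bar>) ^ 0 * exp (- (- (2 * pi)) * \<bar>Im z\<bar>)"
    by simp
qed simp

lemma inverse_Gamma_pair: "inverse (Gamma w * Gamma (- w)) = - w * (sin (of_real pi * w) / of_real (pi :: real))" for w :: complex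
  using rGamma_reflection_complex'[of w] by (simp add: Gamma_def)

lemma Gamma_shift: "0 < Re z \<Longrightarrow> z * Gamma z = Gamma (z + 1)" for z :: complex
  by (subst Gamma_plus1) (auto elim!: nonpos_Ints_cases')

context positive_params
begin

text \<open>The factor of Delta for one pair of coordinates, including its share of
  \<open>c_plus\<close>, which makes it unsymmetric in x and y. \<open>Sg\<close> is the analogue
  for one coordinate.\<close>

definition Pw :: "complex \<Rightarrow> complex \<Rightarrow> complex" where
  "Pw x y = Gamma_pm2 (par_t \<tau>) x y / Gamma_pm2 0 x y *
     ((par_t \<tau> - x + y) * (par_t \<tau> - x - y) / ((y - x) * (- x - y)))"

definition Sg :: "complex \<Rightarrow> complex" where
  "Sg x = Gamma_pm (par_a \<tau>) x * Gamma_pm (par_b \<tau>) x * Gamma_pm (par_c \<tau>) x * Gamma_pm (par_d \<tau>) x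
     / Gamma_pm 0 (2 * x) * ((par_a \<tau> - x) * (par_b \<tau> - x) / (- 2 * x))"

lemma Delta_eq: "Delta n \<tau> x = (\<Prod>j = 1..n. \<Prod>k = j + 1..n. Pw (x j) (x k)) * (\<Prod>j = 1..n. Sg (x j))"
  unfolding Delta_def c_plus_def Delta_plus_def Pw_def Sg_def prod.distrib by (simp only: mult_ac)

text \<open>The continuation to the strip of chi_0 + d_0 times \<open>Sg\<close>, see
  \<open>Sg_eq\<close>. In this form a, b, c, d enter alike and the symmetry z \<mapsto> 1 - z is
  visible.\<close>

definition Hs :: "complex \<Rightarrow> complex" where
  "Hs z = Gpair ra z * Gpair rb z * Gpair rc z * Gpair rd z * (rGamma (2 * z) * rGamma (2 - 2 * z))"

lemma Hs_reflect: "Hs (1 - z) = Hs z"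
proof -
  have "2 * (1 - z) = 2 - 2 * z" "2 - 2 * (1 - z) = 2 * z" by simp_all
  then show ?thesis unfolding Hs_def Gpair_reflect by (simp only: mult.commute)
qed

lemma growth_Hs: "growth (2 * pi) Hs"
proof -
  have "growth (pi + pi + pi + pi + - (2 * pi)) (\<lambda>z. Gpair ra z * Gpair rb z * Gpair rc z * Gpair rd z * (rGamma (2 * z) * rGamma (2 - 2 * z)))"
    by (intro growth_mult growth_Gpair real_pos rGamma_pair_bound)
  then show ?thesis by (simp add: Hs_def[abs_def])
qed

text \<open>With w = x + y and w = x - y, the numerator of \<open>c_plus\<close> raises Gamma(t - w)
  to Gamma(t + 1 - w) and its denominator raises Gamma(-w) to Gamma(1 - w). At coinciding
  coordinates, division by zero gives \<open>Pw\<close> the value 0.\<close>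

lemma Pw_eq:
  assumes "Re x = 0" "Re y = 0"
  shows "Pw x y = (if x = y \<or> x = - y then 0 else Epair rt (x + y) * Epair rt (x - y))"
proof (cases "x = y \<or> x = - y")
  case True
  then have "(y - x) * (- x - y) = 0" by auto
  then show ?thesis using True by (simp add: Pw_def)
next
  case False
  define p q where pq: "p = x + y" "q = x - y"
  have ne: "p \<noteq> 0" "q \<noteq> 0" using False by (auto simp: pq add_eq_0_iff)
  have re: "Re p = 0" "Re q = 0" using assms by (auto simp: pq)
  have args: "of_real rt + x + y = of_real rt + p" "of_real rt + x - y = of_real rt + q"
    "of_real rt - x + y = of_real rt - q" "of_real rt - x - y = of_real rt - p"
    "0 + x + y = p" "0 + x - y = q" "0 - x + y = - q" "0 - x - y = - p" "y - x = - q" "- x - y = - p"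
    by (simp_all add: pq)
  let ?t = "of_real rt :: complex"
  have sh: "(?t - w) * Gamma (?t - w) = Gamma (?t + 1 - w)" if "Re w = 0" for w
    using Gamma_shift[of "?t - w"] that real_pos(1) by (simp add: algebra_simps)
  have E: "Epair rt w = Gamma (?t + w) * ((?t - w) * Gamma (?t - w)) * (inverse (Gamma w * Gamma (- w)) / - w)"
    if "Re w = 0" "w \<noteq> 0" for w
    unfolding sh[OF that(1)] inverse_Gamma_pair Epair_def Gpair_def using that(2) by simp
  have "Pw x y = Gamma (?t + p) * Gamma (?t + q) * Gamma (?t - q) * Gamma (?t - p) / (Gamma p * Gamma q * Gamma (- q) * Gamma (- p)) *
     ((?t - q) * (?t - p) / ((- q) * (- p)))"
    unfolding Pw_def Gamma_pm2_def par_real args ..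
  also have "\<dots> = Epair rt p * Epair rt q"
    unfolding E[OF re(1) ne(1)] E[OF re(2) ne(2)] divide_inverse inverse_mult_distrib by (simp only: mult_ac)
  finally show ?thesis using False by (simp add: pq)
qed

text \<open>The prefactor is chi_0 + d_0; it does for c and d what \<open>c_plus\<close> does for a
  and b.\<close>

lemma Sg_eq:
  assumes "Re x = 0" "x \<noteq> 0"
  shows "(par_c \<tau> - x) * (par_d \<tau> - x) / (1 - 2 * x) * Sg x = Hs x"
proof -
  have ne: "1 - 2 * x \<noteq> 0" using assms(1) by (auto simp: complex_eq_iff)
  have sh: "(of_real a - x) * Gamma (of_real a - x) = Gamma (of_real a + 1 - x)" if "0 < a" for a
    using Gamma_shift[of "of_real a - x"] that assms(1) by (simp add: algebra_simps)
  have G: "Gpair a x = Gamma (of_real a + x) * ((of_real a - x) * Gamma (of_real a - x))" if "0 < a" for a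
    unfolding sh[OF that] Gpair_def ..
  have r1: "(1 - 2 * x) * rGamma (2 - 2 * x) = rGamma (1 - 2 * x)"
    using rGamma_plus1[of "1 - 2 * x"] by simp
  have r2: "(- 2 * x) * rGamma (1 - 2 * x) = rGamma (- 2 * x)"
    using rGamma_plus1[of "- 2 * x"] by (simp add: add.commute)
  have "rGamma (2 - 2 * x) = rGamma (- 2 * x) / (- 2 * x) / (1 - 2 * x)"
    unfolding r2[symmetric] r1[symmetric] using ne assms(2) by simp
  then have "rGamma (2 * x) * rGamma (2 - 2 * x)
      = inverse (Gamma (0 + 2 * x) * Gamma (0 - 2 * x)) / (- 2 * x) / (1 - 2 * x)"
    by (simp add: Gamma_def)
  then show ?thesis
    unfolding Hs_def G[OF real_pos(2)] G[OF real_pos(3)] G[OF real_pos(4)] G[OF real_pos(5)]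
      Sg_def Gamma_pm_def par_real divide_inverse by (simp only: mult_ac)
qed

lemma Sg_0: "Sg 0 = 0" by (simp add: Sg_def)

text \<open>Read off from \<open>growth_Hs\<close> by solving \<open>Sg_eq\<close> for
  \<open>Sg\<close>: on the imaginary axis |c - x| \<ge> c and |d - x| \<ge> d.\<close>

lemma Sg_bound: "\<exists>C\<ge>0. \<exists>N. \<forall>y. cmod (Sg (\<i> * of_real y)) \<le> C * (1 + \<bar>y\<bar>) ^ N * exp (- (2 * pi) * \<bar>y\<bar>)"
proof -
  have "growth (2 * pi) (\<lambda>z. 1 / (of_real rc * of_real rd) * (1 + (-2) * z) * Hs z)"
  proof -
    have "growth (0 + 0 + 2 * pi) (\<lambda>z. 1 / (of_real rc * of_real rd) * (1 + (-2) * z) * Hs z)"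
    proof (intro growth_mult growth_Hs growth_const)
      have "growth (0 + 0) (\<lambda>z. (-2) * z)" by (intro growth_mult growth_const growth_ident)
      then show "growth 0 (\<lambda>z. 1 + (-2) * z)" by (intro growth_add growth_const) simp
    qed
    then show ?thesis by simp
  qed
  then obtain C N where C: "0 \<le> C" "\<And>z. z \<in> pole_free \<Longrightarrow>
      cmod (1 / (of_real rc * of_real rd) * (1 + (-2) * z) * Hs z) \<le> C * (1 + \<bar>Im z\<bar>) ^ N * exp (- (2 * pi) * \<bar>Im z\<bar>)"
    unfolding growth_def by blast
  show ?thesis
  proof (intro exI[of _ C] conjI exI[of _ N] allI C(1))
    fix y :: real
    let ?x = "\<i> * of_real y :: complex"
    show "cmod (Sg ?x) \<le> C * (1 + \<bar>y\<bar>) ^ N * exp (- (2 * pi) * \<bar>y\<bar>)"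
    proof (cases "y = 0")
      case True
      then show ?thesis using C(1) by (simp add: Sg_0)
    next
      case False
      have cd: "rc \<le> cmod (of_real rc - ?x)" "rd \<le> cmod (of_real rd - ?x)"
        using abs_Re_le_cmod[of "of_real rc - ?x"] abs_Re_le_cmod[of "of_real rd - ?x"] real_pos by simp_all
      have ne: "1 - 2 * ?x \<noteq> 0" by (auto simp: complex_eq_iff)
      have "(of_real rc - ?x) * (of_real rd - ?x) * Sg ?x = (1 - 2 * ?x) * Hs ?x"
        using Sg_eq[of ?x] False ne unfolding par_real by (simp add: field_simps)
      then have "cmod (of_real rc - ?x) * cmod (of_real rd - ?x) * cmod (Sg ?x) = cmod ((1 - 2 * ?x) * Hs ?x)"
        by (metis norm_mult)
      moreover have "rc * rd * cmod (Sg ?x) \<le> cmod (of_real rc - ?x) * cmod (of_real rd - ?x) * cmod (Sg ?x)"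
        using cd real_pos by (intro mult_right_mono mult_mono) auto
      ultimately have "rc * rd * cmod (Sg ?x) \<le> cmod ((1 - 2 * ?x) * Hs ?x)" by simp
      then have "cmod (Sg ?x) \<le> cmod ((1 - 2 * ?x) * Hs ?x) / (rc * rd)"
        using real_pos by (simp add: pos_le_divide_eq mult.commute)
      also have "\<dots> = cmod (1 / (of_real rc * of_real rd) * (1 + (-2) * ?x) * Hs ?x)"
        using real_pos by (simp add: norm_mult norm_divide)
      also have "\<dots> \<le> C * (1 + \<bar>y\<bar>) ^ N * exp (- (2 * pi) * \<bar>y\<bar>)"
        using C(2)[of ?x] by (simp add: pole_free_def)
      finally show ?thesis .
    qed
  qed
qed

end

section \<open>Measurability, integrability and reflections of the integral\<close>

text \<open>\<open>Gamma\<close> is the pointwise inverse of the entire function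
  \<open>rGamma\<close>, so its poles, where it takes the value 0, need no separate
  treatment.\<close>

lemma Gamma_measurable [measurable (raw)]:
  fixes f :: "'a \<Rightarrow> complex"
  assumes "f \<in> borel_measurable M"
  shows "(\<lambda>x. Gamma (f x)) \<in> borel_measurable M"
proof -
  have "(rGamma :: complex \<Rightarrow> complex) \<in> borel_measurable borel"
    by (intro borel_measurable_continuous_onI holomorphic_on_imp_continuous_on holomorphic_rGamma)
  from measurable_compose[OF assms this] show ?thesis
    unfolding Gamma_def by (rule borel_measurable_inverse)
qed

definition ix :: "(nat \<Rightarrow> real) \<Rightarrow> point" where
  "ix y = (\<lambda>j. \<i> * of_real (y j))"

definition Rn :: "nat \<Rightarrow> (nat \<Rightarrow> real) measure" where
  "Rn n = (\<Pi>\<^sub>M j\<in>{1..n}. lborel)"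

interpretation lb: product_sigma_finite "\<lambda>_ :: nat. lborel :: real measure"
  by standard

lemma Re_ix [simp]: "Re (ix y j) = 0"
  by (simp add: ix_def)

lemma ix_measurable: "j \<in> {1..n} \<Longrightarrow> (\<lambda>y. ix y j) \<in> borel_measurable (Rn n)"
proof -
  assume "j \<in> {1..n}"
  then have "(\<lambda>y. y j) \<in> measurable (Rn n) lborel" unfolding Rn_def by (rule measurable_component_singleton)
  then have "(\<lambda>y. y j) \<in> borel_measurable (Rn n)" by simp
  then show ?thesis unfolding ix_def by measurable
qed

lemma Pol_measurable: "p \<in> Pol n \<Longrightarrow> (\<lambda>y. p (ix y)) \<in> borel_measurable (Rn n)"
proof (induction rule: Pol.induct)
  case (Pol_var i)
  then show ?case by (rule ix_measurable)
next
  case (Pol_add p q)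
  show ?case by (rule borel_measurable_add[OF Pol_add.IH])
next
  case (Pol_mult p q)
  show ?case by (rule borel_measurable_times[OF Pol_mult.IH])
qed simp

text \<open>A multiplicative majorant of the coordinates: powers of it split into one factor per
  coordinate, so the bound for the integrand becomes a product of one-variable functions.\<close>

definition Bn :: "nat \<Rightarrow> (nat \<Rightarrow> real) \<Rightarrow> real" where
  "Bn n y = (\<Prod>j = 1..n. 1 + \<bar>y j\<bar>)"

lemma Bn_ge_1: "1 \<le> Bn n y"
  unfolding Bn_def by (rule prod_ge_1) simp

lemma Bn_ge: "j \<in> {1..n} \<Longrightarrow> 1 + \<bar>y j\<bar> \<le> Bn n y"
proof -
  assume j: "j \<in> {1..n}"
  have "1 \<le> (\<Prod>k\<in>{1..n} - {j}. 1 + \<bar>y k\<bar>)" by (rule prod_ge_1) simp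
  then have "(1 + \<bar>y j\<bar>) * 1 \<le> (1 + \<bar>y j\<bar>) * (\<Prod>k\<in>{1..n} - {j}. 1 + \<bar>y k\<bar>)"
    by (intro mult_left_mono) auto
  then show ?thesis unfolding Bn_def using prod.remove[OF _ j, of "\<lambda>k. 1 + \<bar>y k\<bar>"] by simp
qed

definition tame :: "nat \<Rightarrow> ((nat \<Rightarrow> real) \<Rightarrow> complex) \<Rightarrow> bool" where
  "tame n f \<longleftrightarrow> (\<exists>K\<ge>0. \<exists>N. \<forall>y. cmod (f y) \<le> K * Bn n y ^ N)"

lemma tameI: "0 \<le> K \<Longrightarrow> (\<And>y. cmod (f y) \<le> K * Bn n y ^ N) \<Longrightarrow> tame n f"
  unfolding tame_def by blast

lemma tame_const: "tame n (\<lambda>y. c)"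
  by (rule tameI[of "cmod c" _ _ 0]) auto

lemma tame_mult:
  assumes "tame n f" "tame n g"
  shows "tame n (\<lambda>y. f y * g y)"
proof -
  obtain K N K' N' where K: "0 \<le> K" "\<And>y. cmod (f y) \<le> K * Bn n y ^ N"
    and K': "0 \<le> K'" "\<And>y. cmod (g y) \<le> K' * Bn n y ^ N'"
    using assms unfolding tame_def by blast
  show ?thesis
  proof (rule tameI[of "K * K'" _ _ "N + N'"])
    fix y
    have "0 \<le> Bn n y" using Bn_ge_1[of n y] by simp
    then have "cmod (f y * g y) \<le> (K * Bn n y ^ N) * (K' * Bn n y ^ N')"
      unfolding norm_mult by (intro mult_mono K K' mult_nonneg_nonneg zero_le_power norm_ge_zero)
    then show "cmod (f y * g y) \<le> K * K' * Bn n y ^ (N + N')" by (simp add: power_add mult_ac)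
  qed (use K K' in simp)
qed

lemma tame_add:
  assumes "tame n f" "tame n g"
  shows "tame n (\<lambda>y. f y + g y)"
proof -
  obtain K N K' N' where K: "0 \<le> K" "\<And>y. cmod (f y) \<le> K * Bn n y ^ N"
    and K': "0 \<le> K'" "\<And>y. cmod (g y) \<le> K' * Bn n y ^ N'"
    using assms unfolding tame_def by blast
  show ?thesis
  proof (rule tameI[of "K + K'" _ _ "N + N'"])
    fix y
    have "K * Bn n y ^ N \<le> K * Bn n y ^ (N + N')" "K' * Bn n y ^ N' \<le> K' * Bn n y ^ (N + N')"
      using K(1) K'(1) Bn_ge_1[of n y] by (intro mult_left_mono power_increasing; simp)+
    from add_mono[OF order_trans[OF K(2) this(1)] order_trans[OF K'(2) this(2)]]
    show "cmod (f y + g y) \<le> (K + K') * Bn n y ^ (N + N')"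
      unfolding distrib_right by (rule order_trans[OF norm_triangle_ineq])
  qed (use K K' in simp)
qed

lemma tame_prod:
  assumes "\<And>a. a \<in> A \<Longrightarrow> tame n (f a)"
  shows "tame n (\<lambda>y. \<Prod>a\<in>A. f a y)"
  using assms by (induction A rule: infinite_finite_induct) (simp_all add: tame_const tame_mult)

lemma tame_Pol: "p \<in> Pol n \<Longrightarrow> tame n (\<lambda>y. p (ix y))"
proof (induction rule: Pol.induct)
  case (Pol_var i)
  show ?case
  proof (rule tameI[of 1 _ _ 1])
    show "cmod (ix y i) \<le> 1 * Bn n y ^ 1" for y
      using Bn_ge[OF Pol_var, of y] by (simp add: ix_def norm_mult)
  qed simp
qed (simp_all add: tame_const tame_add tame_mult)

text \<open>Meant for i > 0: s_0 does not preserve the imaginary contour.\<close>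

definition rgen :: "nat \<Rightarrow> nat \<Rightarrow> (nat \<Rightarrow> real) \<Rightarrow> nat \<Rightarrow> real" where
  "rgen n i y = (if i = n then y(n := - y n) else y(i := y (i + 1), i + 1 := y i))"

lemma ix_rgen: "0 < i \<Longrightarrow> ix (rgen n i y) = gen n i (ix y)"
  by (auto simp: ix_def rgen_def gen_def fun_eq_iff)

lemma rgen_measurable:
  assumes "0 < i" "i \<le> n"
  shows "rgen n i \<in> measurable (Rn n) (Rn n)"
proof -
  have c: "(\<lambda>y. y j) \<in> borel_measurable (Rn n)" if "j \<in> {1..n}" for j
    using measurable_component_singleton[of j "{1..n}" "\<lambda>_. lborel :: real measure"] that by (simp add: Rn_def)
  have "(\<lambda>y j. rgen n i y j) \<in> measurable (Rn n) (\<Pi>\<^sub>M j\<in>{1..n}. lborel)"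
  proof (rule measurable_PiM_single')
    fix j assume j: "j \<in> {1..n}"
    show "(\<lambda>y. rgen n i y j) \<in> measurable (Rn n) lborel"
    proof (cases "i = n")
      case True
      have "(\<lambda>y. - y n) \<in> borel_measurable (Rn n)" using c[of n] assms by simp
      then show ?thesis using c[OF j] True by (cases "j = n") (simp_all add: rgen_def)
    next
      case False
      then show ?thesis using c[OF j] c[of i] c[of "i + 1"] assms
        by (cases "j = i"; cases "j = i + 1") (simp_all add: rgen_def)
    qed
  next
    show "(\<lambda>y j. rgen n i y j) \<in> space (Rn n) \<rightarrow> (\<Pi>\<^sub>E j\<in>{1..n}. space lborel)"
      using assms by (auto simp: Rn_def space_PiM rgen_def PiE_def extensional_def)
  qed
  then show ?thesis by (simp add: Rn_def)
qed

lemma emeasure_lborel_uminus: "A \<in> sets lborel \<Longrightarrow> emeasure lborel (uminus -` A) = emeasure lborel (A :: real set)"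
  using emeasure_distr[of uminus lborel borel A] by (simp add: lborel_distr_uminus)

text \<open>The product measure is determined by boxes; s_n reflects one side of a box and the other
  s_i exchange two sides.\<close>

lemma distr_rgen:
  assumes "0 < i" "i \<le> n"
  shows "distr (Rn n) (Rn n) (rgen n i) = Rn n"
  unfolding Rn_def
proof (rule lb.PiM_eqI)
  fix A :: "nat \<Rightarrow> real set"
  assume A: "\<And>j. j \<in> {1..n} \<Longrightarrow> A j \<in> sets lborel"
  let ?M = "\<Pi>\<^sub>M j\<in>{1..n}. lborel :: real measure"
  have PA: "Pi\<^sub>E {1..n} A \<in> sets ?M" using A by (intro sets_PiM_I_finite) auto
  have d: "emeasure (distr ?M ?M (rgen n i)) (Pi\<^sub>E {1..n} A) = emeasure ?M (rgen n i -` Pi\<^sub>E {1..n} A \<inter> space ?M)"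
    using rgen_measurable[OF assms] PA by (intro emeasure_distr) (simp_all add: Rn_def)
  show "emeasure (distr ?M ?M (rgen n i)) (Pi\<^sub>E {1..n} A) = (\<Prod>j\<in>{1..n}. emeasure lborel (A j))"
  proof (cases "i = n")
    case True
    let ?A = "A(n := uminus -` A n)"
    have An: "uminus -` A n \<in> sets lborel"
      using measurable_sets[of uminus lborel lborel "A n"] A[of n] assms by simp
    have "rgen n i -` Pi\<^sub>E {1..n} A \<inter> space ?M = Pi\<^sub>E {1..n} ?A"
      using True assms by (auto simp: rgen_def space_PiM PiE_def extensional_def Pi_def split: if_splits)
    then have "emeasure ?M (rgen n i -` Pi\<^sub>E {1..n} A \<inter> space ?M) = (\<Prod>j\<in>{1..n}. emeasure lborel (?A j))"
      using A An by (simp only:) (rule lb.emeasure_PiM, auto)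
    also have "\<dots> = (\<Prod>j\<in>{1..n}. emeasure lborel (A j))"
      by (intro prod.cong refl) (use A assms in \<open>auto simp: emeasure_lborel_uminus\<close>)
    finally show ?thesis using d by simp
  next
    case False
    let ?s = "Transposition.transpose i (i + 1)"
    have i: "i < n" using False assms by simp
    have s: "?s j \<in> {1..n} \<longleftrightarrow> j \<in> {1..n}" for j using i assms by (auto simp: Transposition.transpose_def)
    have r: "rgen n i y j = y (?s j)" for y j using False by (auto simp: rgen_def Transposition.transpose_def)
    have "rgen n i -` Pi\<^sub>E {1..n} A \<inter> space ?M = Pi\<^sub>E {1..n} (\<lambda>j. A (?s j))"
    proof (intro equalityI subsetI)
      fix y assume y: "y \<in> rgen n i -` Pi\<^sub>E {1..n} A \<inter> space ?M"
      show "y \<in> Pi\<^sub>E {1..n} (\<lambda>j. A (?s j))"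
      proof (rule PiE_I)
        fix j assume "j \<in> {1..n}"
        then have "rgen n i y (?s j) \<in> A (?s j)" using y s by (auto simp: PiE_def Pi_def)
        then show "y j \<in> A (?s j)" by (simp add: r)
      next
        fix j assume "j \<notin> {1..n}"
        then show "y j = undefined" using y by (auto simp: space_PiM PiE_def extensional_def)
      qed
    next
      fix y assume y: "y \<in> Pi\<^sub>E {1..n} (\<lambda>j. A (?s j))"
      have "rgen n i y \<in> Pi\<^sub>E {1..n} A"
      proof (rule PiE_I)
        fix j assume "j \<in> {1..n}"
        then have "?s j \<in> {1..n}" by (simp only: s)
        from PiE_mem[OF y this] show "rgen n i y j \<in> A j" by (simp add: r)
      next
        fix j assume j: "j \<notin> {1..n}"
        then have "?s j = j" using i assms by (auto simp: Transposition.transpose_def)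
        then show "rgen n i y j = undefined" using y j by (simp add: r PiE_def extensional_def)
      qed
      then show "y \<in> rgen n i -` Pi\<^sub>E {1..n} A \<inter> space ?M"
        using y by (auto simp: space_PiM PiE_def)
    qed
    then have "emeasure ?M (rgen n i -` Pi\<^sub>E {1..n} A \<inter> space ?M) = (\<Prod>j\<in>{1..n}. emeasure lborel (A (?s j)))"
      using A s by (simp only:) (rule lb.emeasure_PiM, auto)
    also have "\<dots> = (\<Prod>j\<in>{1..n}. emeasure lborel (A j))"
      by (rule prod.reindex_bij_witness[where i = ?s and j = ?s]) (use s in auto)
    finally show ?thesis using d by simp
  qed
qed simp_all

lemma integral_odd:
  fixes h :: "(nat \<Rightarrow> real) \<Rightarrow> complex"
  assumes "0 < i" "i \<le> n" "h \<in> borel_measurable (Rn n)" "\<And>y. h (rgen n i y) = - h y"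
  shows "(\<integral>y. h y \<partial>Rn n) = 0"
proof -
  have "(\<integral>y. h y \<partial>Rn n) = (\<integral>y. h y \<partial>distr (Rn n) (Rn n) (rgen n i))"
    by (simp add: distr_rgen[OF assms(1,2)])
  also have "\<dots> = (\<integral>y. h (rgen n i y) \<partial>Rn n)"
    by (rule integral_distr[OF rgen_measurable[OF assms(1,2)] assms(3)])
  finally show ?thesis by (simp add: assms(4))
qed

context positive_params
begin

lemma Delta_measurable: "(\<lambda>y. Delta n \<tau> (ix y)) \<in> borel_measurable (Rn n)"
proof -
  have P: "(\<lambda>y. Pw (ix y j) (ix y k)) \<in> borel_measurable (Rn n)" if "j \<in> {1..n}" "k \<in> {1..n}" for j k
    using ix_measurable[OF that(1)] ix_measurable[OF that(2)]
    unfolding Pw_def Gamma_pm2_def by measurable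
  have S: "(\<lambda>y. Sg (ix y j)) \<in> borel_measurable (Rn n)" if "j \<in> {1..n}" for j
    using ix_measurable[OF that] unfolding Sg_def Gamma_pm_def by measurable
  show ?thesis unfolding Delta_eq
    by (intro borel_measurable_times borel_measurable_prod P S) auto
qed

lemma tame_Pw:
  assumes "j \<in> {1..n}" "k \<in> {1..n}"
  shows "tame n (\<lambda>y. Pw (ix y j) (ix y k))"
proof -
  obtain C N where C: "C \<ge> 0" "\<And>w. 0 \<le> Re w \<Longrightarrow> Re w \<le> 1 \<Longrightarrow> cmod (Epair rt w) \<le> C * (1 + \<bar>Im w\<bar>) ^ N"
    using Epair_bound[OF real_pos(1)] by blast
  have E: "cmod (Epair rt w) \<le> C * (Bn n y * Bn n y) ^ N" if "Re w = 0" "\<bar>Im w\<bar> \<le> \<bar>y j\<bar> + \<bar>y k\<bar>" for w y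
  proof -
    have "1 + \<bar>Im w\<bar> \<le> (1 + \<bar>y j\<bar>) * (1 + \<bar>y k\<bar>)"
    proof -
      have "0 \<le> \<bar>y j\<bar> * \<bar>y k\<bar>" by simp
      then show ?thesis using that(2) by (simp only: distrib_left distrib_right mult_1 mult_1_right; linarith)
    qed
    also have "\<dots> \<le> Bn n y * Bn n y"
      using Bn_ge_1[of n y] by (intro mult_mono Bn_ge assms) auto
    finally have "C * (1 + \<bar>Im w\<bar>) ^ N \<le> C * (Bn n y * Bn n y) ^ N"
      using C(1) by (intro mult_left_mono power_mono) auto
    then show ?thesis using C(2)[of w] that(1) by simp
  qed
  show ?thesis
  proof (rule tameI[of "C * C" _ _ "N + N + (N + N)"])
    fix y
    have "cmod (Pw (ix y j) (ix y k)) \<le> (C * (Bn n y * Bn n y) ^ N) * (C * (Bn n y * Bn n y) ^ N)"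
    proof (cases "ix y j = ix y k \<or> ix y j = - ix y k")
      case True
      have "0 \<le> (C * (Bn n y * Bn n y) ^ N) * (C * (Bn n y * Bn n y) ^ N)" by simp
      then show ?thesis using True Pw_eq[of "ix y j" "ix y k"] by simp
    next
      case False
      have "\<bar>Im (ix y j + ix y k)\<bar> \<le> \<bar>y j\<bar> + \<bar>y k\<bar>" "\<bar>Im (ix y j - ix y k)\<bar> \<le> \<bar>y j\<bar> + \<bar>y k\<bar>"
        by (auto simp: ix_def)
      then have "cmod (Epair rt (ix y j + ix y k)) \<le> C * (Bn n y * Bn n y) ^ N"
        "cmod (Epair rt (ix y j - ix y k)) \<le> C * (Bn n y * Bn n y) ^ N"
        by (intro E; simp)+
      then have "cmod (Epair rt (ix y j + ix y k) * Epair rt (ix y j - ix y k))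
          \<le> (C * (Bn n y * Bn n y) ^ N) * (C * (Bn n y * Bn n y) ^ N)"
        unfolding norm_mult using C(1) Bn_ge_1[of n y] by (intro mult_mono) auto
      then show ?thesis using False Pw_eq[of "ix y j" "ix y k"] by simp
    qed
    also have "\<dots> = C * C * Bn n y ^ (N + N + (N + N))"
      by (simp add: power_mult_distrib mult_ac power_add[symmetric])
    finally show "cmod (Pw (ix y j) (ix y k)) \<le> C * C * Bn n y ^ (N + N + (N + N))" .
  qed simp
qed

text \<open>The pair factors grow only polynomially, so integrability rests on the decay of
  \<open>Sg\<close> at rate 2 pi in each coordinate.\<close>

lemma Delta_integrable:
  assumes "p \<in> Pol n"
  shows "integrable (Rn n) (\<lambda>y. p (ix y) * Delta n \<tau> (ix y))"
proof -
  have "tame n (\<lambda>y. p (ix y) * (\<Prod>j = 1..n. \<Prod>k = j + 1..n. Pw (ix y j) (ix y k)))"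
    by (intro tame_mult tame_Pol assms tame_prod tame_Pw) auto
  then obtain K N where K: "0 \<le> K"
    "\<And>y. cmod (p (ix y) * (\<Prod>j = 1..n. \<Prod>k = j + 1..n. Pw (ix y j) (ix y k))) \<le> K * Bn n y ^ N"
    unfolding tame_def by blast
  obtain C N' where C: "C \<ge> 0" "\<And>y. cmod (Sg (\<i> * of_real y)) \<le> C * (1 + \<bar>y\<bar>) ^ N' * exp (- (2 * pi) * \<bar>y\<bar>)"
    using Sg_bound by blast
  \<comment> \<open>The rate 2 pi is written as 1 + (2 pi - 1) to fit
    \<open>integrable_poly_exp\<close>.\<close>
  define g where "g y = C * ((1 + \<bar>y\<bar>) ^ (N + N') * exp (- (1 + (2 * pi - 1)) * \<bar>y\<bar>))" for y :: real
  have "integrable lborel g"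
    unfolding g_def by (intro integrable_mult_right integrable_poly_exp) (use pi_gt3 in simp)
  then have "integrable (Rn n) (\<lambda>y. \<Prod>j\<in>{1..n}. g (y j))"
    unfolding Rn_def by (intro lb.product_integrable_prod) auto
  then have int: "integrable (Rn n) (\<lambda>y. K * (\<Prod>j\<in>{1..n}. g (y j)))" by simp
  show ?thesis
  proof (rule Bochner_Integration.integrable_bound[OF int])
    show "(\<lambda>y. p (ix y) * Delta n \<tau> (ix y)) \<in> borel_measurable (Rn n)"
      by (intro borel_measurable_times Pol_measurable assms Delta_measurable)
    show "AE y in Rn n. norm (p (ix y) * Delta n \<tau> (ix y)) \<le> norm (K * (\<Prod>j\<in>{1..n}. g (y j)))"
    proof (rule AE_I2)
      fix y
      have "cmod (\<Prod>j = 1..n. Sg (ix y j)) \<le> (\<Prod>j = 1..n. C * (1 + \<bar>y j\<bar>) ^ N' * exp (- (2 * pi) * \<bar>y j\<bar>))"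
        unfolding prod_norm[symmetric] using C(2) by (intro prod_mono) (simp add: ix_def)
      then have "cmod (p (ix y) * (\<Prod>j = 1..n. \<Prod>k = j + 1..n. Pw (ix y j) (ix y k))) * cmod (\<Prod>j = 1..n. Sg (ix y j))
        \<le> (K * Bn n y ^ N) * (\<Prod>j = 1..n. C * (1 + \<bar>y j\<bar>) ^ N' * exp (- (2 * pi) * \<bar>y j\<bar>))"
        using K(1) Bn_ge_1[of n y] by (intro mult_mono K(2)) auto
      also have "\<dots> = K * (\<Prod>j\<in>{1..n}. g (y j))"
        unfolding Bn_def prod_power_distrib mult.assoc prod.distrib[symmetric] g_def
        by (intro arg_cong[of _ _ "\<lambda>c. K * c"] prod.cong refl) (simp add: power_add mult_ac)
      finally have "norm (p (ix y) * Delta n \<tau> (ix y)) \<le> K * (\<Prod>j\<in>{1..n}. g (y j))"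
        unfolding Delta_eq norm_mult by (simp add: mult_ac)
      then show "norm (p (ix y) * Delta n \<tau> (ix y)) \<le> norm (K * (\<Prod>j\<in>{1..n}. g (y j)))" by simp
    qed
  qed
qed

end

section \<open>Symmetry of the operators \<open>T n \<tau> i\<close>\<close>

lemma aff_gen: "1 \<le> n \<Longrightarrow> i \<le> n \<Longrightarrow> aff n i (gen n i x) = - aff n i x"
  by (auto simp: aff_def gen_def)

lemma tendsto_power_exp: "((\<lambda>y. C * (1 + y) ^ N * exp (- (2 * pi) * y)) \<longlongrightarrow> 0) at_top"
proof (rule Lim_null_comparison)
  let ?g = "\<lambda>y :: real. \<bar>C\<bar> * exp 1 * ((1 + y) ^ N / exp (1 + y))"
  show "\<forall>\<^sub>F y in at_top. norm (C * (1 + y) ^ N * exp (- (2 * pi) * y)) \<le> ?g y"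
    using eventually_ge_at_top[of 0]
  proof eventually_elim
    fix y :: real assume y: "0 \<le> y"
    have "1 * y \<le> (2 * pi) * y" using y pi_gt3 by (intro mult_right_mono) auto
    then have "exp (- (2 * pi) * y) \<le> exp (- y)" by simp
    also have "\<dots> = exp 1 / exp (1 + y)" by (simp add: exp_add exp_minus divide_inverse)
    finally have "\<bar>C\<bar> * (1 + y) ^ N * exp (- (2 * pi) * y) \<le> \<bar>C\<bar> * (1 + y) ^ N * (exp 1 / exp (1 + y))"
      using y by (intro mult_left_mono) auto
    then show "norm (C * (1 + y) ^ N * exp (- (2 * pi) * y)) \<le> ?g y"
      using y by (simp add: abs_mult power_abs mult_ac)
  qed
  have "filterlim (\<lambda>y :: real. 1 + y) at_top at_top"
    by (rule filterlim_tendsto_add_at_top[OF tendsto_const filterlim_ident])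
  from filterlim_compose[OF tendsto_power_div_exp_0 this]
  have "((\<lambda>y. \<bar>C\<bar> * exp 1 * ((1 + y) ^ N / exp (1 + y))) \<longlongrightarrow> \<bar>C\<bar> * exp 1 * 0) at_top"
    by (intro tendsto_mult tendsto_const)
  then show "(?g \<longlongrightarrow> 0) at_top" by simp
qed

context positive_params
begin

text \<open>
  \<open>(T\<^sub>i f) g - f (T\<^sub>i g)\<close> is \<open>\<chi>\<^sub>i + d\<^sub>i\<close> times a function that is odd under \<open>s\<^sub>i\<close>; symmetry of \<open>T\<^sub>i\<close>
  therefore reduces to the invariance under \<open>s\<^sub>i\<close> of the following product, analytically continued to
  the strip \<open>0 \<le> Re x\<^sub>1 \<le> 1\<close> when \<open>i = 0\<close>.
\<close>

definition reflected_weight :: "nat \<Rightarrow> point \<Rightarrow> complex" where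
  "reflected_weight i x = (chi n \<tau> i + dcoef n \<tau> i x) * Delta n \<tau> x"

lemma Delta_pairs:
  "Delta n \<tau> x = (\<Prod>(j, k)\<in>(SIGMA j:{1..n}. {j + 1..n}). Pw (x j) (x k)) * (\<Prod>j = 1..n. Sg (x j))"
  unfolding Delta_eq by (subst prod.Sigma) auto

text \<open>The added factor (t - x + y)/(y - x) is the mirror image of the unsymmetric part of
  \<open>Pw y x\<close>, so that both sides contain both of these factors.\<close>

lemma Pw_swap:
  assumes "x \<noteq> y"
  shows "(1 + par_t \<tau> / (y - x)) * Pw y x = (1 + par_t \<tau> / (x - y)) * Pw x y"
proof -
  have G: "Gamma_pm2 c y x = Gamma_pm2 c x y" for c
    by (simp add: Gamma_pm2_def algebra_simps)
  have ne: "x - y \<noteq> 0" "y - x \<noteq> 0" using assms by auto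
  have 1: "1 + par_t \<tau> / (y - x) = (par_t \<tau> - x + y) / (y - x)" "1 + par_t \<tau> / (x - y) = (par_t \<tau> - y + x) / (x - y)"
    using ne by (simp_all add: field_simps)
  have 2: "- y - x = - x - y" "par_t \<tau> - y - x = par_t \<tau> - x - y" by simp_all
  show ?thesis unfolding Pw_def G 1 2 unfolding divide_inverse inverse_mult_distrib by (simp only: mult_ac)
qed

lemma Pw_minus: "Pw x (- y) = Pw x y"
proof -
  have G: "Gamma_pm2 c x (- y) = Gamma_pm2 c x y" for c
    by (simp add: Gamma_pm2_def mult_ac)
  have 1: "par_t \<tau> - x + - y = par_t \<tau> - x - y" "par_t \<tau> - x - - y = par_t \<tau> - x + y"
    "- y - x = - x - y" "- x - - y = y - x" by simp_all
  show ?thesis unfolding Pw_def G 1 by (simp only: mult_ac)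
qed

text \<open>chi_n + d_n equals (a + x)(b + x)/(2x), the mirror image of the \<open>c_plus\<close>
  factor up to sign; the right-hand side is visibly even in x.\<close>

lemma Sg_minus:
  assumes "x \<noteq> 0"
  shows "(par_tn \<tau> + ((par_tn \<tau>)\<^sup>2 - (par_un \<tau>)\<^sup>2 + x\<^sup>2) / (2 * x)) * Sg x
    = (par_a \<tau> + x) * (par_b \<tau> + x) * (par_a \<tau> - x) * (par_b \<tau> - x) / (- 4 * x\<^sup>2) *
      (Gamma_pm (par_a \<tau>) x * Gamma_pm (par_b \<tau>) x * Gamma_pm (par_c \<tau>) x * Gamma_pm (par_d \<tau>) x / Gamma_pm 0 (2 * x))"
proof -
  have 1: "par_tn \<tau> + ((par_tn \<tau>)\<^sup>2 - (par_un \<tau>)\<^sup>2 + x\<^sup>2) / (2 * x) = (par_a \<tau> + x) * (par_b \<tau> + x) / (2 * x)"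
    using assms by (simp add: par_a_def par_b_def field_simps power2_eq_square)
  have 2: "(par_a \<tau> + x) * (par_b \<tau> + x) / (2 * x) * ((par_a \<tau> - x) * (par_b \<tau> - x) / (- 2 * x))
    = (par_a \<tau> + x) * (par_b \<tau> + x) * (par_a \<tau> - x) * (par_b \<tau> - x) / (- 4 * x\<^sup>2)"
    by (simp add: power2_eq_square)
  show ?thesis unfolding Sg_def 1 2[symmetric] by (simp only: mult_ac)
qed

lemma reflected_weight_gen:
  assumes "0 < i" "i \<le> n" "aff n i x \<noteq> 0"
  shows "reflected_weight i (gen n i x) = reflected_weight i x"
proof (cases "i = n")
  case True
  let ?x = "gen n n x"
  have xn: "x n \<noteq> 0" using assms True by (simp add: aff_def)
  have c: "?x n = - x n" "\<And>j. j \<noteq> n \<Longrightarrow> ?x j = x j" using n by (simp_all add: gen_def)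
  have P: "(\<Prod>j = 1..n. \<Prod>k = j + 1..n. Pw (?x j) (?x k)) = (\<Prod>j = 1..n. \<Prod>k = j + 1..n. Pw (x j) (x k))"
  proof (intro prod.cong refl)
    fix j k assume "j \<in> {1..n}" "k \<in> {j + 1..n}"
    then show "Pw (?x j) (?x k) = Pw (x j) (x k)"
      using c by (cases "k = n") (simp_all add: Pw_minus)
  qed
  have split: "(\<Prod>j = 1..n. Sg (z j)) = Sg (z n) * (\<Prod>j\<in>{1..n} - {n}. Sg (z j))" for z
    using n by (intro prod.remove) auto
  have S: "(\<Prod>j\<in>{1..n} - {n}. Sg (?x j)) = (\<Prod>j\<in>{1..n} - {n}. Sg (x j))"
    by (intro prod.cong refl) (simp add: c)
  let ?k = "\<lambda>z. par_tn \<tau> + ((par_tn \<tau>)\<^sup>2 - (par_un \<tau>)\<^sup>2 + z\<^sup>2) / (2 * z)"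
  have K: "?k (- x n) * Sg (- x n) = ?k (x n) * Sg (x n)"
  proof -
    have G: "Gamma_pm c (- z) = Gamma_pm c z" for c z by (simp add: Gamma_pm_def mult.commute)
    have "2 * - x n = - (2 * x n)" by simp
    then show ?thesis
      using Sg_minus[of "- x n"] Sg_minus[of "x n"] xn by (simp add: G)
  qed
  have k: "chi n \<tau> n + dcoef n \<tau> n z = ?k (z n)" for z using n by (simp add: chi_def dcoef_def)
  have r: "a * (b * (h * d)) = a' * (b * (h' * d))" if "a * h = a' * h'" for a b h d a' h' :: complex
    using arg_cong[OF that, of "\<lambda>w. w * (b * d)"] by (simp only: mult_ac)
  show ?thesis
    unfolding True reflected_weight_def Delta_eq P split S k c(1) by (rule r[OF K])
next
  case False
  then have i: "0 < i" "i < n" using assms by auto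
  let ?x = "gen n i x" and ?s = "Transposition.transpose i (i + 1)"
  let ?A = "SIGMA j:{1..n}. {j + 1..n}"
  have xs: "?x j = x (?s j)" for j using i by (simp add: gen_def Transposition.transpose_def)
  have ne: "x i \<noteq> x (i + 1)" using assms(3) i by (simp add: aff_def)
  have S: "(\<Prod>j = 1..n. Sg (?x j)) = (\<Prod>j = 1..n. Sg (x j))"
    by (rule prod.reindex_bij_witness[where i = ?s and j = ?s])
      (use i xs in \<open>auto simp: Transposition.transpose_def\<close>)
  \<comment> \<open>(i, i + 1) is the only pair whose order s_i reverses. All others are permuted
    with j < k preserved, which matters because \<open>Pw\<close> is not symmetric.\<close>
  have split: "(\<Prod>(j, k)\<in>?A. Pw (z j) (z k)) = Pw (z i) (z (i + 1)) * (\<Prod>(j, k)\<in>?A - {(i, i + 1)}. Pw (z j) (z k))" for z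
    using i by (subst prod.remove[of _ "(i, i + 1)"]) auto
  have R: "(\<Prod>(j, k)\<in>?A - {(i, i + 1)}. Pw (?x j) (?x k)) = (\<Prod>(j, k)\<in>?A - {(i, i + 1)}. Pw (x j) (x k))"
    by (rule prod.reindex_bij_witness[where i = "\<lambda>(j, k). (?s j, ?s k)" and j = "\<lambda>(j, k). (?s j, ?s k)"])
      (use i in \<open>auto simp: xs, auto simp: Transposition.transpose_def split: if_splits\<close>)
  have k: "chi n \<tau> i + dcoef n \<tau> i z = 1 + par_t \<tau> / (z i - z (i + 1))" for z
    using i by (simp add: chi_def dcoef_def)
  have c: "?x i = x (i + 1)" "?x (i + 1) = x i" using i by (simp_all add: gen_def)
  have "(1 + par_t \<tau> / (x (i + 1) - x i)) * Pw (x (i + 1)) (x i) = (1 + par_t \<tau> / (x i - x (i + 1))) * Pw (x i) (x (i + 1))"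
    by (rule Pw_swap[OF ne])
  moreover have "a * (b * h * d) = a' * (b' * h * d)" if "a * b = a' * b'" for a b h d a' b' :: complex
    using arg_cong[OF that, of "\<lambda>w. w * (h * d)"] by (simp only: mult_ac)
  ultimately show ?thesis
    unfolding reflected_weight_def Delta_pairs split R S k c by blast
qed

text \<open>Division by zero sets \<open>Pw\<close> and \<open>Sg\<close> to 0 on the walls, so the
  oddness of the integrand can be asserted at every point and not only almost everywhere.\<close>

lemma Delta_wall:
  assumes "0 < i" "i \<le> n" "aff n i x = 0"
  shows "Delta n \<tau> x = 0"
proof (cases "i = n")
  case True
  then have "Sg (x n) = 0" using assms by (simp add: aff_def Sg_0)
  then have "(\<Prod>j = 1..n. Sg (x j)) = 0" using n by (intro prod_zero) auto
  then show ?thesis by (simp add: Delta_eq)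
next
  case False
  then have "x (i + 1) - x i = 0" using assms by (simp add: aff_def)
  then have "Pw (x i) (x (i + 1)) = 0" by (simp add: Pw_def)
  then have "(\<Prod>(j, k)\<in>(SIGMA j:{1..n}. {j + 1..n}). Pw (x j) (x k)) = 0"
    using assms False by (intro prod_zero bexI[of _ "(i, i + 1)"]) auto
  then show ?thesis by (simp add: Delta_pairs)
qed

lemma T_antisymmetrization:
  assumes "i \<le> n" "f \<in> Pol n" "g \<in> Pol n" "aff n i x \<noteq> 0"
  shows "(T n \<tau> i f x * g x - f x * T n \<tau> i g x) * Delta n \<tau> x
    = reflected_weight i x * (f (gen n i x) * g x - f x * g (gen n i x))"
  unfolding T_props(2)[OF n1 assms(1,2,4)] T_props(2)[OF n1 assms(1,3,4)] reflected_weight_def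
  by (simp add: algebra_simps)

lemma T_symmetric_fin:
  assumes "0 < i" "i \<le> n" "f \<in> Pol n" "g \<in> Pol n"
  shows "(\<integral>y. (T n \<tau> i f (ix y) * g (ix y) - f (ix y) * T n \<tau> i g (ix y)) * Delta n \<tau> (ix y) \<partial>Rn n) = 0"
proof (rule integral_odd[OF assms(1,2)])
  have "(\<lambda>x. T n \<tau> i f x * g x - f x * T n \<tau> i g x) \<in> Pol n"
    by (intro Pol_minus Pol.Pol_mult T_props(1) n1 assms)
  from borel_measurable_times[OF Pol_measurable[OF this] Delta_measurable]
  show "(\<lambda>y. (T n \<tau> i f (ix y) * g (ix y) - f (ix y) * T n \<tau> i g (ix y)) * Delta n \<tau> (ix y)) \<in> borel_measurable (Rn n)" .
next
  fix y
  let ?h = "\<lambda>x. (T n \<tau> i f x * g x - f x * T n \<tau> i g x) * Delta n \<tau> x"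
  have "?h (gen n i x) = - ?h x" for x
  proof (cases "aff n i x = 0")
    case True
    then have "Delta n \<tau> (gen n i x) = 0" "Delta n \<tau> x = 0"
      using Delta_wall[OF assms(1,2)] aff_gen[OF n1 assms(2), of x] by simp_all
    then show ?thesis by simp
  next
    case False
    then have "aff n i (gen n i x) \<noteq> 0" using aff_gen[OF n1 assms(2), of x] by simp
    from T_antisymmetrization[OF assms(2-4) this]
    have "?h (gen n i x) = reflected_weight i x * (f x * g (gen n i x) - f (gen n i x) * g x)"
      unfolding gen_gen reflected_weight_gen[OF assms(1,2) False] .
    also have "\<dots> = - (reflected_weight i x * (f (gen n i x) * g x - f x * g (gen n i x)))"
      by (simp add: right_diff_distrib)
    also have "\<dots> = - ?h x" unfolding T_antisymmetrization[OF assms(2-4) False] ..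
    finally show ?thesis .
  qed
  then show "?h (ix (rgen n i y)) = - ?h (ix y)" unfolding ix_rgen[OF assms(1)] .
qed

lemma Gpair_holomorphic:
  assumes "\<delta> \<le> a"
  shows "Gpair a holomorphic_on {z. - \<delta> < Re z \<and> Re z < 1 + \<delta>}"
  unfolding Gpair_def[abs_def]
  by (intro holomorphic_intros) (use assms in \<open>auto elim!: nonpos_Ints_cases' simp: complex_eq_iff\<close>)

lemma Pol_line_holomorphic: "p \<in> Pol n \<Longrightarrow> (\<lambda>z. p (x(1 := z))) holomorphic_on A"
proof (induction rule: Pol.induct)
  case (Pol_var i)
  show ?case by (cases "i = 1") (auto intro!: holomorphic_intros)
qed (auto intro!: holomorphic_intros)

text \<open>The other coordinates stay imaginary, so the shifts by X_k inside \<open>Epair\<close>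
  leave real parts unchanged and no pole enters the strip.\<close>

lemma T_symmetric_line:
  assumes "f \<in> Pol n" "g \<in> Pol n" "\<And>j. j \<noteq> 1 \<Longrightarrow> Re (X j) = 0"
  shows "(\<integral>s. (let x = X(1 := \<i> * of_real s) in
     (T n \<tau> 0 f x * g x - f x * T n \<tau> 0 g x) * Delta n \<tau> x) \<partial>lborel) = 0"
proof -
  let ?xx = "\<lambda>z. X(1 := z)"
  \<comment> \<open>All Gamma factors are free of poles for -\<delta> < Re z < 1 + \<delta>, an open
    neighbourhood of the closed strip.\<close>
  define \<delta> where "\<delta> = Min {rt, ra, rb, rc, rd}"
  have \<delta>: "0 < \<delta>" "\<delta> \<le> rt" "\<delta> \<le> ra" "\<delta> \<le> rb" "\<delta> \<le> rc" "\<delta> \<le> rd"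
    using real_pos by (auto simp: \<delta>_def)
  let ?D = "{z. - \<delta> < Re z \<and> Re z < 1 + \<delta>}"
  define Q where "Q z = f (?xx (1 - z)) * g (?xx z) - f (?xx z) * g (?xx (1 - z))" for z
  define E where "E z = (\<Prod>k = 2..n. Epair rt (z + X k) * Epair rt (z + - X k))" for z
  define \<Phi> where "\<Phi> z = Q z * E z * Hs z" for z
  define c where "c = (\<Prod>j = 2..n. \<Prod>k = j + 1..n. Pw (X j) (X k)) * (\<Prod>j = 2..n. Sg (X j))"
  have gen0: "gen n 0 (?xx z) = ?xx (1 - z)" for z by (simp add: gen_def)
  have f': "(\<lambda>x. f (gen n 0 x)) \<in> Pol n" "(\<lambda>x. g (gen n 0 x)) \<in> Pol n"
    by (intro gen_Pol n1 assms; simp)+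
  have gQ: "growth 0 Q"
  proof -
    have "growth (0 + 0) (\<lambda>z. f (gen n 0 (?xx z)) * g (?xx z))" "growth (0 + (0 + 0)) (\<lambda>z. (-1) * (f (?xx z) * g (gen n 0 (?xx z))))"
      by (intro growth_mult growth_const growth_Pol[OF f'(1)] growth_Pol[OF f'(2)] growth_Pol[OF assms(1)] growth_Pol[OF assms(2)])+
    then have "growth 0 (\<lambda>z. f (gen n 0 (?xx z)) * g (?xx z) + (-1) * (f (?xx z) * g (gen n 0 (?xx z))))"
      by (intro growth_add) simp_all
    then show ?thesis unfolding Q_def[abs_def] gen0 by simp
  qed
  have gE: "growth 0 E"
    unfolding E_def
  proof (rule growth_prod)
    fix k assume "k \<in> {2..n}"
    then have "Re (X k) = 0" by (intro assms(3)) auto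
    then have "growth (0 + 0) (\<lambda>z. Epair rt (z + X k) * Epair rt (z + - X k))"
      by (intro growth_mult growth_Epair real_pos) auto
    then show "growth 0 (\<lambda>z. Epair rt (z + X k) * Epair rt (z + - X k))" by simp
  qed
  have "growth (0 + 0 + 2 * pi) \<Phi>"
    unfolding \<Phi>_def by (intro growth_mult gQ gE growth_Hs)
  then obtain C N where C: "0 \<le> C" "\<And>z. z \<in> pole_free \<Longrightarrow> cmod (\<Phi> z) \<le> C * (1 + \<bar>Im z\<bar>) ^ N * exp (- (2 * pi) * \<bar>Im z\<bar>)"
    unfolding growth_def by auto
  have hol: "\<Phi> holomorphic_on ?D"
  proof -
    have hQ: "Q holomorphic_on ?D"
    proof -
      have "(\<lambda>z. f (?xx (1 - z))) holomorphic_on ?D" "(\<lambda>z. g (?xx (1 - z))) holomorphic_on ?D"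
        using Pol_line_holomorphic[OF f'(1), of X ?D] Pol_line_holomorphic[OF f'(2), of X ?D]
        unfolding gen0 by simp_all
      then show ?thesis
        unfolding Q_def[abs_def] by (intro holomorphic_on_diff holomorphic_on_mult Pol_line_holomorphic assms)
    qed
    have sh: "(\<lambda>z. Epair rt (z + c)) holomorphic_on ?D" if "Re c = 0" for c
    proof -
      have "Epair rt holomorphic_on ?D"
        unfolding Epair_def[abs_def] using pi_neq_zero
        by (intro holomorphic_intros Gpair_holomorphic \<delta>) auto
      moreover have "(\<lambda>z. z + c) holomorphic_on ?D" by (intro holomorphic_intros)
      ultimately have "Epair rt \<circ> (\<lambda>z. z + c) holomorphic_on ?D"
        using that by (intro holomorphic_on_compose_gen) auto
      then show ?thesis by (simp add: o_def)
    qed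
    have hE: "E holomorphic_on ?D"
      unfolding E_def by (intro holomorphic_intros sh) (use assms(3) in auto)
    have hH: "Hs holomorphic_on ?D"
      unfolding Hs_def[abs_def] by (intro holomorphic_intros Gpair_holomorphic \<delta>)
    show ?thesis unfolding \<Phi>_def by (intro holomorphic_intros hQ hE hH)
  qed
  have anti: "\<Phi> (1 - z) = - \<Phi> z" for z
  proof -
    have "Epair rt (1 - z + X k) * Epair rt (1 - z + - X k) = Epair rt (z + X k) * Epair rt (z + - X k)" for k
      using Epair_reflect[of rt "z + - X k"] Epair_reflect[of rt "z + X k"] by (simp add: algebra_simps)
    then have "E (1 - z) = E z" unfolding E_def by (intro prod.cong refl)
    moreover have "Q (1 - z) = - Q z" unfolding Q_def by simp
    ultimately show ?thesis unfolding \<Phi>_def Hs_reflect by simp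
  qed
  have int: "integrable lborel (\<lambda>s. \<Phi> (\<i> * of_real s))"
  proof (rule Bochner_Integration.integrable_bound)
    have "integrable lborel (\<lambda>y. (1 + \<bar>y\<bar>) ^ N * exp (- (1 + (2 * pi - 1)) * \<bar>y\<bar>))"
      by (rule integrable_poly_exp) (use pi_gt3 in simp)
    then show "integrable lborel (\<lambda>y. C * ((1 + \<bar>y\<bar>) ^ N * exp (- (1 + (2 * pi - 1)) * \<bar>y\<bar>)))" by simp
    have "continuous_on UNIV (\<lambda>s :: real. \<Phi> (\<i> * of_real s))"
      by (rule continuous_on_compose2[OF holomorphic_on_imp_continuous_on[OF hol]])
        (use \<delta> in \<open>auto intro!: continuous_intros\<close>)
    then show "(\<lambda>s. \<Phi> (\<i> * of_real s)) \<in> borel_measurable lborel"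
      by (simp add: borel_measurable_continuous_onI)
    show "AE y in lborel. norm (\<Phi> (\<i> * of_real y)) \<le> norm (C * ((1 + \<bar>y\<bar>) ^ N * exp (- (1 + (2 * pi - 1)) * \<bar>y\<bar>)))"
    proof (rule AE_I2)
      fix y :: real
      have "cmod (\<Phi> (\<i> * of_real y)) \<le> C * ((1 + \<bar>y\<bar>) ^ N * exp (- (1 + (2 * pi - 1)) * \<bar>y\<bar>))"
        using C(2)[of "\<i> * of_real y"] by (simp add: pole_free_def mult.assoc)
      then show "norm (\<Phi> (\<i> * of_real y)) \<le> norm (C * ((1 + \<bar>y\<bar>) ^ N * exp (- (1 + (2 * pi - 1)) * \<bar>y\<bar>)))"
        by (simp add: abs_of_nonneg C(1))
    qed
  qed
  have zero: "(\<integral>s. \<Phi> (\<i> * of_real s) \<partial>lborel) = 0"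
  proof (rule integral_antisymmetric_strip[OF hol \<delta>(1) anti _ tendsto_power_exp int])
    fix z assume "0 \<le> Re z" "Re z \<le> 1" "1 \<le> \<bar>Im z\<bar>"
    then show "cmod (\<Phi> z) \<le> C * (1 + \<bar>Im z\<bar>) ^ N * exp (- (2 * pi) * \<bar>Im z\<bar>)"
      by (intro C(2)) (simp add: pole_free_def)
  qed
  have D1: "Delta n \<tau> (?xx z) = (\<Prod>k = 2..n. Pw z (X k)) * Sg z * c" for z
  proof -
    have 1: "{1..n} = insert 1 {2..n}" using n by auto
    have a: "(\<Prod>k = 1 + 1..n. Pw (?xx z 1) (?xx z k)) = (\<Prod>k = 2..n. Pw z (X k))"
      by (intro prod.cong) auto
    have b: "(\<Prod>j = 2..n. \<Prod>k = j + 1..n. Pw (?xx z j) (?xx z k)) = (\<Prod>j = 2..n. \<Prod>k = j + 1..n. Pw (X j) (X k))"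
      by (intro prod.cong refl) auto
    have d: "(\<Prod>j = 2..n. Sg (?xx z j)) = (\<Prod>j = 2..n. Sg (X j))"
      by (intro prod.cong refl) auto
    have i: "(\<Prod>j = 1..n. h j) = h 1 * (\<Prod>j = 2..n. h j)" for h :: "nat \<Rightarrow> complex"
      unfolding 1 by simp
    show ?thesis unfolding Delta_eq i a b d c_def by (simp only: fun_upd_same mult_ac)
  qed
  \<comment> \<open>The finitely many s with z = 0, z = X_k or z = -X_k are discarded as a null set;
    away from them \<open>Pw_eq\<close> and \<open>Sg_eq\<close> give the analytic
    expressions.\<close>
  let ?bad = "insert 0 (Im ` X ` {2..n} \<union> (\<lambda>k. - Im (X k)) ` {2..n})"
  have good: "(let x = ?xx (\<i> * of_real s) in (T n \<tau> 0 f x * g x - f x * T n \<tau> 0 g x) * Delta n \<tau> x)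
      = c * \<Phi> (\<i> * of_real s)" if s: "s \<notin> ?bad" for s
  proof -
    let ?z = "\<i> * of_real s"
    have z0: "?z \<noteq> 0" "Re ?z = 0" using s by auto
    have P: "Pw ?z (X k) = Epair rt (?z + X k) * Epair rt (?z + - X k)" if "k \<in> {2..n}" for k
    proof -
      have "Re (X k) = 0" using that by (intro assms(3)) auto
      moreover have "?z \<noteq> X k" "?z \<noteq> - X k" using s that by (auto simp: complex_eq_iff image_iff)
      ultimately show ?thesis using Pw_eq[of ?z "X k"] by simp
    qed
    have PE: "(\<Prod>k = 2..n. Pw ?z (X k)) = E ?z" unfolding E_def by (intro prod.cong refl P)
    have a: "aff n 0 (?xx ?z) \<noteq> 0" by (auto simp: aff_def complex_eq_iff)
    have ne: "1 - 2 * ?z \<noteq> 0" by (auto simp: complex_eq_iff)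
    have chi: "chi n \<tau> 0 + dcoef n \<tau> 0 (?xx ?z) = (par_c \<tau> - ?z) * (par_d \<tau> - ?z) / (1 - 2 * ?z)"
      unfolding chi_def dcoef_def par_c_def par_d_def using ne
      by (simp add: field_simps power2_eq_square)
    have "reflected_weight 0 (?xx ?z) = E ?z * c * ((par_c \<tau> - ?z) * (par_d \<tau> - ?z) / (1 - 2 * ?z) * Sg ?z)"
      unfolding reflected_weight_def D1 PE chi by (simp only: mult_ac)
    also have "\<dots> = E ?z * c * Hs ?z" unfolding Sg_eq[OF z0(2,1)] ..
    finally have R: "reflected_weight 0 (?xx ?z) = E ?z * c * Hs ?z" .
    show ?thesis
      unfolding Let_def T_antisymmetrization[OF le0 assms(1,2) a] R gen0 \<Phi>_def Q_def by (simp only: mult_ac)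
  qed
  have "(\<integral>s. (let x = ?xx (\<i> * of_real s) in (T n \<tau> 0 f x * g x - f x * T n \<tau> 0 g x) * Delta n \<tau> x) \<partial>lborel)
      = (\<integral>s. c * \<Phi> (\<i> * of_real s) \<partial>lborel)"
    by (rule integral_discrete_difference[where X = ?bad])
      (simp, simp, simp, rule good)
  also have "\<dots> = 0" using zero by simp
  finally show ?thesis .
qed

text \<open>Fubini with x_1 as the inner variable, justified by \<open>Delta_integrable\<close>;
  already the inner integral vanishes.\<close>

lemma T_symmetric_zero:
  assumes "f \<in> Pol n" "g \<in> Pol n"
  shows "(\<integral>y. (T n \<tau> 0 f (ix y) * g (ix y) - f (ix y) * T n \<tau> 0 g (ix y)) * Delta n \<tau> (ix y) \<partial>Rn n) = 0"
proof -
  let ?h = "\<lambda>y. (T n \<tau> 0 f (ix y) * g (ix y) - f (ix y) * T n \<tau> 0 g (ix y)) * Delta n \<tau> (ix y)"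
  have inner: "(\<integral>s. ?h (y(1 := s)) \<partial>lborel) = 0" for y
  proof -
    have "ix (y(1 := s)) = (ix y)(1 := \<i> * of_real s)" for s by (auto simp: ix_def)
    then show ?thesis using T_symmetric_line[OF assms, of "ix y"] by (simp add: Let_def)
  qed
  have I: "{1..n} = insert 1 {2..n}" using n by auto
  have "(\<lambda>x. T n \<tau> 0 f x * g x - f x * T n \<tau> 0 g x) \<in> Pol n"
    by (intro Pol_minus Pol.Pol_mult T_props(1) n1 assms) auto
  from Delta_integrable[OF this] have "integrable (\<Pi>\<^sub>M j\<in>insert 1 {2..n}. lborel) ?h"
    unfolding Rn_def I .
  from lb.product_integral_insert[OF _ _ this]
  have "(\<integral>y. ?h y \<partial>Rn n) = (\<integral>y. (\<integral>s. ?h (y(1 := s)) \<partial>lborel) \<partial>(\<Pi>\<^sub>M j\<in>{2..n}. lborel))"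
    unfolding Rn_def I by simp
  then show ?thesis unfolding inner by simp
qed

section \<open>Symmetry of the operators \<open>Y n \<tau> i\<close> and orthogonality\<close>

lemma form_eq: "form n \<tau> f g = 1 / (2 * of_real pi * \<i>) ^ n * (\<i> ^ n * (\<integral>y. f (ix y) * g (ix y) * Delta n \<tau> (ix y) \<partial>Rn n))"
  by (simp add: form_def ix_def[abs_def] Rn_def Let_def)

lemma form_integrable: "f \<in> Pol n \<Longrightarrow> g \<in> Pol n \<Longrightarrow> integrable (Rn n) (\<lambda>y. f (ix y) * g (ix y) * Delta n \<tau> (ix y))"
  by (rule Delta_integrable[OF Pol.Pol_mult])

lemma T_symmetric:
  assumes "i \<le> n" "f \<in> Pol n" "g \<in> Pol n"
  shows "form n \<tau> (T n \<tau> i f) g = form n \<tau> f (T n \<tau> i g)"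
proof -
  have "(\<integral>y. (T n \<tau> i f (ix y) * g (ix y) - f (ix y) * T n \<tau> i g (ix y)) * Delta n \<tau> (ix y) \<partial>Rn n) = 0"
    using T_symmetric_fin[OF _ assms] T_symmetric_zero[OF assms(2,3)] by (cases "i = 0") auto
  moreover have "(\<integral>y. (T n \<tau> i f (ix y) * g (ix y) - f (ix y) * T n \<tau> i g (ix y)) * Delta n \<tau> (ix y) \<partial>Rn n)
    = (\<integral>y. T n \<tau> i f (ix y) * g (ix y) * Delta n \<tau> (ix y) \<partial>Rn n) - (\<integral>y. f (ix y) * T n \<tau> i g (ix y) * Delta n \<tau> (ix y) \<partial>Rn n)"
    unfolding left_diff_distrib
    by (intro Bochner_Integration.integral_diff form_integrable T_props(1) n1 assms)
  ultimately show ?thesis by (simp add: form_eq)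
qed

lemma foldr_T_symmetric:
  assumes "set is \<subseteq> {0..n}" "f \<in> Pol n" "g \<in> Pol n"
  shows "form n \<tau> (foldr (T n \<tau>) is f) g = form n \<tau> f (foldr (T n \<tau>) (rev is) g)"
  using assms(1,3)
proof (induction "is" arbitrary: g)
  case (Cons i "is")
  then have i: "i \<le> n" "set is \<subseteq> {0..n}" by auto
  have "form n \<tau> (T n \<tau> i (foldr (T n \<tau>) is f)) g = form n \<tau> (foldr (T n \<tau>) is f) (T n \<tau> i g)"
    using foldr_T_Pol[OF n1 i(2) assms(2)] by (intro T_symmetric i Cons.prems) auto
  also have "\<dots> = form n \<tau> f (foldr (T n \<tau>) (rev is) (T n \<tau> i g))"
    by (intro Cons.IH i T_props(1) n1 Cons.prems)
  finally show ?case by simp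
qed simp

lemma form_add_left:
  assumes "f \<in> Pol n" "f' \<in> Pol n" "g \<in> Pol n"
  shows "form n \<tau> (\<lambda>x. f x + f' x) g = form n \<tau> f g + form n \<tau> f' g"
  using Bochner_Integration.integral_add[OF form_integrable[OF assms(1,3)] form_integrable[OF assms(2,3)]]
  by (simp add: form_eq distrib_right distrib_left)

lemma form_commute: "form n \<tau> f g = form n \<tau> g f"
  by (simp add: form_eq mult.commute)

lemma form_scale: "form n \<tau> (\<lambda>x. c * f x) g = c * form n \<tau> f g"
  by (simp add: form_eq mult_ac)

lemma form_sum_left:
  assumes "\<And>a. a \<in> A \<Longrightarrow> f a \<in> Pol n" "g \<in> Pol n"
  shows "form n \<tau> (\<lambda>x. \<Sum>a\<in>A. f a x) g = (\<Sum>a\<in>A. form n \<tau> (f a) g)"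
proof (cases "finite A")
  case True
  then show ?thesis using assms(1)
  proof (induction A rule: finite_induct)
    case empty
    then show ?case by (simp add: form_eq)
  next
    case (insert a A)
    then show ?case using form_add_left[of "f a" "\<lambda>x. \<Sum>a\<in>A. f a x" g] Pol_sum[of A f n] assms(2) by simp
  qed
next
  case False
  then show ?thesis by (simp add: form_eq)
qed

lemma Y_symmetric:
  assumes "i \<in> {1..n}" "f \<in> Pol n" "g \<in> Pol n"
  shows "form n \<tau> (Y n \<tau> i f) g = form n \<tau> f (Y n \<tau> i g)"
proof -
  let ?P = "[i..<n] @ [n] @ rev [i..<n]" and ?Q = "rev [1..<i] @ [0] @ [1..<i]"
  let ?R = "\<lambda>j. [i..<j - 1] @ [j - 1] @ rev [i..<j - 1]"
  have s: "set ?P \<subseteq> {0..n}" "set ?Q \<subseteq> {0..n}" "\<And>j. j \<in> {i + 1..n} \<Longrightarrow> set (?R j) \<subseteq> {0..n}"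
    using assms(1) by auto
  \<comment> \<open>All words in Y_i are palindromes, so passing to the other argument of the form,
    which reverses a word, leaves each of them fixed.\<close>
  have r: "rev ?P = ?P" "rev ?Q = ?Q" "\<And>j. rev (?R j) = ?R j" by simp_all
  have pol: "foldr (T n \<tau>) ?P h \<in> Pol n" "foldr (T n \<tau>) ?Q h \<in> Pol n"
    "\<And>j. j \<in> {i + 1..n} \<Longrightarrow> foldr (T n \<tau>) (?R j) h \<in> Pol n" if "h \<in> Pol n" for h
    using foldr_T_Pol[OF n1 _ that] s by blast+
  have expand: "form n \<tau> (Y n \<tau> i h) k = form n \<tau> (foldr (T n \<tau>) ?P h) k + form n \<tau> (foldr (T n \<tau>) ?Q h) k
      + par_t \<tau> * (\<Sum>j = i + 1..n. form n \<tau> (foldr (T n \<tau>) (?R j) h) k)" if "h \<in> Pol n" "k \<in> Pol n" for h k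
  proof -
    have p: "(\<lambda>x. \<Sum>j = i + 1..n. foldr (T n \<tau>) (?R j) h x) \<in> Pol n"
      by (intro Pol_sum pol that)
    show ?thesis unfolding Y_def T2_def
      by (subst form_add_left, intro Pol.intros pol that, intro Pol.intros pol p that, rule that,
          subst form_add_left, intro pol that, intro pol that, rule that,
          simp only: form_scale form_sum_left[OF pol(3)[OF that(1)] that(2)])
  qed
  have eq: "form n \<tau> (foldr (T n \<tau>) is f) g = form n \<tau> (foldr (T n \<tau>) is g) f"
    if "set is \<subseteq> {0..n}" "rev is = is" for "is"
    using foldr_T_symmetric[OF that(1) assms(2,3)] that(2) form_commute by simp
  have "form n \<tau> (Y n \<tau> i f) g = form n \<tau> (Y n \<tau> i g) f"
    unfolding expand[OF assms(2,3)] expand[OF assms(3,2)] eq[OF s(1) r(1)] eq[OF s(2) r(2)]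
    by (intro arg_cong2[of _ _ _ _ "(+)"] refl arg_cong[of _ _ "\<lambda>c. par_t \<tau> * c"] sum.cong eq s(3) r(3))
  then show ?thesis using form_commute by simp
qed

text \<open>The form is bilinear without conjugation, so by symmetry of Y_j both eigenvalues
  multiply the form to the same number.\<close>

lemma good_orthogonal:
  assumes "\<mu> \<in> Lam n" "\<nu> \<in> Lam n" "gamma n \<tau> \<mu> \<noteq> gamma n \<tau> \<nu>" "good \<mu> p" "good \<nu> q"
  shows "form n \<tau> p q = 0"
proof -
  obtain j where j: "j \<in> {1..n}" "gamma n \<tau> \<mu> j \<noteq> gamma n \<tau> \<nu> j" using gamma_ne_coord[OF assms(1-3)] by blast
  have p: "p \<in> Pol n" "Y n \<tau> j p = (\<lambda>x. gamma n \<tau> \<mu> j * p x)" and q: "q \<in> Pol n" "Y n \<tau> j q = (\<lambda>x. gamma n \<tau> \<nu> j * q x)"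
    using assms(4,5) j(1) by (auto simp: good_def eigenfun_def)
  have "gamma n \<tau> \<mu> j * form n \<tau> p q = form n \<tau> (Y n \<tau> j p) q" unfolding p(2) form_scale ..
  also have "\<dots> = form n \<tau> (Y n \<tau> j q) p" using Y_symmetric[OF j(1) p(1) q(1)] form_commute by simp
  also have "\<dots> = gamma n \<tau> \<nu> j * form n \<tau> p q" unfolding q(2) form_scale using form_commute by simp
  finally show ?thesis using j(2) by simp
qed

end

theorem theorem5p8:
  fixes n :: nat and \<tau> :: wilson_params
  assumes "n \<ge> 2"
    and "par_a \<tau> > 0" and "par_b \<tau> > 0" and "par_c \<tau> > 0" and "par_d \<tau> > 0" and "par_t \<tau> > 0"
    and "\<forall>\<mu> \<in> Lam n. \<forall>\<nu> \<in> Lam n. \<mu> \<noteq> \<nu> \<longrightarrow> gamma n \<tau> \<mu> \<noteq> gamma n \<tau> \<nu>"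
  shows "inj_on (wilson_poly n \<tau>) (Lam n)
    \<and> cfun.independent (wilson_poly n \<tau> ` Lam n)
    \<and> cfun.span (wilson_poly n \<tau> ` Lam n) = Pol n
    \<and> (\<forall>\<mu> \<in> Lam n. \<forall>\<nu> \<in> Lam n. \<mu> \<noteq> \<nu> \<longrightarrow>
         form n \<tau> (wilson_poly n \<tau> \<mu>) (wilson_poly n \<tau> \<nu>) = 0)"
proof -
  interpret positive_params n \<tau>
    by unfold_locales (use assms in auto)
  have inj: "inj_on (gamma n \<tau>) (Lam n)"
    using assms(7) unfolding inj_on_def by blast
  show ?thesis
    using good_inj[OF inj good_wilson] good_cfun_independent[OF inj good_wilson] good_basis[OF inj good_wilson]
      good_orthogonal good_wilson assms(7) by blast
qed

end
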